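(* Let $d\ge 2$, let $p>q\ge 2$, let $D\subset\mathbb{R}^d$ be a ball, and let $c\in(0,|D|)$. Then the problem $$\min\{\lambda_1(\Omega):\ \Omega\in\mathcal{A},\ |\Omega|\le c\},\qquad \mathcal{A}=\{\Omega\subseteq D:\ \Omega \text{ is quasi-open}\},$$ admits at least one solution.
   Context: $|\cdot|$ is Lebesgue measure. cap denotes the Sobolev $p$-capacity: for a compact set $K$ contained in a ball $B$, $\mathrm{cap}(K,B)=\inf\{\int_B|\nabla\varphi|^p dx:\ \varphi\in C_c^\infty(B),\ \varphi\ge 1 \text{ on } K\}$, extended to general sets in the usual way. A property holds $p$-quasi everywhere ($p$-q.e.) if it holds outside a set of $p$-capacity zero. A set $\Omega\subset\mathbb{R}^d$ is quasi-open if for every $\epsilon>0$ there is an open set $\Omega_\epsilon\supseteq\Omega$ with $\mathrm{cap}(\Omega_\epsilon\setminus\Omega)<\epsilon$. Every Sobolev function is identified with its $p$-quasi-continuous representative. For quasi-open $\Omega\subseteq D$, $W^{1,p}_0(\Omega)=\{u\in W^{1,p}_0(D): u=0\ p\text{-q.e. on } D\setminus\Omega\}$, and $$\lambda_1(\Omega)=\inf_{\phi\in W^{1,p}_0(\Omega)\setminus\{0\}}\frac{\frac1p\int_\Omega|\nabla\phi|^p dx+\frac12\int_\Omega|\nabla\phi|^2dx}{\frac1q\int_\Omega|\phi|^q dx}.$$ *)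

theory Defs
  imports "HOL-Analysis.Analysis"
begin

section \<open>Test functions\<close>

definition gradient :: "('a::euclidean_space \<Rightarrow> real) \<Rightarrow> 'a \<Rightarrow> 'a" where
  "gradient f x = (THE v. GDERIV f x :> v)"

primrec Ck :: "nat \<Rightarrow> ('a::euclidean_space \<Rightarrow> real) \<Rightarrow> bool" where
  "Ck 0 f \<longleftrightarrow> continuous_on UNIV f"
| "Ck (Suc k) f \<longleftrightarrow>
     (\<exists>G. (\<forall>x. GDERIV f x :> G x) \<and> (\<forall>i\<in>Basis. Ck k (\<lambda>x. G x \<bullet> i)))"

text \<open>Functions in $C_c^\infty(U)$ are represented by their extension by zero to the
  whole space.\<close>

definition Cc_infinity :: "'a::euclidean_space set \<Rightarrow> ('a \<Rightarrow> real) set" where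
  "Cc_infinity U = {f. (\<forall>k. Ck k f) \<and>
     compact (closure {x. f x \<noteq> 0}) \<and> closure {x. f x \<noteq> 0} \<subseteq> U}"

section \<open>Sobolev p-capacity\<close>

text \<open>Capacity is taken relative to a fixed ball B: first for compact sets, then for open
  sets by inner and for arbitrary sets by outer approximation. Both infima are \<open>top\<close> when
  nothing is admissible; in particular only subsets of B can have finite capacity. One cannot
  let B range over all balls, since for p at least the dimension the infimum over all balls
  of the capacity of a bounded set is zero.\<close>

definition cap_compact :: "real \<Rightarrow> 'a::euclidean_space set \<Rightarrow> 'a set \<Rightarrow> ennreal" where
  "cap_compact p B K =
     (INF \<phi>\<in>{\<phi> \<in> Cc_infinity B. \<forall>x\<in>K. 1 \<le> \<phi> x}.
        \<integral>\<^sup>+x. ennreal (norm (gradient \<phi> x) powr p) \<partial>lebesgue_on B)"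

definition cap_open :: "real \<Rightarrow> 'a::euclidean_space set \<Rightarrow> 'a set \<Rightarrow> ennreal" where
  "cap_open p B U = (SUP K\<in>{K. compact K \<and> K \<subseteq> U}. cap_compact p B K)"

definition cap :: "real \<Rightarrow> 'a::euclidean_space set \<Rightarrow> 'a set \<Rightarrow> ennreal" where
  "cap p B E = (INF U\<in>{U. open U \<and> E \<subseteq> U \<and> U \<subseteq> B}. cap_open p B U)"

definition quasi_everywhere ::
    "real \<Rightarrow> 'a::euclidean_space set \<Rightarrow> 'a set \<Rightarrow> ('a \<Rightarrow> bool) \<Rightarrow> bool" where
  "quasi_everywhere p B S P \<longleftrightarrow> cap p B {x \<in> S. \<not> P x} = 0"

definition quasi_open :: "real \<Rightarrow> 'a::euclidean_space set \<Rightarrow> 'a set \<Rightarrow> bool" where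
  "quasi_open p B \<Omega> \<longleftrightarrow>
     (\<forall>\<epsilon>::real. \<epsilon> > 0 \<longrightarrow> (\<exists>U. open U \<and> \<Omega> \<subseteq> U \<and> cap p B (U - \<Omega>) < ennreal \<epsilon>))"

definition quasi_continuous_on ::
    "real \<Rightarrow> 'a::euclidean_space set \<Rightarrow> 'a set \<Rightarrow> ('a \<Rightarrow> real) \<Rightarrow> bool" where
  "quasi_continuous_on p B D u \<longleftrightarrow>
     (\<forall>\<epsilon>::real. \<epsilon> > 0 \<longrightarrow>
        (\<exists>G. open G \<and> cap p B G < ennreal \<epsilon> \<and> continuous_on (D - G) u))"

section \<open>Sobolev spaces\<close>

text \<open>Elements of the spaces below are pointwise defined functions; only their values on the
  underlying domain matter, and the \<open>L\<^sup>p\<close> and \<open>W\<^sup>1\<^sup>,\<^sup>p\<close>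
  spaces contain all representatives of each class.\<close>

definition Lp :: "real \<Rightarrow> 'a::euclidean_space set \<Rightarrow> ('a \<Rightarrow> 'b::euclidean_space) set" where
  "Lp p D = {f. f \<in> borel_measurable (lebesgue_on D) \<and>
     integrable (lebesgue_on D) (\<lambda>x. norm (f x) powr p)}"

definition locally_integrable ::
    "'a::euclidean_space set \<Rightarrow> ('a \<Rightarrow> 'b::euclidean_space) \<Rightarrow> bool" where
  "locally_integrable D f \<longleftrightarrow>
     (\<forall>K. compact K \<and> K \<subseteq> D \<longrightarrow> integrable (lebesgue_on K) f)"

definition has_weak_gradient ::
    "'a::euclidean_space set \<Rightarrow> ('a \<Rightarrow> real) \<Rightarrow> ('a \<Rightarrow> 'a) \<Rightarrow> bool" where
  "has_weak_gradient D u g \<longleftrightarrow>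
     locally_integrable D u \<and> locally_integrable D g \<and>
     (\<forall>\<phi>\<in>Cc_infinity D.
        (\<integral>x. u x *\<^sub>R gradient \<phi> x \<partial>lebesgue_on D) =
        - (\<integral>x. \<phi> x *\<^sub>R g x \<partial>lebesgue_on D))"

text \<open>The weak gradient is determined almost everywhere, so the choice is immaterial under
  integrals.\<close>

definition weak_gradient :: "'a::euclidean_space set \<Rightarrow> ('a \<Rightarrow> real) \<Rightarrow> 'a \<Rightarrow> 'a" where
  "weak_gradient D u = (SOME g. has_weak_gradient D u g)"

definition W1 :: "real \<Rightarrow> 'a::euclidean_space set \<Rightarrow> ('a \<Rightarrow> real) set" where
  "W1 p D = {u \<in> Lp p D. \<exists>g\<in>Lp p D. has_weak_gradient D u g}"

definition W1_norm :: "real \<Rightarrow> 'a::euclidean_space set \<Rightarrow> ('a \<Rightarrow> real) \<Rightarrow> real" where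
  "W1_norm p D u =
     ((\<integral>x. \<bar>u x\<bar> powr p \<partial>lebesgue_on D) +
      (\<integral>x. norm (weak_gradient D u x) powr p \<partial>lebesgue_on D)) powr (1 / p)"

definition W1_0 :: "real \<Rightarrow> 'a::euclidean_space set \<Rightarrow> ('a \<Rightarrow> real) set" where
  "W1_0 p D = {u \<in> W1 p D. \<exists>\<phi>. (\<forall>n::nat. \<phi> n \<in> Cc_infinity D) \<and>
     (\<lambda>n. W1_norm p D (\<lambda>x. u x - \<phi> n x)) \<longlonglongrightarrow> 0}"

text \<open>\<open>W1_0_quasi p B D \<Omega>\<close> is the space $W^{1,p}_0(\Omega)$ for quasi-open
  \<open>\<Omega>\<close> inside D. As the boundary condition is pointwise up to capacity zero, only
  quasi-continuous representatives are admitted.\<close>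

definition W1_0_quasi ::
    "real \<Rightarrow> 'a::euclidean_space set \<Rightarrow> 'a set \<Rightarrow> 'a set \<Rightarrow> ('a \<Rightarrow> real) set" where
  "W1_0_quasi p B D \<Omega> = {u \<in> W1_0 p D. quasi_continuous_on p B D u \<and>
     quasi_everywhere p B (D - \<Omega>) (\<lambda>x. u x = 0)}"

section \<open>The first eigenvalue\<close>

text \<open>The value is infinite if the space contains only zero, e.g. for empty
  \<open>\<Omega>\<close>. Being nonzero is meant in the Sobolev space, i.e. modulo null sets.\<close>

definition lambda1 ::
    "real \<Rightarrow> real \<Rightarrow> 'a::euclidean_space set \<Rightarrow> 'a set \<Rightarrow> 'a set \<Rightarrow> ereal" where
  "lambda1 p q B D \<Omega> =
     (INF \<phi>\<in>{\<phi> \<in> W1_0_quasi p B D \<Omega>. \<not> (AE x in lebesgue_on D. \<phi> x = 0)}.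
        ereal (((1 / p) * (\<integral>x. norm (weak_gradient D \<phi> x) powr p \<partial>lebesgue_on \<Omega>) +
                (1 / 2) * (\<integral>x. (norm (weak_gradient D \<phi> x))\<^sup>2 \<partial>lebesgue_on \<Omega>)) /
               ((1 / q) * (\<integral>x. \<bar>\<phi> x\<bar> powr q \<partial>lebesgue_on \<Omega>))))"

text \<open>Quasi-open subsets of D are Lebesgue measurable, since capacity controls outer measure;
  hence measurability is not required separately.\<close>

definition quasi_open_subsets ::
    "real \<Rightarrow> 'a::euclidean_space set \<Rightarrow> 'a set \<Rightarrow> 'a set set" where
  "quasi_open_subsets p B D = {\<Omega>. \<Omega> \<subseteq> D \<and> quasi_open p B \<Omega>}"

end

theory Submission
  imports Defs "HOL-Computational_Algebra.Polynomial"
begin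

text \<open>The ball concentric with \<open>D\<close> of volume \<open>c\<close> is a minimizer. Since the eigenvalue is an infimum, it
  suffices to find, for each \<open>\<phi>\<close> admissible for a competitor \<open>\<Omega>\<close>, smooth functions compactly supported
  in the ball whose quotients are at most that of \<open>\<phi>\<close> up to an arbitrarily small error. This needs no
  compactness, and it covers \<open>q = 2\<close>, where the infimum need not be attained in \<open>W\<^sup>1\<^sup>,\<^sup>p\<close>.

  A test function \<open>v\<close> close to \<open>\<phi>\<close> exceeds \<open>\<delta>\<close> in modulus on a set of measure little more than
  \<open>|\<Omega>|\<close>, as \<open>\<phi> = 0\<close> almost everywhere outside \<open>\<Omega>\<close>. Above \<open>\<delta>\<close>, \<open>v\<close> is rearranged by a discrete
  Polya--Szego argument: with levels spaced by \<open>h\<close>, the superlevel sets are replaced by balls of equal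
  volume, joined by a radial profile. Brunn--Minkowski for the superlevel sets bounds the slopes of
  the profile by a multiple of the Lipschitz constant of \<open>v\<close>, and, via sup-convolution, bounds the
  integral of the gradient of \<open>v\<close> over each layer from below by \<open>h\<close> times the perimeter of the inner
  ball. Young's inequality turns this into a comparison of the energies on each layer, the excess
  telescopes to \<open>O(h)\<close>, and a slight dilation restores the volume constraint.\<close>

section \<open>Smooth functions\<close>

text \<open>Both energies must decrease for one and the same competitor. The tangent form of Young's
  inequality is linear in the norm of the gradient, so a single bound for the first-power integral
  over a layer serves the exponents \<open>p\<close> and 2 at once. Working with finitely many
  levels keeps the profile smooth whatever the distribution function of \<open>v\<close> looks like,
  and avoids the coarea formula and critical values.

  The error terms contain a power of the Lipschitz constant \<open>M\<close> of \<open>v\<close>,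
  which is out of control along test functions approaching \<open>\<phi>\<close>. Hence the order of
  choices: the slack in the three integrals goes first to the dilation, then to \<delta> and
  \<open>v\<close>, and the spacing \<open>h\<close> comes last, when \<open>M\<close> is fixed. The
  cut at \<delta> gives compact superlevel sets of controlled measure although \<open>v\<close> need
  not vanish outside \<Omega>.

  Capacity enters only through measure: since \<open>p > 2\<close>, the Poincare inequality at
  exponent 2 bounds the measure of a set of small capacity. Conditions holding quasi everywhere thus
  hold almost everywhere, and quasi-open sets are measurable.\<close>

lemma GDERIV_unique:
  assumes "GDERIV f x :> v" "GDERIV f x :> w"
  shows "v = w"
proof -
  have "(\<lambda>h. h \<bullet> v) = (\<lambda>h. h \<bullet> w)"
    using assms unfolding gderiv_def by (rule has_derivative_unique)
  then show ?thesis
    by (metis vector_eq_ldot)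
qed

lemma gradient_eqI: "GDERIV f x :> v \<Longrightarrow> gradient f x = v"
  unfolding gradient_def by (rule the_equality) (auto intro: GDERIV_unique)

lemma GDERIV_imp_continuous_on:
  assumes "\<And>x. GDERIV f x :> G x"
  shows "continuous_on UNIV f"
  using assms unfolding gderiv_def
  by (meson continuous_at_imp_continuous_on has_derivative_continuous)

text \<open>\<open>Ck (Suc k)\<close> constrains only the partial derivatives, so that the classes
  decrease in \<open>k\<close> takes an induction; it starts from differentiability implying
  continuity.\<close>

lemma Ck_Suc_imp: "Ck (Suc k) f \<Longrightarrow> Ck k f"
proof (induction k arbitrary: f)
  case 0
  then show ?case using GDERIV_imp_continuous_on by auto
next
  case (Suc k)
  from Suc.prems obtain G where "\<forall>x. GDERIV f x :> G x" "\<forall>i\<in>Basis. Ck (Suc k) (\<lambda>x. G x \<bullet> i)"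
    by (auto simp only: Ck.simps(2)[of "Suc k"])
  then show ?case
    unfolding Ck.simps(2)[of k f] by (intro exI[of _ G]) (use Suc.IH in blast)
qed

lemma Ck_const: "Ck k (\<lambda>x. c)"
proof (induction k arbitrary: c)
  case (Suc k)
  show ?case
    unfolding Ck.simps by (rule exI[of _ "\<lambda>_. 0"]) (use Suc in \<open>auto intro: GDERIV_const\<close>)
qed auto

lemma Ck_inner: "Ck k (\<lambda>x. x \<bullet> a)"
proof (cases k)
  case (Suc m)
  have "GDERIV (\<lambda>x. x \<bullet> a) x :> a" for x
    unfolding gderiv_def by (auto intro!: derivative_eq_intros)
  then show ?thesis
    unfolding Suc Ck.simps by (intro exI[of _ "\<lambda>_. a"]) (auto intro: Ck_const)
qed (auto intro!: continuous_intros)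

lemma Ck_add: "Ck k f \<Longrightarrow> Ck k g \<Longrightarrow> Ck k (\<lambda>x. f x + g x)"
proof (induction k arbitrary: f g)
  case (Suc k)
  from Suc.prems obtain F G where "\<forall>x. GDERIV f x :> F x" "\<forall>i\<in>Basis. Ck k (\<lambda>x. F x \<bullet> i)"
    "\<forall>x. GDERIV g x :> G x" "\<forall>i\<in>Basis. Ck k (\<lambda>x. G x \<bullet> i)" by auto
  then show ?case unfolding Ck.simps
    by (intro exI[of _ "\<lambda>x. F x + G x"])
      (auto intro!: GDERIV_add Suc.IH simp: inner_add_left)
qed (auto intro!: continuous_intros)

lemma Ck_mult: "Ck k f \<Longrightarrow> Ck k g \<Longrightarrow> Ck k (\<lambda>x. f x * g x)"
proof (induction k arbitrary: f g)
  case (Suc k)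
  from Suc.prems obtain F G where FG: "\<forall>x. GDERIV f x :> F x" "\<forall>i\<in>Basis. Ck k (\<lambda>x. F x \<bullet> i)"
    "\<forall>x. GDERIV g x :> G x" "\<forall>i\<in>Basis. Ck k (\<lambda>x. G x \<bullet> i)" by auto
  have "Ck k f" "Ck k g" using Suc.prems Ck_Suc_imp by blast+
  with FG show ?case unfolding Ck.simps
    by (intro exI[of _ "\<lambda>x. f x *\<^sub>R G x + g x *\<^sub>R F x"])
      (auto intro!: GDERIV_mult Ck_add Suc.IH simp: inner_add_left)
qed (auto intro!: continuous_intros)

lemma Ck_minus: "Ck k f \<Longrightarrow> Ck k (\<lambda>x. - f x)"
  using Ck_mult[OF Ck_const[of k "-1"], of f] by simp

lemma Ck_diff: "Ck k f \<Longrightarrow> Ck k g \<Longrightarrow> Ck k (\<lambda>x. f x - g x)"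
  using Ck_add[OF _ Ck_minus, of k f g] by simp

lemma Ck_sum: "(\<And>i. i \<in> I \<Longrightarrow> Ck k (f i)) \<Longrightarrow> Ck k (\<lambda>x. \<Sum>i\<in>I. f i x)"
  by (induction I rule: infinite_finite_induct) (auto intro!: Ck_add Ck_const)

lemma Ck_prod: "(\<And>i. i \<in> I \<Longrightarrow> Ck k (f i)) \<Longrightarrow> Ck k (\<lambda>x. \<Prod>i\<in>I. f i x)"
  by (induction I rule: infinite_finite_induct) (auto intro!: Ck_mult Ck_const)

lemma Ck_compose:
  fixes h :: "real \<Rightarrow> real"
  shows "Ck k h \<Longrightarrow> Ck k f \<Longrightarrow> Ck k (\<lambda>x. h (f x))"
proof (induction k arbitrary: f h)
  case 0
  then show ?case
    by (auto intro: continuous_on_compose2)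
next
  case (Suc k)
  from Suc.prems obtain F h' where F: "\<forall>x. GDERIV f x :> F x" "\<forall>i\<in>Basis. Ck k (\<lambda>x. F x \<bullet> i)"
    and h: "\<forall>x. DERIV h x :> h' x" "Ck k h'" by auto
  have "Ck k f" using Suc.prems Ck_Suc_imp by blast
  have "\<forall>x. GDERIV (\<lambda>x. h (f x)) x :> h' (f x) *\<^sub>R F x"
    using F(1) h(1) GDERIV_DERIV_compose by blast
  moreover have "\<forall>i\<in>Basis. Ck k (\<lambda>x. (h' (f x) *\<^sub>R F x) \<bullet> i)"
    using F(2) Ck_mult[OF Suc.IH[OF h(2) \<open>Ck k f\<close>]] by simp
  ultimately show ?case unfolding Ck.simps
    by (intro exI[of _ "\<lambda>x. h' (f x) *\<^sub>R F x"] conjI)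
qed

section \<open>A smooth step function of nearly minimal slope\<close>

lemma tendsto_poly_exp_neg: "((\<lambda>s::real. s ^ k * poly P s * exp (- s)) \<longlongrightarrow> 0) at_top"
proof (induction P arbitrary: k)
  case (pCons a P)
  \<comment> \<open>Splitting off the constant coefficient leaves \<open>s ^ Suc k\<close> in front
    of the remaining polynomial; this is why the statement carries a free power of
    \<open>s\<close>.\<close>
  have "((\<lambda>s::real. a * (s ^ k / exp s) + s ^ Suc k * poly P s * exp (- s)) \<longlongrightarrow> a * 0 + 0) at_top"
    by (intro tendsto_intros tendsto_power_div_exp_0 pCons.IH)
  then show ?case
    by (simp add: exp_minus field_simps)
qed simp

lemma tendsto_poly_inverse_exp:
  "((\<lambda>t::real. poly P (1 / t) * exp (- (1 / t))) \<longlongrightarrow> 0) (at_right 0)"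
  using filterlim_compose[OF tendsto_poly_exp_neg[of 0 P] filterlim_inverse_at_top_right]
  by (simp add: field_simps)

text \<open>The functions of this form, continued by 0, are closed under differentiation: in the
  variable 1/t the derivative has the polynomial X^2 (P - P'). At 0 the difference quotient is again
  of this form, with the polynomial X P, and so tends to 0.\<close>

lemma DERIV_poly_inverse_exp:
  "DERIV (\<lambda>t::real. if t > 0 then poly P (1 / t) * exp (- (1 / t)) else 0) x :>
    (if x > 0 then poly (pCons 0 (pCons 0 (P - pderiv P))) (1 / x) * exp (- (1 / x)) else 0)"
proof -
  let ?f = "\<lambda>t::real. if t > 0 then poly P (1 / t) * exp (- (1 / t)) else 0"
  consider "x > 0" | "x < 0" | "x = 0" by linarith
  then show ?thesis
  proof cases
    case 1
    have "DERIV (\<lambda>t. poly P (1 / t) * exp (- (1 / t))) x :>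
        poly (pCons 0 (pCons 0 (P - pderiv P))) (1 / x) * exp (- (1 / x))"
      using 1 by (auto intro!: derivative_eq_intros DERIV_chain2[OF poly_DERIV]
          simp: field_simps power2_eq_square)
    then have "DERIV ?f x :> poly (pCons 0 (pCons 0 (P - pderiv P))) (1 / x) * exp (- (1 / x))"
      by (rule DERIV_cong_ev[THEN iffD1, rotated -1])
        (use 1 eventually_nhds_in_open[of "{0<..}" x] in \<open>auto elim!: eventually_mono\<close>)
    with 1 show ?thesis by simp
  next
    case 2
    have "DERIV (\<lambda>t::real. 0::real) x :> 0" by simp
    then have "DERIV ?f x :> 0"
      by (rule DERIV_cong_ev[THEN iffD1, rotated -1])
        (use 2 eventually_nhds_in_open[of "{..<0}" x] in \<open>auto elim!: eventually_mono\<close>)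
    with 2 show ?thesis by simp
  next
    case 3
    have "((\<lambda>y. ?f y / y) \<longlongrightarrow> 0) (at_right 0)"
      by (rule Lim_transform_eventually[OF tendsto_poly_inverse_exp[of "pCons 0 P"]])
        (auto simp: eventually_at_filter)
    moreover have "((\<lambda>y. ?f y / y) \<longlongrightarrow> 0) (at_left 0)"
      by (rule tendsto_eventually) (auto simp: eventually_at_filter)
    ultimately have "((\<lambda>y. ?f y / y) \<longlongrightarrow> 0) (at 0)"
      using filterlim_split_at by blast
    then show ?thesis using 3
      by (simp add: has_field_derivative_iff)
  qed
qed

text \<open>The standard smooth function vanishing to infinite order at 0. It yields the step
  function below and, by products over the coordinates, the bumps on boxes.\<close>

definition flat :: "real \<Rightarrow> real" where
  "flat t = (if t > 0 then exp (- (1 / t)) else 0)"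

lemma Ck_poly_inverse_exp:
  "Ck k (\<lambda>t::real. if t > 0 then poly P (1 / t) * exp (- (1 / t)) else 0)"
proof (induction k arbitrary: P)
  case 0
  then show ?case
    using DERIV_poly_inverse_exp[of P]
    by (auto intro!: GDERIV_imp_continuous_on)
next
  case (Suc k)
  let ?g = "\<lambda>x::real. if x > 0 then poly (pCons 0 (pCons 0 (P - pderiv P))) (1 / x) * exp (- (1 / x)) else 0"
  have "\<forall>x. DERIV (\<lambda>t::real. if t > 0 then poly P (1 / t) * exp (- (1 / t)) else 0) x :> ?g x"
    using DERIV_poly_inverse_exp[of P] by blast
  moreover have "Ck k ?g" by (rule Suc)
  ultimately show ?case
    unfolding Ck.simps gderiv_deriv by (intro exI[of _ ?g]) (simp del: poly_pCons)
qed

lemma Ck_flat: "Ck k flat"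
  using Ck_poly_inverse_exp[of k 1] by (simp add: flat_def[abs_def] cong: if_cong)

lemma flat_bounds: "0 \<le> flat t" "flat t \<le> 1"
  by (auto simp: flat_def)

lemma flat_eq_0_iff: "flat t = 0 \<longleftrightarrow> t \<le> 0"
  by (auto simp: flat_def)

lemma flat_mono: "s \<le> t \<Longrightarrow> flat s \<le> flat t"
  by (auto simp: flat_def frac_le)

lemma flat_mult_tendsto: "t > 0 \<Longrightarrow> (\<lambda>n. flat (real n * t)) \<longlonglongrightarrow> 1"
proof -
  assume t: "t > 0"
  have "(\<lambda>n. exp (- ((1 / t) * (1 / real n)))) \<longlonglongrightarrow> exp (- ((1 / t) * 0))"
    by (intro tendsto_intros lim_1_over_n)
  moreover have "\<forall>\<^sub>F n in sequentially. exp (- ((1 / t) * (1 / real n))) = flat (real n * t)"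
    using eventually_gt_at_top[of 0] by eventually_elim (use t in \<open>auto simp: flat_def\<close>)
  ultimately show ?thesis
    by (simp add: tendsto_cong)
qed

text \<open>The slope of the step multiplies every gradient of the radial profile, so it has to come
  arbitrarily close to 1, the slope of the linear step. The step is the normalised antiderivative of
  a smooth function with values between 0 and 1 that is nearly 1 on most of the unit interval;
  dividing by the total mass \<open>J\<close> bounds the slope by 1/J.\<close>

lemma smooth_step_exists:
  fixes e :: real
  assumes "e > 0"
  obtains H H' :: "real \<Rightarrow> real" where "\<And>k. Ck k H" "\<And>t. DERIV H t :> H' t"
    "\<And>t. 0 \<le> H' t" "\<And>t. H' t \<le> 1 + e" "\<And>t. t \<le> 0 \<Longrightarrow> H t = 0" "\<And>t. t \<ge> 1 \<Longrightarrow> H t = 1"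
    "\<And>t. \<not> (0 < t \<and> t < 1) \<Longrightarrow> H' t = 0"
proof -
  \<comment> \<open>Between \<open>a\<close> and \<open>1 - a\<close> the integrand will exceed
    \<open>1 - 2 * a\<close>, so its mass is at least (1 - 2a)^2 \<ge> 1 - 4a; this choice makes the
    latter at least 1/(1 + e).\<close>
  define a where "a = min (1/4) (e / (4 * (1 + e)))"
  have a: "0 < a" "a \<le> 1/4" using assms by (auto simp: a_def)
  have ae: "(1 - 2 * a) * (1 - 2 * a) \<ge> 1 / (1 + e)"
  proof -
    have "a \<le> e / (4 * (1 + e))" by (simp add: a_def)
    then have "4 * a \<le> e / (1 + e)" using assms by (simp add: field_simps)
    then have "1 - 4 * a \<ge> 1 / (1 + e)" using assms by (simp add: field_simps)
    moreover have "(1 - 2 * a) * (1 - 2 * a) \<ge> 1 - 4 * a"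
      by (simp add: algebra_simps)
    ultimately show ?thesis by linarith
  qed
  have "\<forall>\<^sub>F n in sequentially. flat (real n * (a * (1 - a))) > 1 - 2 * a"
    by (rule order_tendstoD(1)[OF flat_mult_tendsto]) (use a in auto)
  then obtain n where n: "flat (real n * (a * (1 - a))) > 1 - 2 * a"
    by (meson eventually_happens trivial_limit_sequentially)
  define g where "g s = flat (real n * (s * (1 - s)))" for s
  have Ckg: "Ck k g" for k
  proof -
    have "Ck k (\<lambda>s::real. s)" using Ck_inner[of k "1::real"] by simp
    then have "Ck k (\<lambda>s::real. real n * (s * (1 - s)))"
      by (intro Ck_mult Ck_const Ck_diff)
    from Ck_compose[OF Ck_flat this] show ?thesis by (simp add: g_def[abs_def])
  qed
  then have "continuous_on UNIV g" using Ck.simps(1) by blast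
  then have "\<exists>K. \<forall>x. - \<infinity> < ereal x \<longrightarrow> ereal x < \<infinity> \<longrightarrow> (K has_vector_derivative g x) (at x)"
    using einterval_antiderivative[of "-\<infinity>" "\<infinity>" g] by (simp add: continuous_on_eq_continuous_at)
  then obtain K where K: "\<And>x. DERIV K x :> g x"
    by (auto simp: has_real_derivative_iff_has_vector_derivative)
  have g0: "g s = 0" if "\<not> (0 < s \<and> s < 1)" for s
    using that by (auto simp: g_def flat_eq_0_iff mult_le_0_iff)
  have gb: "0 \<le> g s" "g s \<le> 1" for s by (auto simp: g_def flat_bounds)
  have Kmono: "K x \<le> K y" if "x \<le> y" for x y
    using DERIV_nonneg_imp_nondecreasing[OF that] K gb(1) by blast
  have K0: "K t = K 0" if "t \<le> 0" for t
  proof (cases "t = 0")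
    case False
    with that have "t < 0" by simp
    moreover have "DERIV K x :> 0" if "x < 0" for x using K[of x] g0[of x] that by simp
    moreover have "continuous_on {t..0} K"
      using K by (intro continuous_at_imp_continuous_on) (auto intro: DERIV_isCont)
    ultimately show ?thesis
      using DERIV_isconst2[of t 0 K 0] by auto
  qed simp
  have K1: "K t = K 1" if "t \<ge> 1" for t
  proof (cases "t = 1")
    case False
    with that have "1 < t" by simp
    moreover have "DERIV K x :> 0" if "1 < x" for x using K[of x] g0[of x] that by simp
    moreover have "continuous_on {1..t} K"
      using K by (intro continuous_at_imp_continuous_on) (auto intro: DERIV_isCont)
    ultimately show ?thesis
      using DERIV_isconst2[of 1 t K t] by auto
  qed simp
  define J where "J = K 1 - K 0"
  have "J \<ge> (1 - 2 * a) * (1 - 2 * a)"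
  proof -
    \<comment> \<open>The mean value theorem turns the pointwise lower bound for \<open>g\<close>
      into one for the increment of \<open>K\<close>; on this interval \<open>s * (1 - s)\<close> is
      smallest at the ends.\<close>
    obtain z where z: "a < z" "z < 1 - a" "K (1 - a) - K a = (1 - a - a) * g z"
      using MVT2[of a "1 - a" K g] K a by auto
    have "a * (1 - a) \<le> z * (1 - z)"
    proof -
      have "0 \<le> (z - a) * (1 - a - z)" using z by simp
      then show ?thesis by (simp add: algebra_simps)
    qed
    then have "g z \<ge> 1 - 2 * a" using n flat_mono[of "real n * (a * (1-a))" "real n * (z * (1-z))"]
      unfolding g_def by (smt (verit) mult_left_mono of_nat_0_le_iff)
    then have "K (1 - a) - K a \<ge> (1 - 2 * a) * (1 - 2 * a)"
      using z a by (simp add: mult_left_mono)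
    moreover have "K 0 \<le> K a" "K (1 - a) \<le> K 1" using a by (auto intro: Kmono)
    ultimately show ?thesis by (simp add: J_def)
  qed
  with ae have J: "J \<ge> 1 / (1 + e)" by linarith
  moreover have "1 / (1 + e) > 0" using assms by simp
  ultimately have J0: "J > 0" by linarith
  show ?thesis
  proof (rule that[of "\<lambda>t. (K t - K 0) / J" "\<lambda>t. g t / J"])
    show D: "DERIV (\<lambda>t. (K t - K 0) / J) t :> g t / J" for t
      using DERIV_cdivide[OF DERIV_diff[OF K[of t] DERIV_const[of "K 0"]], of J] by simp
    have "Ck k (\<lambda>t. g t / J)" for k
      using Ck_mult[OF Ckg[of k] Ck_const[of k "1/J"]] by simp
    then have "Ck (Suc k) (\<lambda>t. (K t - K 0) / J)" for k
      using D by (auto intro!: exI[of _ "\<lambda>t. g t / J"])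
    then show "Ck k (\<lambda>t. (K t - K 0) / J)" for k by (rule Ck_Suc_imp)
    show "g t / J \<le> 1 + e" for t
    proof -
      have "g t \<le> J * (1 + e)" using gb(2)[of t] J assms by (simp add: field_simps)
      then show ?thesis using J0 by (simp add: field_simps)
    qed
    show "0 \<le> g t / J" for t using gb J0 by simp
    show "(K t - K 0) / J = 0" if "t \<le> 0" for t using K0[OF that] by simp
    show "(K t - K 0) / J = 1" if "1 \<le> t" for t using K1[OF that] J0 by (simp add: J_def)
    show "g t / J = 0" if "\<not> (0 < t \<and> t < 1)" for t using g0[OF that] by simp
  qed
qed

lemma Cc_infinity_Ck: "f \<in> Cc_infinity U \<Longrightarrow> Ck k f"
  by (simp add: Cc_infinity_def)

lemma Ck_imp_gradient:
  assumes "\<And>k. Ck k f"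
  shows "GDERIV f x :> gradient f x" "Ck k (\<lambda>x. gradient f x \<bullet> i)" "continuous_on UNIV (gradient f)"
proof -
  have *: "(\<forall>x. GDERIV f x :> gradient f x) \<and> (\<forall>i\<in>Basis. Ck k (\<lambda>x. gradient f x \<bullet> i))" for k
  proof -
    have "Ck (Suc k) f" by (rule assms)
    then obtain G where G: "\<forall>x. GDERIV f x :> G x" "\<forall>i\<in>Basis. Ck k (\<lambda>x. G x \<bullet> i)" by auto
    then have "gradient f = G" using gradient_eqI by blast
    with G show ?thesis by simp
  qed
  then show "GDERIV f x :> gradient f x" by blast
  have "Ck k (\<lambda>x. \<Sum>j\<in>Basis. (i \<bullet> j) * (gradient f x \<bullet> j))" for k
    using * by (intro Ck_sum Ck_mult Ck_const) auto
  then show "Ck k (\<lambda>x. gradient f x \<bullet> i)"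
    by (subst euclidean_inner) (simp add: mult.commute)
  from *[of 0] have "\<forall>i\<in>Basis. continuous_on UNIV (\<lambda>x. gradient f x \<bullet> i)" by simp
  then show "continuous_on UNIV (gradient f)"
    by (rule continuous_on_componentwise[THEN iffD2])
qed

lemma Cc_infinity_gradient:
  assumes "f \<in> Cc_infinity U"
  shows "GDERIV f x :> gradient f x" "continuous_on UNIV (gradient f)" "continuous_on UNIV f"
  using Ck_imp_gradient[of f] Cc_infinity_Ck[OF assms] Ck.simps(1) by blast+

lemma Cc_infinity_outside:
  assumes "f \<in> Cc_infinity U" "x \<notin> closure {x. f x \<noteq> 0}"
  shows "f x = 0" "gradient f x = 0"
proof -
  have eq: "0 = f y" if "y \<in> - closure {x. f x \<noteq> 0}" for y
  proof (rule ccontr)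
    assume "0 \<noteq> f y"
    then have "y \<in> {x. f x \<noteq> 0}" by simp
    then have "y \<in> closure {x. f x \<noteq> 0}" by (rule subsetD[OF closure_subset])
    with that show False by simp
  qed
  from eq[of x] assms(2) show "f x = 0" by simp
  have "x \<in> - closure {x. f x \<noteq> 0}" using assms(2) by simp
  from has_derivative_transform_within_open[OF has_derivative_const[of 0] open_Compl[OF closed_closure] this eq]
  have "(f has_derivative (\<lambda>_. 0)) (at x)" .
  then have "GDERIV f x :> 0"
    unfolding gderiv_def by simp
  then show "gradient f x = 0" by (rule gradient_eqI)
qed

lemma Cc_infinity_mono: "U \<subseteq> V \<Longrightarrow> Cc_infinity U \<subseteq> Cc_infinity V"
  by (auto simp: Cc_infinity_def)

lemma Cc_infinityI:
  assumes "\<And>k. Ck k f" "compact C" "C \<subseteq> U" "\<And>x. x \<notin> C \<Longrightarrow> f x = 0"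
  shows "f \<in> Cc_infinity U"
proof -
  have "closure {x. f x \<noteq> 0} \<subseteq> C"
    using assms(4) compact_imp_closed[OF assms(2)] by (intro closure_minimal) blast+
  moreover from this have "compact (closure {x. f x \<noteq> 0})"
    using assms(2) compact_imp_bounded by (metis bounded_subset closed_closure compact_eq_bounded_closed)
  ultimately show ?thesis using assms(1,3) unfolding Cc_infinity_def by blast
qed

section \<open>The Brunn--Minkowski inequality\<close>

lemma integrable_indicator_lmeasurable: "A \<in> lmeasurable \<Longrightarrow> integrable lebesgue (indicat_real A)"
  unfolding fmeasurable_def by (intro integrable_real_indicator) blast+

text \<open>The Minkowski sum. Written as a union of translates of \<open>B\<close>, it is visibly
  open as soon as \<open>B\<close> is.\<close>

definition msum :: "'a::euclidean_space set \<Rightarrow> 'a set \<Rightarrow> 'a set" where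
  "msum A B = (\<Union>a\<in>A. (\<lambda>b. a + b) ` B)"

lemma msumI: "a \<in> A \<Longrightarrow> b \<in> B \<Longrightarrow> a + b \<in> msum A B"
  by (auto simp: msum_def)

lemma msumE: assumes "x \<in> msum A B" obtains a b where "x = a + b" "a \<in> A" "b \<in> B"
  using assms by (auto simp: msum_def)

lemma msum_commute: "msum A B = msum B A"
  by (force simp: msum_def add.commute)

lemma msum_mono: "A \<subseteq> A' \<Longrightarrow> B \<subseteq> B' \<Longrightarrow> msum A B \<subseteq> msum A' B'"
  by (force simp: msum_def)

lemma open_msum: "open B \<Longrightarrow> open (msum A B)"
  unfolding msum_def by (auto intro: open_translation)

lemma bounded_msum:
  assumes "bounded A" "bounded B" shows "bounded (msum A B)"
proof -
  have "msum A B = (\<Union>x\<in>A. \<Union>y\<in>B. {x + y})" by (auto simp: msum_def)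
  then show ?thesis using bounded_sums[OF assms] by simp
qed

lemma lmeasurable_msum:
  "bounded A \<Longrightarrow> bounded B \<Longrightarrow> open B \<Longrightarrow> msum A B \<in> lmeasurable"
  by (intro lmeasurable_open bounded_msum open_msum)

text \<open>In each coordinate \<open>z\<close> divides the sum of the two intervals in some ratio
  \<open>l i\<close>. The points dividing the intervals of the two boxes in these same ratios add up
  to \<open>z\<close>.\<close>

lemma box_msum:
  fixes a b c d :: "'a::euclidean_space"
  assumes "box a b \<noteq> {}" "box c d \<noteq> {}"
  shows "box (a + c) (b + d) \<subseteq> msum (box a b) (box c d)"
proof
  fix z assume z: "z \<in> box (a + c) (b + d)"
  define l where "l i = ((z - a - c) \<bullet> i) / ((b - a + (d - c)) \<bullet> i)" for i
  have pos: "(b - a) \<bullet> i > 0" "(d - c) \<bullet> i > 0" if "i \<in> Basis" for i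
    using assms that by (auto simp: box_ne_empty inner_diff_left)
  have l: "0 < l i" "l i < 1" if "i \<in> Basis" for i
    using z that pos[OF that] by (auto simp: l_def box_def inner_diff_left inner_add_left divide_simps)
  define x y where "x = a + (\<Sum>i\<in>Basis. (l i * ((b - a) \<bullet> i)) *\<^sub>R i)"
    and "y = c + (\<Sum>i\<in>Basis. (l i * ((d - c) \<bullet> i)) *\<^sub>R i)"
  have xi: "x \<bullet> i = a \<bullet> i + l i * ((b - a) \<bullet> i)" "y \<bullet> i = c \<bullet> i + l i * ((d - c) \<bullet> i)" if "i \<in> Basis" for i
    using that by (auto simp: x_def y_def inner_add_left inner_sum_left_Basis)
  have *: "0 < t * s \<and> t * s < s" if "0 < t" "t < 1" "0 < s" for s t :: real using that by simp
  have "a \<bullet> i < x \<bullet> i \<and> x \<bullet> i < b \<bullet> i" if "i \<in> Basis" for i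
    using * [OF l[OF that] pos(1)[OF that]] by (simp add: xi[OF that] inner_diff_left)
  then have "x \<in> box a b" by (simp add: mem_box)
  moreover have "c \<bullet> i < y \<bullet> i \<and> y \<bullet> i < d \<bullet> i" if "i \<in> Basis" for i
    using * [OF l[OF that] pos(2)[OF that]] by (simp add: xi[OF that] inner_diff_left)
  then have "y \<in> box c d" by (simp add: mem_box)
  moreover have "x + y = z"
  proof (rule euclidean_eqI)
    fix i :: 'a assume i: "i \<in> Basis"
    have "l i * ((b - a + (d - c)) \<bullet> i) = (z - a - c) \<bullet> i"
      using pos[OF i] by (simp add: l_def inner_add_left)
    then show "(x + y) \<bullet> i = z \<bullet> i"
      using i by (simp add: xi inner_add_left inner_diff_left algebra_simps)
  qed
  ultimately show "z \<in> msum (box a b) (box c d)" using msumI by blast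
qed

text \<open>Brunn--Minkowski for two boxes with side lengths \<open>s\<close> and \<open>t\<close>.
  After division by the geometric mean of the sums \<open>s i + t i\<close>, the
  arithmetic-geometric mean inequality applies to both terms, and the two arithmetic means add up to
  1.\<close>

lemma root_prod_add_le:
  fixes s t :: "'i \<Rightarrow> real"
  assumes I: "finite I" "I \<noteq> {}" and s: "\<And>i. i \<in> I \<Longrightarrow> s i > 0" and t: "\<And>i. i \<in> I \<Longrightarrow> t i > 0"
  shows "root (card I) (\<Prod>i\<in>I. s i) + root (card I) (\<Prod>i\<in>I. t i) \<le> root (card I) (\<Prod>i\<in>I. s i + t i)"
proof -
  let ?n = "card I"
  have n: "?n > 0" using I by (simp add: card_gt_0_iff)
  have amgm: "root ?n (\<Prod>i\<in>I. x i) \<le> (\<Sum>i\<in>I. x i) / ?n" if "\<And>i. i \<in> I \<Longrightarrow> x i > 0" for x :: "'i \<Rightarrow> real"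
    using arith_geom_mean[OF I, of x] that n
    by (simp add: root_powr_inverse prod_pos less_imp_le sum_divide_distrib)
  have P: "(\<Prod>i\<in>I. s i + t i) > 0" using s t by (intro prod_pos) (simp add: add_pos_pos)
  have e: "root ?n (\<Prod>i\<in>I. x i) = root ?n (\<Prod>i\<in>I. x i / (s i + t i)) * root ?n (\<Prod>i\<in>I. s i + t i)" for x
    using P n by (simp add: prod_dividef real_root_divide)
  have "root ?n (\<Prod>i\<in>I. s i / (s i + t i)) + root ?n (\<Prod>i\<in>I. t i / (s i + t i))
      \<le> (\<Sum>i\<in>I. s i / (s i + t i)) / ?n + (\<Sum>i\<in>I. t i / (s i + t i)) / ?n"
    using s t by (intro add_mono amgm) (auto simp: add_pos_pos)
  also have "\<dots> = (\<Sum>i\<in>I. s i / (s i + t i) + t i / (s i + t i)) / ?n"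
    by (simp add: sum.distrib add_divide_distrib)
  also have "\<dots> = (\<Sum>i\<in>I. 1) / ?n"
    using s t by (intro arg_cong2[of _ _ _ _ "(/)"] sum.cong)
      (auto simp: add_divide_distrib[symmetric] add_pos_pos less_imp_neq[symmetric])
  also have "\<dots> = 1" using n by simp
  finally have "(root ?n (\<Prod>i\<in>I. s i / (s i + t i)) + root ?n (\<Prod>i\<in>I. t i / (s i + t i))) * root ?n (\<Prod>i\<in>I. s i + t i)
     \<le> 1 * root ?n (\<Prod>i\<in>I. s i + t i)"
    using P n by (intro mult_right_mono) auto
  then show ?thesis
    by (simp add: e[of s] e[of t] distrib_right)
qed

text \<open>Empty boxes and the empty family are excluded so that every union has positive volume
  and volume ratios make sense; disjointness provides the separating hyperplanes.\<close>

definition boxes :: "'a::euclidean_space set set \<Rightarrow> bool" where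
  "boxes \<A> \<longleftrightarrow> finite \<A> \<and> \<A> \<noteq> {} \<and> (\<forall>K\<in>\<A>. K \<noteq> {} \<and> (\<exists>a b. K = box a b)) \<and>
     (\<forall>K\<in>\<A>. \<forall>L\<in>\<A>. K \<noteq> L \<longrightarrow> K \<inter> L = {})"

lemma boxes_Union:
  assumes "boxes \<A>"
  shows "open (\<Union>\<A>)" "bounded (\<Union>\<A>)" "\<Union>\<A> \<noteq> {}" "\<Union>\<A> \<in> lmeasurable" "measure lebesgue (\<Union>\<A>) > 0"
proof -
  have box: "\<exists>a b. K = box a b" if "K \<in> \<A>" for K using assms that by (auto simp: boxes_def)
  show o: "open (\<Union>\<A>)" using box by (metis open_Union open_box)
  show b: "bounded (\<Union>\<A>)" using box assms unfolding boxes_def by (metis bounded_Union bounded_box)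
  show ne: "\<Union>\<A> \<noteq> {}" using assms by (auto simp: boxes_def)
  show m: "\<Union>\<A> \<in> lmeasurable" using o b lmeasurable_open by blast
  show "measure lebesgue (\<Union>\<A>) > 0"
    using ne m o open_not_negligible[OF o ne] negligible_iff_measure measure_nonneg
    by (metis less_eq_real_def)
qed

lemma box_split:
  fixes i :: "'a::euclidean_space"
  assumes i: "i \<in> Basis"
  shows "\<exists>b'. box a b \<inter> {x. x \<bullet> i < t} = box a b'" "\<exists>a'. box a b \<inter> {x. t < x \<bullet> i} = box a' b"
proof -
  have "box a b \<inter> {x. x \<bullet> i < t} = box a (\<Sum>j\<in>Basis. (if j = i then min (b \<bullet> i) t else b \<bullet> j) *\<^sub>R j)"
    using i by (auto simp: mem_box split: if_splits)
  then show "\<exists>b'. box a b \<inter> {x. x \<bullet> i < t} = box a b'" by blast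
  have "box a b \<inter> {x. t < x \<bullet> i} = box (\<Sum>j\<in>Basis. (if j = i then max (a \<bullet> i) t else a \<bullet> j) *\<^sub>R j) b"
    using i by (auto simp: mem_box split: if_splits)
  then show "\<exists>a'. box a b \<inter> {x. t < x \<bullet> i} = box a' b" by blast
qed

text \<open>Empty pieces are dropped, so the number of boxes falls as soon as one box misses the
  half-space \<open>H\<close>.\<close>

definition cut :: "'a set \<Rightarrow> 'a set set \<Rightarrow> 'a set set" where
  "cut H \<A> = (\<lambda>K. K \<inter> H) ` \<A> - {{}}"

lemma Union_cut: "\<Union>(cut H \<A>) = \<Union>\<A> \<inter> H"
  by (auto simp: cut_def)

lemma card_cut_le: "finite \<A> \<Longrightarrow> card (cut H \<A>) \<le> card \<A>"
  unfolding cut_def by (meson card_Diff1_le card_image_le finite_imageI le_trans)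

lemma card_cut_less:
  assumes "finite \<A>" "L \<in> \<A>" "L \<inter> H = {}"
  shows "card (cut H \<A>) < card \<A>"
proof -
  have "cut H \<A> \<subseteq> (\<lambda>K. K \<inter> H) ` (\<A> - {L})"
    using assms by (auto simp: cut_def)
  then have "card (cut H \<A>) \<le> card (\<A> - {L})"
    by (meson assms(1) card_image_le card_mono finite_Diff finite_imageI le_trans)
  then show ?thesis using assms by (metis card_Diff1_less le_less_trans)
qed

lemma boxes_cut:
  assumes "boxes \<A>" "i \<in> Basis" "H = {x. x \<bullet> i < t} \<or> H = {x. t < x \<bullet> i}" "\<Union>\<A> \<inter> H \<noteq> {}"
  shows "boxes (cut H \<A>)"
  unfolding boxes_def
proof (intro conjI ballI)
  show "finite (cut H \<A>)" using assms by (auto simp: boxes_def cut_def)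
  show "cut H \<A> \<noteq> {}" using assms(4) by (auto simp: cut_def)
  fix K assume K: "K \<in> cut H \<A>"
  then show "K \<noteq> {}" by (auto simp: cut_def)
  from K obtain K' where "K' \<in> \<A>" "K = K' \<inter> H" by (auto simp: cut_def)
  with assms(1) obtain a b where "K = box a b \<inter> H" unfolding boxes_def by metis
  then show "\<exists>a b. K = box a b" using box_split[OF assms(2), of a b t] assms(3) by auto
next
  fix K L assume "K \<in> cut H \<A>" "L \<in> cut H \<A>"
  then obtain K' L' where "K' \<in> \<A>" "L' \<in> \<A>" "K = K' \<inter> H" "L = L' \<inter> H" by (auto simp: cut_def)
  with assms(1) show "K \<noteq> L \<longrightarrow> K \<inter> L = {}" by (auto simp: boxes_def)
qed

lemma measure_halfspace_split:
  fixes A :: "'a::euclidean_space set"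
  assumes "A \<in> lmeasurable" "i \<in> Basis"
  shows "measure lebesgue A = measure lebesgue (A \<inter> {x. x \<bullet> i < t}) + measure lebesgue (A \<inter> {x. t < x \<bullet> i})"
proof -
  have m: "A \<inter> {x. x \<bullet> i < t} \<in> lmeasurable" "A \<inter> {x. t < x \<bullet> i} \<in> lmeasurable"
    using assms(1) by (auto intro!: fmeasurable_Int_fmeasurable borel_open open_halfspace_component_lt open_halfspace_component_gt)
  have "negligible {x::'a. x \<bullet> i = t}"
    using negligible_standard_hyperplane[OF assms(2), of t] by (simp only: inner_commute[of _ i])
  then have "negligible (A \<inter> {x. x \<bullet> i = t})" by (rule negligible_subset) auto
  then have "measure lebesgue ((A \<inter> {x. x \<bullet> i < t} \<union> A \<inter> {x. t < x \<bullet> i}) \<union> (A \<inter> {x. x \<bullet> i = t}))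
      = measure lebesgue (A \<inter> {x. x \<bullet> i < t} \<union> A \<inter> {x. t < x \<bullet> i})"
    by (intro measure_Un_null_set) (use m in \<open>auto simp: negligible_iff_null_sets\<close>)
  moreover have "(A \<inter> {x. x \<bullet> i < t} \<union> A \<inter> {x. t < x \<bullet> i}) \<union> (A \<inter> {x. x \<bullet> i = t}) = A"
    by auto
  moreover have "measure lebesgue (A \<inter> {x. x \<bullet> i < t} \<union> A \<inter> {x. t < x \<bullet> i})
      = measure lebesgue (A \<inter> {x. x \<bullet> i < t}) + measure lebesgue (A \<inter> {x. t < x \<bullet> i})"
  proof -
    have "(A \<inter> {x. x \<bullet> i < t}) \<inter> (A \<inter> {x. t < x \<bullet> i}) = {}" by auto
    then show ?thesis using measure_Un3[OF m] by (simp only: measure_empty)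
  qed
  ultimately show ?thesis by simp
qed

text \<open>Hyperplanes are null sets, so by dominated convergence the volume cut off depends
  continuously on \<open>t\<close>; boundedness of \<open>A\<close> provides levels with the volumes
  0 and all of \<open>A\<close>.\<close>

lemma measure_halfspace_ivt:
  fixes A :: "'a::euclidean_space set"
  assumes A: "A \<in> lmeasurable" "bounded A" and i: "i \<in> Basis" and r: "0 < r" "r < 1"
  shows "\<exists>t. measure lebesgue (A \<inter> {x. x \<bullet> i < t}) = r * measure lebesgue A"
proof -
  let ?g = "\<lambda>t. measure lebesgue (A \<inter> {x. x \<bullet> i < t})"
  have m: "A \<inter> {x. x \<bullet> i < t} \<in> lmeasurable" for t
    using assms(1) by (auto intro!: fmeasurable_Int_fmeasurable borel_open open_halfspace_component_lt)
  have "isCont ?g t" for t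
    unfolding continuous_at_sequentially
  proof (intro allI impI)
    fix X :: "nat \<Rightarrow> real" assume X: "X \<longlonglongrightarrow> t"
    have "(\<lambda>n. LINT x|lebesgue. indicat_real (A \<inter> {x. x \<bullet> i < X n}) x)
        \<longlonglongrightarrow> (LINT x|lebesgue. indicat_real (A \<inter> {x. x \<bullet> i < t}) x)"
    proof (rule integral_dominated_convergence[where w = "indicat_real A"])
      have "negligible {x::'a. x \<bullet> i = t}"
        using negligible_standard_hyperplane[OF i, of t] by (simp only: inner_commute[of _ i])
      then have "AE x in lebesgue. x \<notin> {x::'a. x \<bullet> i = t}"
        unfolding negligible_iff_null_sets by (rule AE_not_in)
      then show "AE x in lebesgue. (\<lambda>n. indicat_real (A \<inter> {x. x \<bullet> i < X n}) x)
           \<longlonglongrightarrow> indicat_real (A \<inter> {x. x \<bullet> i < t}) x"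
      proof (rule AE_mp, intro AE_I2 impI)
        fix x :: 'a assume "x \<notin> {x. x \<bullet> i = t}"
        then consider "x \<bullet> i < t" | "x \<bullet> i > t" by fastforce
        then have "\<forall>\<^sub>F n in sequentially. x \<bullet> i < X n \<longleftrightarrow> x \<bullet> i < t"
        proof cases
          case 1
          then show ?thesis using order_tendstoD(1)[OF X, of "x \<bullet> i"] by (auto elim: eventually_mono)
        next
          case 2
          then show ?thesis using order_tendstoD(2)[OF X, of "x \<bullet> i"] by (auto elim!: eventually_mono)
        qed
        then show "(\<lambda>n. indicat_real (A \<inter> {x. x \<bullet> i < X n}) x) \<longlonglongrightarrow> indicat_real (A \<inter> {x. x \<bullet> i < t}) x"
          by (intro tendsto_eventually) (auto simp: indicator_def elim!: eventually_mono)
      qed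
      show "integrable lebesgue (indicat_real A)" using A(1) by (rule integrable_indicator_lmeasurable)
      show "indicat_real (A \<inter> {x. x \<bullet> i < t}) \<in> borel_measurable lebesgue"
        "indicat_real (A \<inter> {x. x \<bullet> i < X n}) \<in> borel_measurable lebesgue" for n
        by (rule borel_measurable_indicator, rule fmeasurableD, rule m)+
      show "AE x in lebesgue. norm (indicat_real (A \<inter> {x. x \<bullet> i < X n}) x) \<le> indicat_real A x" for n
        by (intro AE_I2) (simp add: indicator_def)
    qed
    then show "(?g \<circ> X) \<longlonglongrightarrow> ?g t"
      using m by (simp add: o_def fmeasurableD)
  qed
  moreover obtain c where c: "\<And>x. x \<in> A \<Longrightarrow> norm x \<le> c" using A(2) bounded_iff by blast
  have "\<bar>x \<bullet> i\<bar> \<le> c" if "x \<in> A" for x using Basis_le_norm[OF i] c[OF that] order_trans by blast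
  then have "A \<inter> {x. x \<bullet> i < - \<bar>c\<bar> - 1} = {}" "A \<inter> {x. x \<bullet> i < \<bar>c\<bar> + 1} = A"
    by (force simp: abs_le_iff)+
  then have "?g (- \<bar>c\<bar> - 1) = 0" "?g (\<bar>c\<bar> + 1) = measure lebesgue A" by auto
  moreover have "r * measure lebesgue A \<le> measure lebesgue A" using r by (simp add: mult_left_le_one_le)
  ultimately show ?thesis
    using IVT[of ?g "- \<bar>c\<bar> - 1" "r * measure lebesgue A" "\<bar>c\<bar> + 1"] r by auto
qed

text \<open>Two disjoint nonempty boxes have disjoint projections onto some coordinate axis.\<close>

lemma boxes_separate:
  fixes \<A> :: "'a::euclidean_space set set"
  assumes "boxes \<A>" "card \<A> \<ge> 2"
  obtains K L i t where "K \<in> \<A>" "L \<in> \<A>" "i \<in> Basis" "K \<subseteq> {x. x \<bullet> i < t}" "L \<subseteq> {x. t < x \<bullet> i}"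
proof -
  obtain K L where KL: "K \<in> \<A>" "L \<in> \<A>" "K \<noteq> L"
    using assms(2) by (metis card_2_iff' card_le_Suc0_iff_eq not_less_eq_eq numeral_2_eq_2 boxes_def assms(1))
  with assms(1) have "K \<inter> L = {}" "K \<noteq> {}" "L \<noteq> {}" by (auto simp: boxes_def)
  from assms(1) KL obtain a b c d where ab: "K = box a b" "L = box c d" unfolding boxes_def by metis
  have "\<exists>i\<in>Basis. b \<bullet> i \<le> a \<bullet> i \<or> d \<bullet> i \<le> c \<bullet> i \<or> b \<bullet> i \<le> c \<bullet> i \<or> d \<bullet> i \<le> a \<bullet> i"
    using \<open>K \<inter> L = {}\<close> unfolding ab disjoint_interval .
  with \<open>K \<noteq> {}\<close> \<open>L \<noteq> {}\<close> obtain i where i: "i \<in> Basis" "b \<bullet> i \<le> c \<bullet> i \<or> d \<bullet> i \<le> a \<bullet> i"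
    unfolding ab box_ne_empty by force
  then show ?thesis
  proof (elim disjE)
    assume "b \<bullet> i \<le> c \<bullet> i"
    then have "K \<subseteq> {x. x \<bullet> i < b \<bullet> i}" "L \<subseteq> {x. b \<bullet> i < x \<bullet> i}"
      using i unfolding ab by (force simp: mem_box)+
    with KL i show ?thesis using that by blast
  next
    assume "d \<bullet> i \<le> a \<bullet> i"
    then have "L \<subseteq> {x. x \<bullet> i < d \<bullet> i}" "K \<subseteq> {x. d \<bullet> i < x \<bullet> i}"
      using i unfolding ab by (force simp: mem_box)+
    with KL i show ?thesis using that by blast
  qed
qed

text \<open>Hadwiger--Ohmann: cut one family by a hyperplane separating two of its boxes and the
  other by a parallel hyperplane in the same volume ratio; the two halves of the sum are then
  disjoint, and the total number of boxes has decreased.\<close>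

lemma brunn_minkowski_boxes:
  fixes \<A> \<B> :: "'a::euclidean_space set set"
  assumes "boxes \<A>" "boxes \<B>"
  shows "(root DIM('a) (measure lebesgue (\<Union>\<A>)) + root DIM('a) (measure lebesgue (\<Union>\<B>))) ^ DIM('a)
    \<le> measure lebesgue (msum (\<Union>\<A>) (\<Union>\<B>))"
  using assms
proof (induction "card \<A> + card \<B>" arbitrary: \<A> \<B> rule: less_induct)
  case less
  let ?n = "DIM('a)" and ?m = "measure lebesgue :: 'a set \<Rightarrow> real"
  \<comment> \<open>The induction step for the case that the first family has two boxes. It takes
    the induction hypothesis as a premise, so that it can be reused with the roles of the families
    exchanged.\<close>
  have step: "(root ?n (?m (\<Union>\<A>)) + root ?n (?m (\<Union>\<B>))) ^ ?n \<le> ?m (msum (\<Union>\<A>) (\<Union>\<B>))"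
    if A: "boxes \<A>" and B: "boxes \<B>" and two: "card \<A> \<ge> 2"
      and IH: "\<And>\<A>' \<B>'. card \<A>' + card \<B>' < card \<A> + card \<B> \<Longrightarrow> boxes \<A>' \<Longrightarrow> boxes \<B>' \<Longrightarrow>
        (root ?n (?m (\<Union>\<A>')) + root ?n (?m (\<Union>\<B>'))) ^ ?n \<le> ?m (msum (\<Union>\<A>') (\<Union>\<B>'))"
    for \<A> \<B> :: "'a set set"
  proof -
    obtain K L i t where KL: "K \<in> \<A>" "L \<in> \<A>" "i \<in> Basis" "K \<subseteq> {x. x \<bullet> i < t}" "L \<subseteq> {x. t < x \<bullet> i}"
      using boxes_separate[OF A two] by blast
    define A1 A2 where "A1 = cut {x. x \<bullet> i < t} \<A>" and "A2 = cut {x. t < x \<bullet> i} \<A>"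
    have ne: "K \<noteq> {}" "L \<noteq> {}" using A KL by (auto simp: boxes_def)
    have b1: "boxes A1" unfolding A1_def using KL ne by (intro boxes_cut[OF A]) auto
    have b2: "boxes A2" unfolding A2_def using KL ne by (intro boxes_cut[OF A]) auto
    have fin: "finite \<A>" using A by (simp add: boxes_def)
    have "L \<inter> {x. x \<bullet> i < t} = {}" "K \<inter> {x. t < x \<bullet> i} = {}" using KL by fastforce+
    then have cards: "card A1 < card \<A>" "card A2 < card \<A>"
      unfolding A1_def A2_def using card_cut_less[OF fin] KL by blast+
    have mA: "?m (\<Union>\<A>) = ?m (\<Union>A1) + ?m (\<Union>A2)"
      unfolding A1_def A2_def Union_cut using boxes_Union[OF A] KL by (intro measure_halfspace_split)
    \<comment> \<open>The fraction of the volume of the first family on the lower side;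
      \<open>s\<close> below is chosen so that the second family is divided in the same
      ratio.\<close>
    define r where "r = ?m (\<Union>A1) / ?m (\<Union>\<A>)"
    have r: "0 < r" "r < 1"
      using boxes_Union(5)[OF b1] boxes_Union(5)[OF b2] mA by (auto simp: r_def)
    have mA12: "?m (\<Union>A1) = r * ?m (\<Union>\<A>)" "?m (\<Union>A2) = (1 - r) * ?m (\<Union>\<A>)"
      using boxes_Union(5)[OF A] mA by (auto simp: r_def field_simps)
    obtain s where s: "?m (\<Union>\<B> \<inter> {x. x \<bullet> i < s}) = r * ?m (\<Union>\<B>)"
      using measure_halfspace_ivt[OF boxes_Union(4,2)[OF B] KL(3) r] by blast
    define B1 B2 where "B1 = cut {x. x \<bullet> i < s} \<B>" and "B2 = cut {x. s < x \<bullet> i} \<B>"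
    have mB: "?m (\<Union>\<B>) = ?m (\<Union>B1) + ?m (\<Union>B2)"
      unfolding B1_def B2_def Union_cut using boxes_Union[OF B] KL by (intro measure_halfspace_split)
    have mB12: "?m (\<Union>B1) = r * ?m (\<Union>\<B>)" "?m (\<Union>B2) = (1 - r) * ?m (\<Union>\<B>)"
      using s mB by (auto simp: B1_def Union_cut algebra_simps)
    have pos: "?m (\<Union>B1) > 0" "?m (\<Union>B2) > 0"
      unfolding mB12 using r boxes_Union(5)[OF B] by simp_all
    have c1: "boxes B1" unfolding B1_def
      by (rule boxes_cut[OF B KL(3)]) (use pos in \<open>auto simp: B1_def Union_cut\<close>)
    have c2: "boxes B2" unfolding B2_def
      by (rule boxes_cut[OF B KL(3)]) (use pos in \<open>auto simp: B2_def Union_cut\<close>)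
    have cardsB: "card B1 \<le> card \<B>" "card B2 \<le> card \<B>"
      unfolding B1_def B2_def using B by (auto simp: boxes_def intro: card_cut_le)
    let ?C1 = "msum (\<Union>A1) (\<Union>B1)" and ?C2 = "msum (\<Union>A2) (\<Union>B2)"
    have meas: "?C1 \<in> lmeasurable" "?C2 \<in> lmeasurable" "msum (\<Union>\<A>) (\<Union>\<B>) \<in> lmeasurable"
      using boxes_Union[OF b1] boxes_Union[OF b2] boxes_Union[OF c1] boxes_Union[OF c2] boxes_Union[OF A] boxes_Union[OF B]
      by (auto intro!: lmeasurable_msum)
    \<comment> \<open>The left-hand side is homogeneous of degree 1 in the pair of volumes. With the
      common ratio \<open>r\<close>, the bounds for the two halves therefore add up exactly to the
      bound for the whole.\<close>
    have scale: "(root ?n (q * x) + root ?n (q * y)) ^ ?n = q * (root ?n x + root ?n y) ^ ?n" if "q \<ge> 0" for q x y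
      using that by (simp add: real_root_mult distrib_left[symmetric] power_mult_distrib)
    have "(root ?n (?m (\<Union>\<A>)) + root ?n (?m (\<Union>\<B>))) ^ ?n
        = r * (root ?n (?m (\<Union>\<A>)) + root ?n (?m (\<Union>\<B>))) ^ ?n
          + (1 - r) * (root ?n (?m (\<Union>\<A>)) + root ?n (?m (\<Union>\<B>))) ^ ?n"
      by (simp add: algebra_simps)
    also have "\<dots> = (root ?n (?m (\<Union>A1)) + root ?n (?m (\<Union>B1))) ^ ?n
        + (root ?n (?m (\<Union>A2)) + root ?n (?m (\<Union>B2))) ^ ?n"
      unfolding mA12 mB12 using r by (simp only: scale diff_ge_0_iff_ge less_imp_le)
    also have "\<dots> \<le> ?m ?C1 + ?m ?C2"
      using cards cardsB b1 b2 c1 c2 by (intro add_mono IH) auto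
    also have "\<dots> = ?m (?C1 \<union> ?C2)"
    proof -
      have "?C1 \<subseteq> {x. x \<bullet> i < t + s}" "?C2 \<subseteq> {x. x \<bullet> i > t + s}"
        unfolding A1_def A2_def B1_def B2_def Union_cut
        by (auto simp: msum_def inner_add_left add_strict_mono)
      then have "?C1 \<inter> ?C2 = {}" by fastforce
      then show ?thesis using meas by (simp add: measure_Un3)
    qed
    also have "\<dots> \<le> ?m (msum (\<Union>\<A>) (\<Union>\<B>))"
    proof (rule measure_mono_fmeasurable)
      show "?C1 \<union> ?C2 \<subseteq> msum (\<Union>\<A>) (\<Union>\<B>)"
        unfolding A1_def A2_def B1_def B2_def Union_cut by (intro Un_least msum_mono) auto
    qed (use meas in auto)
    finally show ?thesis .
  qed
  have "card \<A> > 0" "card \<B> > 0" using less.prems by (auto simp: boxes_def card_gt_0_iff)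
  then have "card \<A> \<ge> 2 \<or> card \<B> \<ge> 2 \<or> (card \<A> = 1 \<and> card \<B> = 1)" by linarith
  then consider "card \<A> \<ge> 2" | "card \<B> \<ge> 2" | "card \<A> = 1" "card \<B> = 1" by blast
  then show ?case
  proof cases
    case 1
    show ?thesis by (rule step[OF less.prems 1 less.hyps])
  next
    case 2
    have "(root ?n (?m (\<Union>\<B>)) + root ?n (?m (\<Union>\<A>))) ^ ?n \<le> ?m (msum (\<Union>\<B>) (\<Union>\<A>))"
    proof (rule step[OF less.prems(2,1) 2])
      fix \<A>' \<B>' :: "'a set set"
      assume "card \<A>' + card \<B>' < card \<B> + card \<A>" and b: "boxes \<A>'" "boxes \<B>'"
      then have "card \<A>' + card \<B>' < card \<A> + card \<B>" by linarith
      from less.hyps[OF this b]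
      show "(root ?n (?m (\<Union>\<A>')) + root ?n (?m (\<Union>\<B>'))) ^ ?n \<le> ?m (msum (\<Union>\<A>') (\<Union>\<B>'))" .
    qed
    then show ?thesis by (simp add: add.commute msum_commute)
  next
    case 3
    then obtain K L where "\<A> = {K}" "\<B> = {L}" by (metis card_1_singletonE)
    moreover obtain a b where "K = box a b" "K \<noteq> {}"
      using less.prems(1) \<open>\<A> = {K}\<close> by (auto simp: boxes_def)
    moreover obtain c d where "L = box c d" "L \<noteq> {}"
      using less.prems(2) \<open>\<B> = {L}\<close> by (auto simp: boxes_def)
    ultimately have ab: "\<A> = {box a b}" "\<B> = {box c d}" "box a b \<noteq> {}" "box c d \<noteq> {}"
      by blast+
    have pos: "(b - a) \<bullet> i > 0" "(d - c) \<bullet> i > 0" if "i \<in> Basis" for i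
      using ab that by (auto simp: box_ne_empty inner_diff_left)
    have mb: "?m (box u v) = (\<Prod>i\<in>Basis. (v - u) \<bullet> i)" if "\<And>i. i \<in> Basis \<Longrightarrow> (v - u) \<bullet> i > 0" for u v :: 'a
      using that measure_lborel_box_eq[of u v] by (auto simp: inner_diff_left less_imp_le)
    have "(root ?n (?m (box a b)) + root ?n (?m (box c d))) ^ ?n
        \<le> root ?n (\<Prod>i\<in>Basis. (b - a) \<bullet> i + (d - c) \<bullet> i) ^ ?n"
    proof (rule power_mono)
      have "?m (box a b) = (\<Prod>i\<in>Basis. (b - a) \<bullet> i)" "?m (box c d) = (\<Prod>i\<in>Basis. (d - c) \<bullet> i)"
        by (rule mb, erule pos)+
      then show "root ?n (?m (box a b)) + root ?n (?m (box c d)) \<le> root ?n (\<Prod>i\<in>Basis. (b - a) \<bullet> i + (d - c) \<bullet> i)"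
        using root_prod_add_le[of Basis "\<lambda>i. (b - a) \<bullet> i" "\<lambda>i. (d - c) \<bullet> i"] pos by simp
      show "0 \<le> root ?n (?m (box a b)) + root ?n (?m (box c d))"
        by (intro add_nonneg_nonneg real_root_ge_zero measure_nonneg)
    qed
    also have "\<dots> = (\<Prod>i\<in>Basis. (b - a) \<bullet> i + (d - c) \<bullet> i)"
      by (intro real_root_pow_pos2 DIM_positive prod_nonneg add_nonneg_nonneg less_imp_le pos)
    also have "\<dots> = ?m (box (a + c) (b + d))"
      using pos by (subst mb) (auto simp: inner_diff_left inner_add_left add_strict_mono intro!: prod.cong)
    also have "\<dots> \<le> ?m (msum (box a b) (box c d))"
      by (intro measure_mono_fmeasurable box_msum ab lmeasurable_msum) auto
    finally show ?thesis by (simp add: ab)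
  qed
qed

section \<open>From finite unions of boxes to open sets\<close>

lemma open_approx_boxes:
  fixes U :: "'a::euclidean_space set"
  assumes U: "open U" "bounded U" "U \<noteq> {}" and e: "e > 0"
  obtains \<A> where "boxes \<A>" "\<Union>\<A> \<subseteq> U" "measure lebesgue (\<Union>\<A>) > measure lebesgue U - e"
proof -
  obtain c where c: "U \<subseteq> cbox (-c) c" using bounded_subset_cbox_symmetric[OF U(2)] by blast
  have "box (-c) c \<noteq> {}"
    using U interior_maximal[OF c U(1)] by (auto simp: interior_cbox)
  \<comment> \<open>With this gauge every interval tagged in \<open>U\<close> stays inside
    \<open>U\<close>. Outside \<open>U\<close> the radius is arbitrary, since a gauge is defined
    everywhere.\<close>
  have "\<forall>x. \<exists>d>0. x \<in> U \<longrightarrow> ball x d \<subseteq> U"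
    using U(1) open_contains_ball by (metis zero_less_one)
  then obtain d where d: "\<And>x. d x > 0" "\<And>x. x \<in> U \<Longrightarrow> ball x (d x) \<subseteq> U" by metis
  have "gauge (\<lambda>x. ball x (d x))" using d by (auto simp: gauge_def)
  from covering_lemma[OF c \<open>box (-c) c \<noteq> {}\<close> this] obtain \<D> where \<D>: "countable \<D>"
    "\<And>K. K \<in> \<D> \<Longrightarrow> interior K \<noteq> {} \<and> (\<exists>c d. K = cbox c d)"
    "pairwise (\<lambda>A B. interior A \<inter> interior B = {}) \<D>"
    "\<And>K. K \<in> \<D> \<Longrightarrow> \<exists>x\<in>U \<inter> K. K \<subseteq> ball x (d x)" "U \<subseteq> \<Union>\<D>" by metis
  have sub: "K \<subseteq> U" if "K \<in> \<D>" for K using \<D>(4)[OF that] d by blast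
  have "\<D> \<noteq> {}" using \<D>(5) U by auto
  \<comment> \<open>The enumeration may repeat intervals; this is harmless because
    \<open>boxes\<close> speaks of a set of boxes and compares only distinct ones.\<close>
  define f where "f = from_nat_into \<D>"
  have rf: "range f = \<D>" unfolding f_def using \<D>(1) \<open>\<D> \<noteq> {}\<close> by (rule range_from_nat_into[rotated])
  define A where "A n = (\<Union>m<n. interior (f m))" for n
  have A: "range A \<subseteq> sets lebesgue" "incseq A"
    unfolding A_def by (auto intro!: sets.finite_UN borel_open incseq_SucI simp: less_Suc_eq)
  have UA: "(\<Union>n. A n) \<subseteq> U" unfolding A_def using sub rf interior_subset by fastforce
  have Ulm: "U \<in> lmeasurable" using U lmeasurable_open by blast
  have "U - (\<Union>n. A n) \<subseteq> (\<Union>n. f n - interior (f n))"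
  proof
    fix x assume x: "x \<in> U - (\<Union>n. A n)"
    then obtain n where "x \<in> f n" using \<D>(5) rf by blast
    moreover have "x \<notin> interior (f n)" using x unfolding A_def by blast
    ultimately show "x \<in> (\<Union>n. f n - interior (f n))" by blast
  qed
  moreover have "negligible (f n - interior (f n))" for n
  proof -
    obtain a b where "f n = cbox a b" using \<D>(2)[of "f n"] rf by blast
    then show ?thesis using negligible_frontier_interval[of a b] by (simp add: interior_cbox)
  qed
  then have "negligible (\<Union>n. f n - interior (f n))"
    by (intro negligible_countable_Union) auto
  ultimately have neg: "negligible (U - (\<Union>n. A n))"
    by (meson negligible_subset)
  have mU: "measure lebesgue U = measure lebesgue (\<Union>n. A n)"
  proof -
    have "U = (\<Union>n. A n) \<union> (U - (\<Union>n. A n))" using UA by blast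
    moreover have "measure lebesgue ((\<Union>n. A n) \<union> (U - (\<Union>n. A n))) = measure lebesgue (\<Union>n. A n)"
      using A(1) neg by (intro measure_Un_null_set sets.countable_UN) (simp_all add: negligible_iff_null_sets)
    ultimately show ?thesis by metis
  qed
  have "(\<lambda>n. measure lebesgue (A n)) \<longlonglongrightarrow> measure lebesgue (\<Union>n. A n)"
  proof (rule Lim_measure_incseq[OF A])
    have "emeasure lebesgue (\<Union>n. A n) \<le> emeasure lebesgue U"
      using UA Ulm by (intro emeasure_mono) (auto dest: fmeasurableD)
    then show "emeasure lebesgue (\<Union>n. A n) \<noteq> \<infinity>"
      using Ulm by (auto simp: fmeasurable_def top_unique)
  qed
  then have "\<forall>\<^sub>F n in sequentially. measure lebesgue (A n) > measure lebesgue U - e"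
    using order_tendstoD(1) mU e by (metis diff_less_eq less_add_same_cancel1)
  then obtain n where n: "n \<ge> 1" "measure lebesgue (A n) > measure lebesgue U - e"
    by (metis eventually_at_top_linorder le_cases order_refl)
  show ?thesis
  proof (rule that[of "(\<lambda>m. interior (f m)) ` {..<n}"])
    have fD: "f m \<in> \<D>" for m using rf by blast
    show "boxes ((\<lambda>m. interior (f m)) ` {..<n})"
      unfolding boxes_def
    proof (intro conjI ballI)
      show "(\<lambda>m. interior (f m)) ` {..<n} \<noteq> {}" using n(1) by (auto simp: lessThan_empty_iff)
      fix K assume "K \<in> (\<lambda>m. interior (f m)) ` {..<n}"
      then obtain k where k: "K = interior (f k)" by blast
      from \<D>(2)[OF fD[of k]] obtain a b where "interior (f k) \<noteq> {}" "f k = cbox a b" by blast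
      then show "K \<noteq> {}" "\<exists>a b. K = box a b" unfolding k by (metis interior_cbox)+
    next
      fix K L assume "K \<in> (\<lambda>m. interior (f m)) ` {..<n}" "L \<in> (\<lambda>m. interior (f m)) ` {..<n}"
      then obtain k l where "K = interior (f k)" "L = interior (f l)" by blast
      then show "K \<noteq> L \<longrightarrow> K \<inter> L = {}"
        using pairwiseD[OF \<D>(3) fD[of k] fD[of l]] by metis
    qed (rule finite_imageI, rule finite_lessThan)
    show "\<Union> ((\<lambda>m. interior (f m)) ` {..<n}) \<subseteq> U" using UA unfolding A_def by blast
    show "measure lebesgue (\<Union> ((\<lambda>m. interior (f m)) ` {..<n})) > measure lebesgue U - e"
      using n(2) unfolding A_def .
  qed
qed

lemma brunn_minkowski_open:
  fixes U V :: "'a::euclidean_space set"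
  assumes U: "open U" "bounded U" "U \<noteq> {}" and V: "open V" "bounded V" "V \<noteq> {}"
  shows "(root DIM('a) (measure lebesgue U) + root DIM('a) (measure lebesgue V)) ^ DIM('a)
    \<le> measure lebesgue (msum U V)"
proof -
  let ?n = "DIM('a)" and ?m = "measure lebesgue :: 'a set \<Rightarrow> real"
  have ineq: "(root ?n (?m U - e) + root ?n (?m V - e)) ^ ?n \<le> ?m (msum U V)"
    if e: "e > 0" "e < ?m U" "e < ?m V" for e
  proof -
    obtain \<A> where A: "boxes \<A>" "\<Union>\<A> \<subseteq> U" "?m (\<Union>\<A>) > ?m U - e"
      using open_approx_boxes[OF U e(1)] by blast
    obtain \<B> where B: "boxes \<B>" "\<Union>\<B> \<subseteq> V" "?m (\<Union>\<B>) > ?m V - e"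
      using open_approx_boxes[OF V e(1)] by blast
    have "(root ?n (?m U - e) + root ?n (?m V - e)) ^ ?n \<le> (root ?n (?m (\<Union>\<A>)) + root ?n (?m (\<Union>\<B>))) ^ ?n"
      using A B e by (intro power_mono add_mono) auto
    also have "\<dots> \<le> ?m (msum (\<Union>\<A>) (\<Union>\<B>))"
      using A B by (intro brunn_minkowski_boxes)
    also have "\<dots> \<le> ?m (msum U V)"
      using A(1,2) B(1,2) U V boxes_Union[OF A(1)] boxes_Union[OF B(1)]
      by (intro measure_mono_fmeasurable msum_mono lmeasurable_msum fmeasurableD)
    finally show ?thesis .
  qed
  have pos: "?m U > 0" "?m V > 0"
    using U V open_not_negligible negligible_iff_measure lmeasurable_open measure_nonneg
    by (metis less_eq_real_def)+
  have "((\<lambda>e. (root ?n (?m U - e) + root ?n (?m V - e)) ^ ?n) \<longlongrightarrow> (root ?n (?m U - 0) + root ?n (?m V - 0)) ^ ?n) (at_right 0)"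
    by (intro tendsto_intros)
  moreover have "\<forall>\<^sub>F e in at_right 0. (root ?n (?m U - e) + root ?n (?m V - e)) ^ ?n \<le> ?m (msum U V)"
    using eventually_at_right_less[of 0] eventually_at_right[of 0 "min (?m U) (?m V)"] pos ineq
    by (auto simp: eventually_at_right_field intro!: exI[of _ "min (?m U) (?m V)"])
  ultimately show ?thesis
    using tendsto_upperbound[of _ _ "at_right (0::real)"] by (simp add: trivial_limit_at_right_real)
qed

text \<open>The root of the volume of a ball is proportional to its radius, so Brunn--Minkowski with
  a ball as one summand becomes a statement about radii; \<open>msum U (ball 0 t)\<close> is the
  open \<open>t\<close>-neighbourhood of \<open>U\<close>.\<close>

lemma brunn_minkowski_ball:
  fixes U :: "'a::euclidean_space set"
  assumes U: "open U" "bounded U" "U \<noteq> {}" and t: "t > 0" "x \<ge> 0"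
    and le: "measure lebesgue (ball (0::'a) x) \<le> measure lebesgue U"
  shows "measure lebesgue (ball (0::'a) (x + t)) \<le> measure lebesgue (msum U (ball 0 t))"
proof -
  let ?n = "DIM('a)" and ?m = "measure lebesgue :: 'a set \<Rightarrow> real"
  define w where "w = unit_ball_vol (real ?n)"
  have w: "w > 0" by (simp add: w_def)
  have mb: "?m (ball 0 y) = w * y ^ ?n" if "y \<ge> 0" for y
    using content_ball[OF that, of "0::'a"] by (simp add: w_def)
  have rb: "root ?n (?m (ball 0 y)) = root ?n w * y" if "y \<ge> 0" for y
    unfolding mb[OF that] using that by (simp add: real_root_mult real_root_power_cancel)
  have "(root ?n (?m (ball 0 x)) + root ?n (?m (ball 0 t))) ^ ?n = (root ?n w * (x + t)) ^ ?n"
    using rb[of x] rb[of t] t by (simp only: less_imp_le distrib_left)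
  also have "\<dots> = w * (x + t) ^ ?n"
    using w by (simp add: power_mult_distrib real_root_pow_pos2)
  also have "\<dots> = ?m (ball 0 (x + t))"
    using mb[of "x + t"] t by linarith
  finally have "?m (ball 0 (x + t)) = (root ?n (?m (ball 0 x)) + root ?n (?m (ball 0 t))) ^ ?n" ..
  also have "\<dots> \<le> (root ?n (?m U) + root ?n (?m (ball 0 t))) ^ ?n"
    using le by (intro power_mono add_mono add_nonneg_nonneg) auto
  also have "\<dots> \<le> ?m (msum U (ball 0 t))"
    using U t by (intro brunn_minkowski_open) auto
  finally show ?thesis .
qed

section \<open>Weak gradients\<close>

lemma integral_lebesgue_on_support:
  fixes f :: "'a::euclidean_space \<Rightarrow> 'b::euclidean_space"
  assumes "D \<in> sets lebesgue" "\<And>x. x \<notin> D \<Longrightarrow> f x = 0"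
  shows "integral\<^sup>L (lebesgue_on D) f = integral\<^sup>L lebesgue f"
    "integrable (lebesgue_on D) f \<longleftrightarrow> integrable lebesgue f"
proof -
  have "(\<lambda>x. if x \<in> D then f x else 0) = f" using assms(2) by auto
  then show "integral\<^sup>L (lebesgue_on D) f = integral\<^sup>L lebesgue f"
    "integrable (lebesgue_on D) f \<longleftrightarrow> integrable lebesgue f"
    using Lebesgue_Measure.integral_restrict_UNIV[OF assms(1), of f] Lebesgue_Measure.integrable_restrict_UNIV[OF assms(1), of f] by auto
qed

lemma integrable_continuous_compact_support:
  fixes f :: "'a::euclidean_space \<Rightarrow> 'b::euclidean_space"
  assumes f: "continuous_on UNIV f" and C: "compact C" "\<And>x. x \<notin> C \<Longrightarrow> f x = 0"
  shows "integrable lborel f" "integrable lebesgue f" "f \<in> borel_measurable borel"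
proof -
  show m: "f \<in> borel_measurable borel" using f by (rule borel_measurable_continuous_onI)
  have "(\<lambda>x. indicat_real C x *\<^sub>R f x) = f" using C(2) by (auto simp: indicator_def)
  then show i: "integrable lborel f"
    using borel_integrable_compact[OF C(1), of f] continuous_on_subset[OF f, of C] by simp
  show "integrable lebesgue f" using i m by (simp add: integrable_completion)
qed

lemma Cc_infinity_support:
  assumes "f \<in> Cc_infinity U"
  obtains C where "compact C" "C \<subseteq> U" "\<And>x. x \<notin> C \<Longrightarrow> f x = 0" "\<And>x. x \<notin> C \<Longrightarrow> gradient f x = 0"
proof -
  have "compact (closure {x. f x \<noteq> 0})" "closure {x. f x \<noteq> 0} \<subseteq> U"
    using assms by (auto simp: Cc_infinity_def)
  then show ?thesis using that Cc_infinity_outside[OF assms] by blast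
qed

lemma Cc_infinity_zero_outside:
  assumes "f \<in> Cc_infinity U" "x \<notin> U"
  shows "f x = 0" "gradient f x = 0"
proof -
  obtain C where "C \<subseteq> U" "\<And>x. x \<notin> C \<Longrightarrow> f x = 0" "\<And>x. x \<notin> C \<Longrightarrow> gradient f x = 0"
    using Cc_infinity_support[OF assms(1)] by metis
  with assms(2) show "f x = 0" "gradient f x = 0" by auto
qed

lemma continuous_compact_support_bounded:
  fixes f :: "'a::euclidean_space \<Rightarrow> 'b::euclidean_space"
  assumes f: "continuous_on UNIV f" and C: "compact C" "\<And>x. x \<notin> C \<Longrightarrow> f x = 0"
  obtains M where "M > 0" "\<And>x. norm (f x) \<le> M"
proof -
  have "compact (f ` C)" using C f continuous_on_subset by (blast intro: compact_continuous_image)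
  then obtain M where M: "M > 0" "\<And>x. x \<in> C \<Longrightarrow> norm (f x) \<le> M"
    using compact_imp_bounded bounded_pos by (metis imageI)
  show ?thesis
  proof (rule that[OF M(1)])
    show "norm (f x) \<le> M" for x using M C(2)[of x] by (cases "x \<in> C") auto
  qed
qed

lemma Cc_infinity_Lipschitz:
  assumes "f \<in> Cc_infinity U"
  obtains M where "M > 0" "\<And>x. \<bar>f x\<bar> \<le> M" "\<And>x. norm (gradient f x) \<le> M"
    "\<And>x y. \<bar>f x - f y\<bar> \<le> M * norm (x - y)"
proof -
  obtain C where C: "compact C" "\<And>x. x \<notin> C \<Longrightarrow> f x = 0" "\<And>x. x \<notin> C \<Longrightarrow> gradient f x = 0"
    using Cc_infinity_support[OF assms] by metis
  obtain M1 where M1: "M1 > 0" "\<And>x. norm (f x) \<le> M1"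
    using continuous_compact_support_bounded[OF Cc_infinity_gradient(3)[OF assms] C(1,2)] by blast
  obtain M2 where M2: "M2 > 0" "\<And>x. norm (gradient f x) \<le> M2"
    using continuous_compact_support_bounded[OF Cc_infinity_gradient(2)[OF assms] C(1,3)] by blast
  have lip: "norm (f x - f y) \<le> M2 * norm (x - y)" for x y
  proof (rule differentiable_bound[of UNIV f "\<lambda>x h. h \<bullet> gradient f x"])
    show "(f has_derivative (\<lambda>h. h \<bullet> gradient f x)) (at x within UNIV)" for x
      using Cc_infinity_gradient(1)[OF assms] by (simp add: gderiv_def)
    show "onorm (\<lambda>h. h \<bullet> gradient f x) \<le> M2" for x
    proof (rule onorm_bound)
      show "norm (h \<bullet> gradient f x) \<le> M2 * norm h" for h
        using Cauchy_Schwarz_ineq2[of h "gradient f x"] M2(2)[of x]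
        by (metis mult.commute mult_left_mono norm_ge_zero order_trans real_norm_def)
    qed (use M2 in simp)
  qed auto
  show ?thesis
  proof (rule that[of "max M1 M2"])
    show "\<bar>f x - f y\<bar> \<le> max M1 M2 * norm (x - y)" for x y
      using lip[of x y] by (smt (verit) mult_right_mono norm_ge_zero real_norm_def max.cobounded2)
  qed (use M1 M2 in \<open>auto intro: order_trans[OF _ max.cobounded1] order_trans[OF _ max.cobounded2]\<close>)
qed

lemma integrable_truncated_Cc_infinity:
  assumes v: "v \<in> Cc_infinity U" and "d \<ge> 0" "q > 0"
  shows "integrable lebesgue (\<lambda>x. max 0 (\<bar>v x\<bar> - d) powr q)"
proof -
  obtain C where C: "compact C" "\<And>x. x \<notin> C \<Longrightarrow> v x = 0" using Cc_infinity_support[OF v] by metis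
  then show ?thesis
    using assms(2,3) Cc_infinity_gradient(3)[OF v]
    by (intro integrable_continuous_compact_support(2)[OF _ C(1)] continuous_on_powr' continuous_intros) auto
qed

text \<open>By translation invariance every difference quotient of \<open>f\<close> has integral 0.
  The quotients converge to the partial derivative and are bounded by the Lipschitz constant on a
  fixed compact set, so dominated convergence applies.\<close>

lemma integral_gradient_Cc_infinity:
  fixes f :: "'a::euclidean_space \<Rightarrow> real"
  assumes "f \<in> Cc_infinity U"
  shows "(\<integral>x. gradient f x \<partial>lebesgue) = 0"
proof -
  obtain C where C: "compact C" "\<And>x. x \<notin> C \<Longrightarrow> f x = 0" "\<And>x. x \<notin> C \<Longrightarrow> gradient f x = 0"
    using Cc_infinity_support[OF assms] by metis
  obtain M where M: "M > 0" "\<And>x y. \<bar>f x - f y\<bar> \<le> M * norm (x - y)"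
    using Cc_infinity_Lipschitz[OF assms] by metis
  note g = Cc_infinity_gradient[OF assms]
  note intf = integrable_continuous_compact_support[OF g(3) C(1,2)]
  note intg = integrable_continuous_compact_support[OF g(2) C(1,3)]
  have shift: "integrable lborel (\<lambda>x. f (x + a))" "(\<integral>x. f (x + a) \<partial>lborel) = (\<integral>x. f x \<partial>lborel)" for a
  proof -
    have "(\<integral>x. f x \<partial>distr lborel borel ((+) a)) = (\<integral>x. f (a + x) \<partial>lborel)"
      using intf(3) by (intro integral_distr) simp_all
    then show "(\<integral>x. f (x + a) \<partial>lborel) = (\<integral>x. f x \<partial>lborel)"
      by (simp add: lborel_distr_plus add.commute)
    have "integrable (distr lborel borel ((+) a)) f \<longleftrightarrow> integrable lborel (\<lambda>x. f (a + x))"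
      using intf(3) by (intro integrable_distr_eq) simp_all
    then show "integrable lborel (\<lambda>x. f (x + a))"
      using intf(1) by (simp add: lborel_distr_plus add.commute)
  qed
  have "(\<integral>x. gradient f x \<bullet> e \<partial>lborel) = 0" if e: "e \<in> Basis" for e
  proof -
    define h where "h n = inverse (real (Suc n))" for n
    have h: "h n > 0" "h n \<le> 1" for n by (auto simp: h_def inverse_le_1_iff)
    have h0: "h \<longlonglongrightarrow> 0" unfolding h_def by (rule LIMSEQ_inverse_real_of_nat)
    define s where "s n x = (f (x + h n *\<^sub>R e) - f x) / h n" for n x
    \<comment> \<open>The closed 1-neighbourhood of the support. It contains the supports of all the
      difference quotients, since the steps \<open>h n\<close> are at most 1.\<close>
    define K where "K = {x - y |x y. x \<in> C \<and> y \<in> cball 0 1}"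
    have K: "compact K" unfolding K_def by (rule compact_differences[OF C(1) compact_cball])
    have s0: "(\<integral>x. s n x \<partial>lborel) = 0" for n
      unfolding s_def using shift[of "h n *\<^sub>R e"] intf(1) by simp
    have "(\<lambda>n. \<integral>x. s n x \<partial>lborel) \<longlonglongrightarrow> (\<integral>x. gradient f x \<bullet> e \<partial>lborel)"
    proof (rule integral_dominated_convergence[where w = "\<lambda>x. indicat_real K x *\<^sub>R M"])
      show "(\<lambda>x. gradient f x \<bullet> e) \<in> borel_measurable lborel"
        using intg(3) by simp
      show "s n \<in> borel_measurable lborel" for n
        unfolding s_def[abs_def] using shift[of "h n *\<^sub>R e"] intf(1) by measurable
      show "integrable lborel (\<lambda>x. indicat_real K x *\<^sub>R M)"
        by (rule borel_integrable_compact[OF K]) simp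
      show "AE x in lborel. (\<lambda>n. s n x) \<longlonglongrightarrow> gradient f x \<bullet> e"
      proof (intro AE_I2)
        fix x
        have "(f has_derivative (\<lambda>k. k \<bullet> gradient f x)) (at x)"
          using g(1) by (simp add: gderiv_def)
        then have "((\<lambda>t. f (x + t *\<^sub>R e)) has_derivative (\<lambda>t. (t *\<^sub>R e) \<bullet> gradient f x)) (at 0)"
          by (intro has_derivative_compose[where f = "\<lambda>t. x + t *\<^sub>R e" and g = f, simplified o_def])
            (auto intro!: derivative_eq_intros)
        moreover have "(\<lambda>t. (t *\<^sub>R e) \<bullet> gradient f x) = (*) (gradient f x \<bullet> e)"
          by (auto simp: inner_commute)
        ultimately have "((\<lambda>t. f (x + t *\<^sub>R e)) has_field_derivative (gradient f x \<bullet> e)) (at 0)"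
          by (simp only: has_field_derivative_def)
        then have "((\<lambda>t. (f (x + t *\<^sub>R e) - f x) / t) \<longlongrightarrow> gradient f x \<bullet> e) (at 0)"
          by (simp add: has_field_derivative_iff)
        moreover have "filterlim h (at 0) sequentially"
          using h0 h(1) by (simp add: filterlim_at less_imp_neq[symmetric])
        ultimately show "(\<lambda>n. s n x) \<longlonglongrightarrow> gradient f x \<bullet> e"
          unfolding s_def by (rule filterlim_compose)
      qed
      show "AE x in lborel. norm (s n x) \<le> indicat_real K x *\<^sub>R M" for n
      proof (intro AE_I2)
        fix x
        show "norm (s n x) \<le> indicat_real K x *\<^sub>R M"
        proof (cases "x \<in> K")
          case True
          have "\<bar>f (x + h n *\<^sub>R e) - f x\<bar> \<le> M * h n"
            using M(2)[of "x + h n *\<^sub>R e" x] e h(1)[of n] by simp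
          then show ?thesis using True h(1)[of n] by (simp add: s_def field_simps)
        next
          case False
          have "x + h n *\<^sub>R e \<notin> C"
          proof
            assume "x + h n *\<^sub>R e \<in> C"
            moreover have "h n *\<^sub>R e \<in> cball 0 1" using h(1,2)[of n] e by simp
            ultimately have "(x + h n *\<^sub>R e) - h n *\<^sub>R e \<in> K" unfolding K_def by blast
            with False show False by simp
          qed
          moreover have "x \<notin> C"
          proof
            assume "x \<in> C"
            moreover have "0 \<in> cball (0::'a) 1" by simp
            ultimately have "x - 0 \<in> K" unfolding K_def by blast
            with False show False by simp
          qed
          ultimately show ?thesis using C(2) by (simp add: s_def False)
        qed
      qed
    qed
    then show ?thesis unfolding s0 by (simp add: LIMSEQ_const_iff)
  qed
  moreover have "integrable lborel (gradient f)" using intg(1) by blast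
  ultimately have "(\<integral>x. gradient f x \<partial>lborel) \<bullet> e = 0 \<bullet> e" if "e \<in> Basis" for e
    using that by simp
  then have "(\<integral>x. gradient f x \<partial>lborel) = 0"
    by (rule euclidean_eqI)
  then show ?thesis using intg(3) by (simp add: integral_completion)
qed

lemma Cc_infinity_mult:
  assumes "f \<in> Cc_infinity U" "\<And>k. Ck k g"
  shows "(\<lambda>x. f x * g x) \<in> Cc_infinity U"
    "gradient (\<lambda>x. f x * g x) x = f x *\<^sub>R gradient g x + g x *\<^sub>R gradient f x"
proof -
  obtain C where C: "compact C" "C \<subseteq> U" "\<And>x. x \<notin> C \<Longrightarrow> f x = 0"
    using Cc_infinity_support[OF assms(1)] by metis
  show "(\<lambda>x. f x * g x) \<in> Cc_infinity U"
    using C assms by (intro Cc_infinityI[of _ C]) (auto intro: Ck_mult Cc_infinity_Ck)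
  show "gradient (\<lambda>x. f x * g x) x = f x *\<^sub>R gradient g x + g x *\<^sub>R gradient f x"
    by (intro gradient_eqI GDERIV_mult Cc_infinity_gradient[OF assms(1)] Ck_imp_gradient assms)
qed

lemma integrable_Cc_infinity:
  assumes "f \<in> Cc_infinity U"
  shows "integrable lebesgue f" "integrable lebesgue (gradient f)"
proof -
  obtain C where C: "compact C" "\<And>x. x \<notin> C \<Longrightarrow> f x = 0" "\<And>x. x \<notin> C \<Longrightarrow> gradient f x = 0"
    using Cc_infinity_support[OF assms] by metis
  show "integrable lebesgue f" "integrable lebesgue (gradient f)"
    using integrable_continuous_compact_support(2)[OF Cc_infinity_gradient(3)[OF assms] C(1,2)]
      integrable_continuous_compact_support(2)[OF Cc_infinity_gradient(2)[OF assms] C(1,3)] by auto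
qed

text \<open>Only one factor is compactly supported, which allows a linear function as the other
  factor in the Poincare inequality.\<close>

lemma integration_by_parts_Cc_infinity:
  assumes f: "f \<in> Cc_infinity U" and g: "\<And>k. Ck k g"
  shows "(\<integral>x. f x *\<^sub>R gradient g x \<partial>lebesgue) = - (\<integral>x. g x *\<^sub>R gradient f x \<partial>lebesgue)"
proof -
  obtain C where C: "compact C" "C \<subseteq> U" "\<And>x. x \<notin> C \<Longrightarrow> f x = 0" "\<And>x. x \<notin> C \<Longrightarrow> gradient f x = 0"
    using Cc_infinity_support[OF f] by metis
  have "continuous_on UNIV g" using g[of 0] by simp
  then have i: "integrable lebesgue (\<lambda>x. f x *\<^sub>R gradient g x)" "integrable lebesgue (\<lambda>x. g x *\<^sub>R gradient f x)"
    using C(3,4)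
    by (auto intro!: integrable_continuous_compact_support[OF _ C(1)] continuous_intros
        Cc_infinity_gradient[OF f] Ck_imp_gradient(3) g)
  have "0 = (\<integral>x. f x *\<^sub>R gradient g x + g x *\<^sub>R gradient f x \<partial>lebesgue)"
    using integral_gradient_Cc_infinity[OF Cc_infinity_mult(1)[OF f g]]
    unfolding Cc_infinity_mult(2)[OF f g] by simp
  also have "\<dots> = (\<integral>x. f x *\<^sub>R gradient g x \<partial>lebesgue) + (\<integral>x. g x *\<^sub>R gradient f x \<partial>lebesgue)"
    using i by (rule Bochner_Integration.integral_add)
  finally show ?thesis by (simp add: eq_neg_iff_add_eq_0)
qed

lemma has_weak_gradient_Cc_infinity:
  assumes D: "open D" and f: "f \<in> Cc_infinity D"
  shows "has_weak_gradient D f (gradient f)"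
  unfolding has_weak_gradient_def locally_integrable_def
proof (intro conjI allI impI ballI)
  note c = Cc_infinity_gradient[OF f]
  have bm: "f \<in> borel_measurable lebesgue" "gradient f \<in> borel_measurable lebesgue"
    using integrable_Cc_infinity[OF f] by auto
  fix K :: "'a set" assume K: "compact K \<and> K \<subseteq> D"
  then have Ks: "K \<in> sets lebesgue" by (simp add: lmeasurable_compact fmeasurableD)
  show "integrable (lebesgue_on K) f" "integrable (lebesgue_on K) (gradient f)"
    using integrable_mult_indicator[OF Ks integrable_Cc_infinity(1)[OF f]]
      integrable_mult_indicator[OF Ks integrable_Cc_infinity(2)[OF f]] Ks
    by (simp_all add: integrable_restrict_space)
next
  fix \<phi> assume p: "\<phi> \<in> Cc_infinity D"
  have Ds: "D \<in> sets lebesgue" using D by auto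
  show "(\<integral>x. f x *\<^sub>R gradient \<phi> x \<partial>lebesgue_on D) = - (\<integral>x. \<phi> x *\<^sub>R gradient f x \<partial>lebesgue_on D)"
    using integration_by_parts_Cc_infinity[OF f Cc_infinity_Ck[OF p]]
    by (subst (1 2) integral_lebesgue_on_support[OF Ds]) (simp_all add: Cc_infinity_zero_outside[OF p])
qed

lemma integrable_locally_integrable_bound:
  fixes u :: "'a::euclidean_space \<Rightarrow> 'b::euclidean_space" and F :: "'a \<Rightarrow> 'c::euclidean_space"
  assumes u: "locally_integrable D u" and K: "compact K" "K \<subseteq> D" and D: "open D"
    and F: "F \<in> borel_measurable (lebesgue_on K)" "\<And>x. norm (F x) \<le> M * norm (u x)" "\<And>x. x \<notin> K \<Longrightarrow> F x = 0"
  shows "integrable (lebesgue_on D) F"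
proof -
  have Ks: "K \<in> sets lebesgue" using K by (simp add: lmeasurable_compact fmeasurableD)
  have "integrable (lebesgue_on K) u" using u K by (auto simp: locally_integrable_def)
  then have "integrable (lebesgue_on K) (\<lambda>x. M * norm (u x))" by simp
  then have "integrable (lebesgue_on K) F"
    by (rule Bochner_Integration.integrable_bound) (use F in \<open>auto intro!: AE_I2 order_trans[OF F(2)]\<close>)
  then have "integrable lebesgue F"
    using integral_lebesgue_on_support(2)[OF Ks, of F] F(3) by auto
  then show ?thesis
    using integral_lebesgue_on_support(2)[of D F] D F(3) K by auto
qed

lemma has_weak_gradient_integrable:
  assumes D: "open D" and w: "has_weak_gradient D u g" and p: "\<phi> \<in> Cc_infinity D"
  shows "integrable (lebesgue_on D) (\<lambda>x. u x *\<^sub>R gradient \<phi> x)"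
    "integrable (lebesgue_on D) (\<lambda>x. \<phi> x *\<^sub>R g x)"
proof -
  obtain C where C: "compact C" "C \<subseteq> D" "\<And>x. x \<notin> C \<Longrightarrow> \<phi> x = 0" "\<And>x. x \<notin> C \<Longrightarrow> gradient \<phi> x = 0"
    using Cc_infinity_support[OF p] by metis
  have Cs: "C \<in> sets lebesgue" using C by (simp add: lmeasurable_compact fmeasurableD)
  obtain M where M: "M > 0" "\<And>x. \<bar>\<phi> x\<bar> \<le> M" "\<And>x. norm (gradient \<phi> x) \<le> M"
    using Cc_infinity_Lipschitz[OF p] by metis
  have l: "locally_integrable D u" "locally_integrable D g" using w by (auto simp: has_weak_gradient_def)
  then have m: "u \<in> borel_measurable (lebesgue_on C)" "g \<in> borel_measurable (lebesgue_on C)"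
    using C by (auto simp: locally_integrable_def)
  have mp: "\<phi> \<in> borel_measurable (lebesgue_on C)" "gradient \<phi> \<in> borel_measurable (lebesgue_on C)"
    using integrable_Cc_infinity[OF p] by (auto intro!: measurable_restrict_space1)
  have b: "norm (u x *\<^sub>R gradient \<phi> x) \<le> M * norm (u x)" "norm (\<phi> x *\<^sub>R g x) \<le> M * norm (g x)" for x
    using mult_right_mono[OF M(3)[of x], of "\<bar>u x\<bar>"] mult_right_mono[OF M(2)[of x], of "norm (g x)"]
    by (simp_all add: mult.commute)
  show "integrable (lebesgue_on D) (\<lambda>x. u x *\<^sub>R gradient \<phi> x)"
    by (rule integrable_locally_integrable_bound[OF l(1) C(1,2) D, of _ M])
      (use m mp b C in auto)
  show "integrable (lebesgue_on D) (\<lambda>x. \<phi> x *\<^sub>R g x)"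
    by (rule integrable_locally_integrable_bound[OF l(2) C(1,2) D, of _ M])
      (use m mp b C in auto)
qed

lemma has_weak_gradient_diff:
  assumes D: "open D" and u: "has_weak_gradient D u g" and v: "has_weak_gradient D v h"
  shows "has_weak_gradient D (\<lambda>x. u x - v x) (\<lambda>x. g x - h x)"
  unfolding has_weak_gradient_def
proof (intro conjI ballI)
  show "locally_integrable D (\<lambda>x. u x - v x)" "locally_integrable D (\<lambda>x. g x - h x)"
    using u v by (auto simp: has_weak_gradient_def locally_integrable_def)
  fix \<phi> assume p: "\<phi> \<in> Cc_infinity D"
  show "(\<integral>x. (u x - v x) *\<^sub>R gradient \<phi> x \<partial>lebesgue_on D) = - (\<integral>x. \<phi> x *\<^sub>R (g x - h x) \<partial>lebesgue_on D)"
    using has_weak_gradient_integrable[OF D u p] has_weak_gradient_integrable[OF D v p] u v p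
    by (simp add: scaleR_diff_left scaleR_diff_right has_weak_gradient_def)
qed

section \<open>The fundamental lemma of the calculus of variations and uniqueness of weak
  gradients\<close>

lemma Ck_box_bump: "Ck k (\<lambda>x. \<Prod>i\<in>Basis. flat (n * ((x \<bullet> i - a \<bullet> i) * (b \<bullet> i - x \<bullet> i))))"
  by (intro Ck_prod Ck_compose[OF Ck_flat, where f="\<lambda>x. n * ((x \<bullet> i - a \<bullet> i) * (b \<bullet> i - x \<bullet> i))" for i]
      Ck_mult Ck_diff Ck_const Ck_inner)

lemma box_bump_outside:
  assumes "box a b \<noteq> {}" "x \<notin> box a b" "n \<ge> 0"
  shows "(\<Prod>i\<in>Basis. flat (n * ((x \<bullet> i - a \<bullet> i) * (b \<bullet> i - x \<bullet> i)))) = 0"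
proof -
  obtain i where i: "i \<in> Basis" "\<not> (a \<bullet> i < x \<bullet> i \<and> x \<bullet> i < b \<bullet> i)" using assms(2) by (auto simp: mem_box)
  moreover have "a \<bullet> i < b \<bullet> i" using assms i by (simp add: box_ne_empty)
  ultimately have "(x \<bullet> i - a \<bullet> i) * (b \<bullet> i - x \<bullet> i) \<le> 0" by (auto simp: mult_le_0_iff)
  then have "flat (n * ((x \<bullet> i - a \<bullet> i) * (b \<bullet> i - x \<bullet> i))) = 0"
    using assms(3) by (simp add: flat_eq_0_iff mult_nonneg_nonpos)
  then show ?thesis using i(1) by (intro prod_zero) auto
qed

text \<open>Lets smooth test functions be replaced by indicators of boxes under the
  integral.\<close>

lemma box_bump_tendsto:
  assumes "box a b \<noteq> {}"
  shows "(\<lambda>n. \<Prod>i\<in>Basis. flat (real n * ((x \<bullet> i - a \<bullet> i) * (b \<bullet> i - x \<bullet> i)))) \<longlonglongrightarrow> indicat_real (box a b) x"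
proof (cases "x \<in> box a b")
  case True
  then have "(\<lambda>n. \<Prod>i\<in>Basis. flat (real n * ((x \<bullet> i - a \<bullet> i) * (b \<bullet> i - x \<bullet> i)))) \<longlonglongrightarrow> (\<Prod>i\<in>(Basis::'a set). 1)"
    by (intro tendsto_prod flat_mult_tendsto) (auto simp: mem_box)
  with True show ?thesis by simp
next
  case False
  then have "(\<Prod>i\<in>Basis. flat (real n * ((x \<bullet> i - a \<bullet> i) * (b \<bullet> i - x \<bullet> i)))) = 0" for n
    using box_bump_outside[OF assms] by simp
  moreover have "indicat_real (box a b) x = 0" using False by simp
  ultimately show ?thesis by (simp only: tendsto_const)
qed

text \<open>Boxes form an intersection-stable generator of the Borel sets, so the vanishing of the
  integrals extends to Borel sets by induction over disjoint unions and complements, then to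
  Lebesgue sets by discarding null sets. Applied to the sets where \<open>f\<close> is positive and
  where it is negative, it gives the claim.\<close>

lemma AE_zero_if_box_integrals_zero:
  fixes f :: "'a::euclidean_space \<Rightarrow> real"
  assumes f: "integrable lebesgue f" and box: "\<And>a b. (\<integral>x. indicator (box a b) x * f x \<partial>lebesgue) = 0"
  shows "AE x in lebesgue. f x = 0"
proof -
  have ib: "integrable lebesgue (\<lambda>x. indicator A x * f x)" if "A \<in> sets lebesgue" for A
    using integrable_mult_indicator[OF that f] by simp
  \<comment> \<open>The case of the whole space, as a limit of growing boxes; the induction needs it
    for complements.\<close>
  have total: "(\<integral>x. f x \<partial>lebesgue) = 0"
  proof -
    have "(\<lambda>n. \<integral>x. indicator (box (- (real n *\<^sub>R One)) (real n *\<^sub>R One)) x * f x \<partial>lebesgue) \<longlonglongrightarrow> (\<integral>x. f x \<partial>lebesgue)"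
    proof (rule integral_dominated_convergence[where w = "\<lambda>x. norm (f x)"])
      show "AE x in lebesgue. (\<lambda>n. indicator (box (- (real n *\<^sub>R One)) (real n *\<^sub>R One)) x * f x) \<longlonglongrightarrow> f x"
      proof (intro AE_I2)
        fix x :: 'a
        obtain m where m: "x \<in> box (- (real m *\<^sub>R One)) (real m *\<^sub>R One)"
          using UN_box_eq_UNIV by blast
        have "x \<in> box (- (real n *\<^sub>R One)) (real n *\<^sub>R One)" if "n \<ge> m" for n
        proof -
          have "real m \<le> real n" using that by simp
          then show ?thesis using m by (fastforce simp: mem_box)
        qed
        then show "(\<lambda>n. indicator (box (- (real n *\<^sub>R One)) (real n *\<^sub>R One)) x * f x) \<longlonglongrightarrow> f x"
          by (intro tendsto_eventually) (auto simp: eventually_at_top_linorder intro!: exI[of _ m])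
      qed
    qed (use f ib in \<open>auto simp: indicator_def intro!: borel_measurable_integrable\<close>)
    then show ?thesis by (simp add: box LIMSEQ_const_iff)
  qed
  have borel: "(\<integral>x. indicator A x * f x \<partial>lebesgue) = 0" if "A \<in> sets borel" for A :: "'a set"
  proof -
    have sets: "B \<in> sets lebesgue" if "B \<in> sigma_sets UNIV (range (\<lambda>(a::'a, b). box a b))" for B
      using that unfolding borel_eq_box[symmetric]
      by (metis borel_eq_box sets_completionI_sets sets_lborel sets_measure_of subset_UNIV Pow_UNIV)
    have "Int_stable (range (\<lambda>(a::'a, b). box a b))"
      by (auto simp: Int_stable_def box_Int_box)
    moreover have "range (\<lambda>(a::'a, b). box a b) \<subseteq> Pow UNIV" by simp
    moreover have "A \<in> sigma_sets UNIV (range (\<lambda>(a::'a, b). box a b))"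
      using that by (simp add: borel_eq_box)
    ultimately show ?thesis
    proof (induction rule: sigma_sets_induct_disjoint)
      case (basic A)
      then show ?case using box by auto
    next
      case empty
      then show ?case by simp
    next
      case (compl A)
      have "(\<integral>x. indicator (UNIV - A) x * f x \<partial>lebesgue) = (\<integral>x. f x - indicator A x * f x \<partial>lebesgue)"
        by (intro Bochner_Integration.integral_cong) (auto simp: indicator_def)
      also have "\<dots> = 0" using f ib[OF sets[OF compl(1)]] compl total by simp
      finally show ?case .
    next
      case (union A)
      have s: "A i \<in> sets lebesgue" for i using union sets by auto
      have "(LINT x:(\<Union>i. A i)|lebesgue. f x) = (\<Sum>i. LINT x:A i|lebesgue. f x)"
        using s union(1) ib[OF sets.countable_UN[of A UNIV lebesgue]]
        by (intro lebesgue_integral_countable_add) (auto simp: set_integrable_def disjoint_family_on_def)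
      then show ?case
        using union(3) by (simp add: set_lebesgue_integral_def)
    qed
  qed
  have leb: "(\<integral>x. indicator A x * f x \<partial>lebesgue) = 0" if A: "A \<in> sets lebesgue" for A :: "'a set"
  proof -
    obtain B N N' where "A = B \<union> N" "N \<subseteq> N'" "N' \<in> null_sets lborel" "B \<in> sets lborel"
      using sets_completionE[OF A] by metis
    moreover from this have "N \<in> null_sets lebesgue"
      using completion.complete2[OF _ null_sets_completionI] by blast
    ultimately have BN: "A = B \<union> N" "B \<in> sets borel" "N \<in> null_sets lebesgue" by simp_all
    have "(\<integral>x. indicator A x * f x \<partial>lebesgue) = (\<integral>x. indicator B x * f x \<partial>lebesgue)"
    proof (rule integral_cong_AE)
      show "AE x in lebesgue. indicat_real A x * f x = indicat_real B x * f x"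
        using AE_not_in[OF BN(3)] by eventually_elim (auto simp: BN(1) indicator_def)
    qed (use ib[OF A] ib[of B] BN(2) in \<open>auto intro: borel_measurable_integrable\<close>)
    then show ?thesis using borel[OF BN(2)] by simp
  qed
  have m: "f \<in> borel_measurable lebesgue" using f by simp
  define P where "P = {x. f x > 0}" define Q where "Q = {x. f x < 0}"
  have PQ: "P \<in> sets lebesgue" "Q \<in> sets lebesgue"
    using borel_measurable_less[OF _ m, of "\<lambda>_. 0"] borel_measurable_less[OF m, of "\<lambda>_. 0"]
    by (auto simp: P_def Q_def)
  have "AE x in lebesgue. indicator P x * f x = 0"
    using leb[OF PQ(1)] ib[OF PQ(1)]
    by (subst (asm) integral_nonneg_eq_0_iff_AE) (auto simp: P_def indicator_def)
  moreover have "AE x in lebesgue. - (indicator Q x * f x) = 0"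
    using leb[OF PQ(2)] ib[OF PQ(2)]
    by (subst integral_nonneg_eq_0_iff_AE[symmetric]) (auto simp: Q_def indicator_def)
  ultimately show ?thesis
    by eventually_elim (auto simp: P_def Q_def indicator_def split: if_splits)
qed

text \<open>Measurability is assumed of one side only and passes to the other by completeness of
  Lebesgue measure. This suits \<open>weak_gradient\<close>, an arbitrary choice whose definition
  mentions integrability on compact subsets only.\<close>

lemma integral_lebesgue_on_cong_AE:
  fixes f g :: "'a::euclidean_space \<Rightarrow> real"
  assumes D: "D \<in> sets lebesgue" and g: "g \<in> borel_measurable (lebesgue_on D)"
    and eq: "AE x in lebesgue_on D. f x = g x"
  shows "integral\<^sup>L (lebesgue_on D) f = integral\<^sup>L (lebesgue_on D) g"
    "integrable (lebesgue_on D) f \<longleftrightarrow> integrable (lebesgue_on D) g"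
proof -
  let ?f = "\<lambda>x. if x \<in> D then f x else 0" and ?g = "\<lambda>x. if x \<in> D then g x else 0"
  have g': "?g \<in> borel_measurable lebesgue" using g D by (simp add: borel_measurable_if)
  have "AE x in lebesgue. x \<in> D \<longrightarrow> f x = g x" using eq D by (simp add: AE_restrict_space_iff)
  then have e: "AE x in lebesgue. ?g x = ?f x" by eventually_elim auto
  have f': "?f \<in> borel_measurable lebesgue" by (rule borel_measurable_AE[OF g' e])
  have "integral\<^sup>L lebesgue ?g = integral\<^sup>L lebesgue ?f" by (rule integral_cong_AE[OF g' f' e])
  moreover have "integrable lebesgue ?g = integrable lebesgue ?f" by (rule integrable_cong_AE[OF g' f' e])
  ultimately show "integral\<^sup>L (lebesgue_on D) f = integral\<^sup>L (lebesgue_on D) g"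
    "integrable (lebesgue_on D) f \<longleftrightarrow> integrable (lebesgue_on D) g"
    using D by (simp_all add: Lebesgue_Measure.integral_restrict_UNIV Lebesgue_Measure.integrable_restrict_UNIV)
qed

text \<open>On a closed box inside \<open>D\<close> the field is integrable, and bumps tending to
  indicators of smaller boxes show that its integrals over these vanish. Countably many closed boxes
  cover \<open>D\<close>, so the exceptional null sets can be collected.\<close>

lemma weak_gradient_zero:
  fixes w :: "'a::euclidean_space \<Rightarrow> 'a"
  assumes D: "open D" and w: "locally_integrable D w"
    and z: "\<And>\<phi>. \<phi> \<in> Cc_infinity D \<Longrightarrow> (\<integral>x. \<phi> x *\<^sub>R w x \<partial>lebesgue_on D) = 0"
  shows "AE x in lebesgue_on D. w x = 0"
proof -
  have Ds: "D \<in> sets lebesgue" using D by auto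
  have onbox: "AE x in lebesgue. x \<in> cbox a b \<longrightarrow> w x \<bullet> i = 0" if ab: "cbox a b \<subseteq> D" and i: "i \<in> Basis" for a b i
  proof -
    define f where "f x = indicat_real (cbox a b) x * (w x \<bullet> i)" for x
    have "integrable (lebesgue_on (cbox a b)) w"
      using w ab compact_cbox[of a b] by (simp add: locally_integrable_def)
    then have wi: "integrable lebesgue (\<lambda>x. indicat_real (cbox a b) x *\<^sub>R w x)"
      by (subst (asm) integrable_restrict_space) auto
    then have "integrable lebesgue (\<lambda>x. (indicat_real (cbox a b) x *\<^sub>R w x) \<bullet> i)"
      by (rule integrable_inner_left)
    then have f: "integrable lebesgue f" by (simp add: f_def[abs_def])
    have "(\<integral>x. indicator (box c d) x * f x \<partial>lebesgue) = 0" for c d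
    proof -
      \<comment> \<open>Since \<open>f\<close> vanishes off \<open>cbox a b\<close>, an arbitrary
        box may be replaced by its part inside \<open>box a b\<close>, up to the null boundary; only
        for such boxes are the bumps admissible test functions on \<open>D\<close>.\<close>
      obtain e e' where e: "box c d \<inter> box a b = box e e'" using that[OF box_Int_box] by blast
      have "negligible (cbox a b - box a b)" by (rule negligible_frontier_interval)
      then have nb: "AE x in lebesgue. x \<notin> cbox a b - box a b"
        unfolding negligible_iff_null_sets by (rule AE_not_in)
      have "(\<integral>x. indicator (box c d) x * f x \<partial>lebesgue) = (\<integral>x. indicator (box e e') x * f x \<partial>lebesgue)"
      proof (rule integral_cong_AE)
        show "AE x in lebesgue. indicator (box c d) x * f x = indicator (box e e') x * f x"
          using nb by eventually_elim (auto simp: f_def indicator_def e[symmetric])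
        show "(\<lambda>x. indicator (box c d) x * f x) \<in> borel_measurable lebesgue"
          "(\<lambda>x. indicator (box e e') x * f x) \<in> borel_measurable lebesgue"
          using borel_measurable_integrable[OF f]
          by (intro borel_measurable_times borel_measurable_indicator; simp)+
      qed
      also have "\<dots> = 0"
      proof (cases "box e e' = {}")
        case False
        have "box e e' \<subseteq> cbox a b" using e box_subset_cbox by blast
        then have sub: "cbox e e' \<subseteq> cbox a b"
          using False by (metis closed_cbox closure_box closure_minimal)
        define \<phi> where "\<phi> n x = (\<Prod>i\<in>Basis. flat (real n * ((x \<bullet> i - e \<bullet> i) * (e' \<bullet> i - x \<bullet> i))))" for n x
        have out: "\<phi> n x = 0" if "x \<notin> box e e'" for n x
          using box_bump_outside[OF False that] by (simp add: \<phi>_def)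
        have ph: "\<phi> n \<in> Cc_infinity D" for n
        proof (rule Cc_infinityI[of _ "cbox e e'"])
          show "Ck k (\<phi> n)" for k unfolding \<phi>_def[abs_def] by (rule Ck_box_bump)
          show "\<phi> n x = 0" if "x \<notin> cbox e e'" for x using that out[of x n] subsetD[OF box_subset_cbox, of x e e'] by blast
          show "cbox e e' \<subseteq> D" using sub ab by (rule order_trans)
        qed (rule compact_cbox)
        have ab': "x \<in> cbox a b" if "x \<in> box e e'" for x using that \<open>box e e' \<subseteq> cbox a b\<close> by blast
        have ph01: "0 \<le> \<phi> n x" "\<phi> n x \<le> 1" for n x
          unfolding \<phi>_def by (auto intro!: prod_nonneg prod_le_1 simp: flat_bounds)
        have mph: "\<phi> n \<in> borel_measurable lebesgue" for n
          using integrable_Cc_infinity(1)[OF ph] by simp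
        have int0: "(\<integral>x. \<phi> n x * f x \<partial>lebesgue) = 0" for n
        proof -
          have eq: "(\<lambda>x. \<phi> n x *\<^sub>R w x) = (\<lambda>x. \<phi> n x *\<^sub>R (indicat_real (cbox a b) x *\<^sub>R w x))"
          proof
            show "\<phi> n x *\<^sub>R w x = \<phi> n x *\<^sub>R (indicat_real (cbox a b) x *\<^sub>R w x)" for x
              using out[of x n] ab'[of x] by (cases "x \<in> box e e'") simp_all
          qed
          have ii: "integrable lebesgue (\<lambda>x. \<phi> n x *\<^sub>R w x)"
            unfolding eq
          proof (rule Bochner_Integration.integrable_bound[OF wi borel_measurable_scaleR[OF mph borel_measurable_integrable[OF wi]]])
            show "AE x in lebesgue. norm (\<phi> n x *\<^sub>R indicat_real (cbox a b) x *\<^sub>R w x) \<le> norm (indicat_real (cbox a b) x *\<^sub>R w x)"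
              unfolding norm_scaleR[of "\<phi> n _"] using ph01[of n]
              by (intro AE_I2 mult_left_le_one_le norm_ge_zero) simp_all
          qed
          have "0 = (\<integral>x. \<phi> n x *\<^sub>R w x \<partial>lebesgue_on D)" using z[OF ph] by simp
          also have "\<dots> = (\<integral>x. \<phi> n x *\<^sub>R w x \<partial>lebesgue)"
          proof (rule integral_lebesgue_on_support[OF Ds])
            show "\<phi> n x *\<^sub>R w x = 0" if "x \<notin> D" for x
              using out[of x n] ab'[of x] ab that by auto
          qed
          finally have "(\<integral>x. (\<phi> n x *\<^sub>R w x) \<bullet> i \<partial>lebesgue) = 0 \<bullet> i"
            using integral_inner_left[of i lebesgue "\<lambda>x. \<phi> n x *\<^sub>R w x"] ii by (simp only:)
          moreover have "(\<lambda>x. (\<phi> n x *\<^sub>R w x) \<bullet> i) = (\<lambda>x. \<phi> n x * f x)"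
          proof
            show "(\<phi> n x *\<^sub>R w x) \<bullet> i = \<phi> n x * f x" for x
              using out[of x n] ab'[of x] by (cases "x \<in> box e e'") (simp_all add: f_def)
          qed
          ultimately show ?thesis by simp
        qed
        have "(\<lambda>n. \<integral>x. \<phi> n x * f x \<partial>lebesgue) \<longlonglongrightarrow> (\<integral>x. indicator (box e e') x * f x \<partial>lebesgue)"
        proof (rule integral_dominated_convergence[where w = "\<lambda>x. norm (f x)"])
          show "AE x in lebesgue. (\<lambda>n. \<phi> n x * f x) \<longlonglongrightarrow> indicator (box e e') x * f x"
            unfolding \<phi>_def by (intro AE_I2 tendsto_mult box_bump_tendsto False tendsto_const)
          show "AE x in lebesgue. norm (\<phi> n x * f x) \<le> norm (f x)" for n
            using ph01 by (intro AE_I2) (simp add: abs_mult mult_left_le_one_le)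
          show "(\<lambda>x. \<phi> n x * f x) \<in> borel_measurable lebesgue"
            "(\<lambda>x. indicator (box e e') x * f x) \<in> borel_measurable lebesgue" for n
            using borel_measurable_integrable[OF f] mph
            by (intro borel_measurable_times borel_measurable_indicator; simp)+
        qed (use f in simp)
        then show ?thesis unfolding int0 by (simp add: LIMSEQ_const_iff)
      next
        case True
        show ?thesis unfolding True by simp
      qed
      finally show ?thesis .
    qed
    from AE_zero_if_box_integrals_zero[OF f this] show ?thesis
      by eventually_elim (auto simp: f_def)
  qed
  obtain \<D> where \<D>: "countable \<D>" "\<D> \<subseteq> Pow D" "\<And>X. X \<in> \<D> \<Longrightarrow> \<exists>a b. X = cbox a b" "\<Union>\<D> = D"
    using open_countable_Union_open_cbox[OF D] by metis
  have "AE x in lebesgue. \<forall>X\<in>\<D>. \<forall>i\<in>Basis. x \<in> X \<longrightarrow> w x \<bullet> i = 0"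
    unfolding AE_ball_countable[OF \<D>(1)] AE_finite_all[OF finite_Basis]
  proof (intro ballI)
    fix X i assume X: "X \<in> \<D>" "i \<in> (Basis :: 'a set)"
    obtain a b where "X = cbox a b" using \<D>(3)[OF X(1)] by blast
    with onbox[of a b i] X \<D>(2) show "AE x in lebesgue. x \<in> X \<longrightarrow> w x \<bullet> i = 0" by blast
  qed
  then have "AE x in lebesgue. x \<in> D \<longrightarrow> w x = 0"
  proof eventually_elim
    case (elim x)
    show ?case
    proof
      assume "x \<in> D"
      then obtain X where X: "X \<in> \<D>" "x \<in> X" using \<D>(4) by blast
      show "w x = 0"
      proof (rule euclidean_eqI)
        fix b :: 'a assume "b \<in> Basis"
        with elim X have "w x \<bullet> b = 0" by blast
        then show "w x \<bullet> b = 0 \<bullet> b" by simp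
      qed
    qed
  qed
  then show ?thesis using Ds by (simp add: AE_restrict_space_iff)
qed

lemma weak_gradient_unique:
  assumes D: "open D" and u: "has_weak_gradient D u g" and v: "has_weak_gradient D u h"
  shows "AE x in lebesgue_on D. g x = h x"
proof -
  note d = has_weak_gradient_diff[OF D u v]
  have "AE x in lebesgue_on D. g x - h x = 0"
  proof (rule weak_gradient_zero[OF D])
    show "locally_integrable D (\<lambda>x. g x - h x)" using d by (simp add: has_weak_gradient_def)
    fix \<phi> assume "\<phi> \<in> Cc_infinity D"
    with d show "(\<integral>x. \<phi> x *\<^sub>R (g x - h x) \<partial>lebesgue_on D) = 0"
      by (simp add: has_weak_gradient_def)
  qed
  then show ?thesis by simp
qed

lemma weak_gradient_AE_eq:
  assumes D: "open D" and u: "has_weak_gradient D u g"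
  shows "AE x in lebesgue_on D. weak_gradient D u x = g x"
  using weak_gradient_unique[OF D _ u] someI[of "has_weak_gradient D u", OF u]
  by (simp add: weak_gradient_def)

section \<open>Smooth functions in the Sobolev spaces\<close>

lemma Lp_Cc_infinity:
  assumes f: "f \<in> Cc_infinity D" and D: "open D" and p: "p > 0"
  shows "f \<in> Lp p D" "gradient f \<in> Lp p D"
    "integrable lebesgue (\<lambda>x. \<bar>f x\<bar> powr p)" "integrable lebesgue (\<lambda>x. norm (gradient f x) powr p)"
proof -
  obtain C where C: "compact C" "C \<subseteq> D" "\<And>x. x \<notin> C \<Longrightarrow> f x = 0" "\<And>x. x \<notin> C \<Longrightarrow> gradient f x = 0"
    using Cc_infinity_support[OF f] by metis
  note c = Cc_infinity_gradient[OF f]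
  have Ds: "D \<in> sets lebesgue" using D by auto
  show 1: "integrable lebesgue (\<lambda>x. \<bar>f x\<bar> powr p)"
    using c C p by (intro integrable_continuous_compact_support[OF _ C(1)] continuous_on_powr' continuous_intros) auto
  show 2: "integrable lebesgue (\<lambda>x. norm (gradient f x) powr p)"
    using c C p by (intro integrable_continuous_compact_support[OF _ C(1)] continuous_on_powr' continuous_intros) auto
  note z = Cc_infinity_zero_outside[OF f]
  have 3: "integrable (lebesgue_on D) (\<lambda>x. norm (f x) powr p)"
    using 1 integral_lebesgue_on_support(2)[OF Ds, of "\<lambda>x. norm (f x) powr p"] z p by simp
  have 4: "integrable (lebesgue_on D) (\<lambda>x. norm (gradient f x) powr p)"
    using 2 integral_lebesgue_on_support(2)[OF Ds, of "\<lambda>x. norm (gradient f x) powr p"] z p by simp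
  have m: "f \<in> borel_measurable (lebesgue_on D)" "gradient f \<in> borel_measurable (lebesgue_on D)"
    using integrable_Cc_infinity[OF f] by (auto intro!: measurable_restrict_space1)
  show "f \<in> Lp p D" "gradient f \<in> Lp p D" using 3 4 m by (auto simp: Lp_def)
qed

text \<open>The constant sequence approximates \<open>f\<close>. Still, the weak gradient of the
  zero function is a choice, and its vanishing almost everywhere rests on uniqueness.\<close>

lemma Cc_infinity_subset_W1_0:
  assumes f: "f \<in> Cc_infinity D" and D: "open D" and p: "p > 0"
  shows "f \<in> W1_0 p D"
proof -
  have W1: "f \<in> W1 p D"
    using Lp_Cc_infinity[OF f D p] has_weak_gradient_Cc_infinity[OF D f] by (auto simp: W1_def)
  have "has_weak_gradient D (\<lambda>x. f x - f x) (\<lambda>x. gradient f x - gradient f x)"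
    using has_weak_gradient_diff[OF D] has_weak_gradient_Cc_infinity[OF D f] by blast
  then have "AE x in lebesgue_on D. weak_gradient D (\<lambda>x. f x - f x) x = 0"
    using weak_gradient_AE_eq[OF D] by simp
  then have "AE x in lebesgue_on D. norm (weak_gradient D (\<lambda>x. f x - f x) x) powr p = 0"
    by eventually_elim simp
  then have "(\<integral>x. norm (weak_gradient D (\<lambda>x. f x - f x) x) powr p \<partial>lebesgue_on D) = 0"
    by (rule integral_eq_zero_AE)
  then have "W1_norm p D (\<lambda>x. f x - f x) = 0"
    by (simp add: W1_norm_def)
  then show ?thesis using W1 f unfolding W1_0_def
    by (auto intro!: exI[of _ "\<lambda>_. f"])
qed

text \<open>Trades the chosen weak gradients for one fixed \<open>L^p\<close> representative
  \<open>g\<close> and the classical gradients of the test functions, and splits convergence in the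
  Sobolev norm into two limits of integrals.\<close>

lemma W1_0_approx:
  assumes u: "u \<in> W1_0 p D" and D: "open D" and p: "p > 0"
  obtains g \<phi> where "has_weak_gradient D u g" "u \<in> Lp p D" "g \<in> Lp p D" "\<And>n. \<phi> n \<in> Cc_infinity D"
    "(\<lambda>n. \<integral>x. \<bar>u x - \<phi> n x\<bar> powr p \<partial>lebesgue_on D) \<longlonglongrightarrow> 0"
    "(\<lambda>n. \<integral>x. norm (g x - gradient (\<phi> n) x) powr p \<partial>lebesgue_on D) \<longlonglongrightarrow> 0"
proof -
  from u obtain g \<phi> where g: "has_weak_gradient D u g" "u \<in> Lp p D" "g \<in> Lp p D" and ph: "\<And>n. \<phi> n \<in> Cc_infinity D"
    and lim: "(\<lambda>n. W1_norm p D (\<lambda>x. u x - \<phi> n x)) \<longlonglongrightarrow> 0"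
    by (auto simp: W1_0_def W1_def)
  define A where "A n = (\<integral>x. \<bar>u x - \<phi> n x\<bar> powr p \<partial>lebesgue_on D)" for n
  define B where "B n = (\<integral>x. norm (g x - gradient (\<phi> n) x) powr p \<partial>lebesgue_on D)" for n
  have Ds: "D \<in> sets lebesgue" using D by auto
  have mg: "(\<lambda>x. norm (g x - gradient (\<phi> n) x) powr p) \<in> borel_measurable (lebesgue_on D)" for n
    using g(3) Lp_Cc_infinity(2)[OF ph D p, of n] by (auto simp: Lp_def)
  have eq: "W1_norm p D (\<lambda>x. u x - \<phi> n x) = (A n + B n) powr (1 / p)" for n
  proof -
    have "has_weak_gradient D (\<lambda>x. u x - \<phi> n x) (\<lambda>x. g x - gradient (\<phi> n) x)"
      by (intro has_weak_gradient_diff[OF D] g has_weak_gradient_Cc_infinity[OF D ph])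
    then have "AE x in lebesgue_on D. weak_gradient D (\<lambda>x. u x - \<phi> n x) x = g x - gradient (\<phi> n) x"
      by (rule weak_gradient_AE_eq[OF D])
    then have "AE x in lebesgue_on D. norm (weak_gradient D (\<lambda>x. u x - \<phi> n x) x) powr p = norm (g x - gradient (\<phi> n) x) powr p"
      by eventually_elim simp
    then have "(\<integral>x. norm (weak_gradient D (\<lambda>x. u x - \<phi> n x) x) powr p \<partial>lebesgue_on D) = B n"
      unfolding B_def by (rule integral_lebesgue_on_cong_AE[OF Ds mg])
    then show ?thesis by (simp add: W1_norm_def A_def)
  qed
  have pos: "A n \<ge> 0" "B n \<ge> 0" for n by (auto simp: A_def B_def)
  have "(\<lambda>n. ((A n + B n) powr (1 / p)) powr p) \<longlonglongrightarrow> 0 powr p"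
    using lim p unfolding eq by (intro tendsto_powr2 tendsto_const) auto
  then have AB: "(\<lambda>n. A n + B n) \<longlonglongrightarrow> 0"
    using p pos by (simp add: powr_powr)
  have "A \<longlonglongrightarrow> 0" by (rule tendsto_sandwich[OF _ _ tendsto_const AB]) (use pos in auto)
  moreover have "B \<longlonglongrightarrow> 0" by (rule tendsto_sandwich[OF _ _ tendsto_const AB]) (use pos in auto)
  ultimately show ?thesis using that[OF g ph] by (simp add: A_def[abs_def] B_def[abs_def])
qed

section \<open>Level sets and the gradient\<close>

text \<open>The type argument only fixes the dimension.\<close>

abbreviation ball_vol :: "'a::euclidean_space itself \<Rightarrow> real \<Rightarrow> real" where
  "ball_vol T r \<equiv> unit_ball_vol (real DIM('a)) * r ^ DIM('a)"

lemma measure_ball_0: "r \<ge> 0 \<Longrightarrow> measure lebesgue (ball (c::'a::euclidean_space) r) = ball_vol TYPE('a) r"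
  using content_ball[of r c] by simp

lemma ball_vol_le_iff:
  assumes "0 \<le> r" "0 \<le> s"
  shows "ball_vol TYPE('a::euclidean_space) r \<le> ball_vol TYPE('a) s \<longleftrightarrow> r \<le> s"
proof -
  have "unit_ball_vol (real DIM('a)) > 0" by simp
  then show ?thesis
    using assms power_mono_iff[of r s "DIM('a)"] by (simp add: mult_le_cancel_left_pos)
qed

text \<open>The coefficient of \<open>t\<close> is the perimeter of the ball of radius
  \<open>x\<close>, which is at most that of the ball of radius \<open>r\<close>. The growth of the
  volume is Bernoulli's inequality for \<open>1 + t / r\<close>.\<close>

lemma ball_vol_add_ge:
  assumes "0 \<le> x" "x \<le> r" "0 \<le> t"
  shows "ball_vol TYPE('a::euclidean_space) r + real DIM('a) * unit_ball_vol (real DIM('a)) * x ^ (DIM('a) - 1) * t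
    \<le> ball_vol TYPE('a) (r + t)"
proof -
  let ?n = "DIM('a)"
  have "r ^ ?n + real ?n * r ^ (?n - 1) * t \<le> (r + t) ^ ?n"
  proof (cases "r = 0 \<or> t = 0")
    case True
    \<comment> \<open>In dimension 1 the exponent \<open>?n - 1\<close> is 0 and
      \<open>0 ^ 0\<close> is 1, so this dimension is treated on its own.\<close>
    show ?thesis
    proof (cases "?n = 1")
      case False
      then have "?n \<ge> 2" using DIM_positive[where 'a='a] by linarith
      then show ?thesis using assms True by (auto simp: power_0_left)
    qed (use assms True in auto)
  next
    case False
    then have "r > 0" using assms by auto
    have "1 + real ?n * (t / r) \<le> (1 + t / r) ^ ?n"
      using assms \<open>r > 0\<close> by (intro Bernoulli_inequality) (simp add: order_trans[of _ 0])
    then have "r ^ ?n * (1 + real ?n * (t / r)) \<le> r ^ ?n * (1 + t / r) ^ ?n"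
      using \<open>r > 0\<close> by (intro mult_left_mono) auto
    also have "r ^ ?n * (1 + t / r) ^ ?n = (r + t) ^ ?n"
      using \<open>r > 0\<close> by (simp add: power_mult_distrib[symmetric] distrib_left)
    also have "r ^ ?n * (1 + real ?n * (t / r)) = r ^ ?n + real ?n * r ^ (?n - 1) * t"
      using \<open>r > 0\<close> DIM_positive[where 'a='a] power_minus_mult[of ?n r] by (simp add: distrib_left field_simps)
    finally show ?thesis .
  qed
  moreover have "real ?n * x ^ (?n - 1) * t \<le> real ?n * r ^ (?n - 1) * t"
    using assms by (intro mult_right_mono mult_left_mono power_mono) auto
  ultimately have "r ^ ?n + real ?n * x ^ (?n - 1) * t \<le> (r + t) ^ ?n" by linarith
  then have "unit_ball_vol ?n * (r ^ ?n + real ?n * x ^ (?n - 1) * t) \<le> unit_ball_vol ?n * (r + t) ^ ?n"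
    by (intro mult_left_mono) auto
  then show ?thesis by (simp add: algebra_simps)
qed

lemma ball_vol_surj:
  assumes "0 \<le> m"
  obtains r where "r \<ge> 0" "ball_vol TYPE('a::euclidean_space) r = m"
proof
  let ?n = "DIM('a)"
  show "root ?n (m / unit_ball_vol ?n) \<ge> 0" using assms by simp
  show "unit_ball_vol ?n * root ?n (m / unit_ball_vol ?n) ^ ?n = m"
  proof -
    have "unit_ball_vol (real ?n) > 0" by simp
    then have "unit_ball_vol (real ?n) \<noteq> 0" by linarith
    then show ?thesis using assms by (simp add: real_root_pow_pos2)
  qed
qed

text \<open>The form in which Brunn--Minkowski is applied. The first part compares radii and will
  bound the slopes of the profile. The second is an isoperimetric inequality without a notion of
  perimeter for \<open>U\<close>; it follows by letting the ball with the volume of \<open>U\<close>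
  grow.\<close>

lemma brunn_minkowski_growth:
  fixes U :: "'a::euclidean_space set"
  assumes U: "open U" "bounded U" "U \<noteq> {}" and t: "t > 0" "x \<ge> 0"
    and le: "ball_vol TYPE('a) x \<le> measure lebesgue U"
  shows "ball_vol TYPE('a) (x + t) \<le> measure lebesgue (msum U (ball 0 t))"
    "measure lebesgue U + real DIM('a) * unit_ball_vol (real DIM('a)) * x ^ (DIM('a) - 1) * t
      \<le> measure lebesgue (msum U (ball 0 t))"
proof -
  have *: "ball_vol TYPE('a) (r + t) \<le> measure lebesgue (msum U (ball 0 t))"
    if "r \<ge> 0" "ball_vol TYPE('a) r \<le> measure lebesgue U" for r
    using brunn_minkowski_ball[OF U t(1) that(1)] that t measure_ball_0[of r "0::'a"] measure_ball_0[of "r + t" "0::'a"]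
    by linarith
  show "ball_vol TYPE('a) (x + t) \<le> measure lebesgue (msum U (ball 0 t))"
    using *[of x] t le by simp
  obtain r where r: "r \<ge> 0" "ball_vol TYPE('a) r = measure lebesgue U"
    using ball_vol_surj[of "measure lebesgue U"] measure_nonneg by blast
  then have "x \<le> r" using le ball_vol_le_iff[OF t(2) r(1), where 'a='a] by simp
  from ball_vol_add_ge[OF t(2) this less_imp_le[OF t(1)], where 'a='a] *[of r] r
  show "measure lebesgue U + real DIM('a) * unit_ball_vol (real DIM('a)) * x ^ (DIM('a) - 1) * t
      \<le> measure lebesgue (msum U (ball 0 t))" by linarith
qed

section \<open>Sup-convolution and the integral of the gradient over a layer\<close>

lemma nn_integral_layer_cake:
  fixes g :: "'a::euclidean_space \<Rightarrow> real"
  assumes g: "g \<in> borel_measurable borel" and h: "\<And>x. 0 \<le> g x" "\<And>x. g x \<le> h"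
  shows "(\<integral>\<^sup>+x. g x \<partial>lborel) = (\<integral>\<^sup>+s. indicator {0..<h} s * emeasure lborel {x. s < g x} \<partial>lborel)"
proof -
  have m: "{x. s < g x} \<in> sets lborel" for s using g by measurable
  have "(\<integral>\<^sup>+x. g x \<partial>lborel) = (\<integral>\<^sup>+x. (\<integral>\<^sup>+s. indicator {0..<g x} s \<partial>lborel) \<partial>lborel)"
    using h(1) by (intro nn_integral_cong) simp
  also have "\<dots> = (\<integral>\<^sup>+x. (\<integral>\<^sup>+s. indicator {0..<h} s * indicator {x. s < g x} x \<partial>lborel) \<partial>lborel)"
    using h by (intro nn_integral_cong) (auto simp: indicator_def intro: less_le_trans)
  also have "\<dots> = (\<integral>\<^sup>+s. (\<integral>\<^sup>+x. indicator {0..<h} s * indicator {x. s < g x} x \<partial>lborel) \<partial>lborel)"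
  proof (rule lborel_pair.Fubini'[symmetric])
    have "(\<lambda>(x, s). indicator {0..<h} s * indicator {x. s < g x} x :: ennreal) =
        (\<lambda>z. if 0 \<le> snd z \<and> snd z < h \<and> snd z < g (fst z) then 1 else 0)"
      by (auto simp: indicator_def)
    also have "\<dots> \<in> borel_measurable (lborel \<Otimes>\<^sub>M lborel)"
      using g by measurable
    finally show "(\<lambda>(x, s). indicator {0..<h} s * indicator {x. s < g x} x :: ennreal) \<in> borel_measurable (lborel \<Otimes>\<^sub>M lborel)" .
  qed
  also have "\<dots> = (\<integral>\<^sup>+s. indicator {0..<h} s * emeasure lborel {x. s < g x} \<partial>lborel)"
    using m by (intro nn_integral_cong) (simp add: nn_integral_cmult)
  finally show ?thesis .
qed

text \<open>Its superlevel sets are the \<open>t\<close>-neighbourhoods of those of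
  \<open>f\<close>, to which Brunn--Minkowski applies, while its growth rate in \<open>t\<close> is
  bounded to first order by the norm of the gradient.\<close>

definition sup_conv :: "real \<Rightarrow> ('a::euclidean_space \<Rightarrow> real) \<Rightarrow> 'a \<Rightarrow> real" where
  "sup_conv t f x = (SUP y\<in>ball x t. f y)"

lemma sup_conv_superlevel:
  assumes "t > 0" "\<And>x. f x \<le> h"
  shows "{x. s < sup_conv t f x} = msum {x. s < f x} (ball 0 t)"
proof -
  have "s < sup_conv t f x \<longleftrightarrow> (\<exists>y\<in>ball x t. s < f y)" for x
    unfolding sup_conv_def using assms by (intro less_cSUP_iff) (auto intro!: bdd_aboveI2)
  moreover have "(\<exists>y\<in>ball x t. s < f y) \<longleftrightarrow> x \<in> msum {x. s < f x} (ball 0 t)" for x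
  proof
    assume "\<exists>y\<in>ball x t. s < f y"
    then obtain y where "dist x y < t" "s < f y" by auto
    then have "y + (x - y) \<in> msum {x. s < f x} (ball 0 t)"
      by (intro msumI) (auto simp: dist_norm norm_minus_commute)
    then show "x \<in> msum {x. s < f x} (ball 0 t)" by simp
  next
    assume "x \<in> msum {x. s < f x} (ball 0 t)"
    then obtain y z where "x = y + z" "s < f y" "norm z < t" by (auto elim!: msumE)
    then show "\<exists>y\<in>ball x t. s < f y" by (intro bexI[of _ y]) (auto simp: dist_norm)
  qed
  ultimately show ?thesis by auto
qed

lemma sup_conv_bounds:
  assumes "t > 0" "\<And>x. f x \<le> h"
  shows "f x \<le> sup_conv t f x" "sup_conv t f x \<le> h"
    "(\<And>y. y \<in> ball x t \<Longrightarrow> f y \<le> c) \<Longrightarrow> sup_conv t f x \<le> c"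
  unfolding sup_conv_def using assms
  by (auto intro!: cSUP_upper bdd_aboveI2 cSUP_least)

lemma sup_conv_measurable:
  assumes "t > 0" "\<And>x. f x \<le> h"
  shows "sup_conv t f \<in> borel_measurable borel"
  unfolding borel_measurable_iff_greater
proof
  fix s
  have "{w. s < sup_conv t f w} \<in> sets borel"
    unfolding sup_conv_superlevel[OF assms] by (intro borel_open open_msum open_ball)
  then show "{w \<in> space borel. s < sup_conv t f w} \<in> sets borel" by simp
qed

text \<open>Brunn--Minkowski is applied to every superlevel set of \<open>f\<close>.\<close>

lemma sup_conv_integral_growth:
  fixes f :: "'a::euclidean_space \<Rightarrow> real"
  assumes f: "continuous_on UNIV f" "\<And>x. 0 \<le> f x" "\<And>x. f x \<le> h"
    and C: "compact C" "\<And>x. x \<notin> C \<Longrightarrow> f x = 0"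
    and E: "E \<noteq> {}" "\<And>x. x \<in> E \<Longrightarrow> f x = h" "E \<in> lmeasurable" "ball_vol TYPE('a) x \<le> measure lebesgue E"
    and t: "t > 0" "x \<ge> 0"
  shows "(\<integral>\<^sup>+y. f y \<partial>lborel) + ennreal (h * (real DIM('a) * unit_ball_vol (real DIM('a)) * x ^ (DIM('a) - 1) * t))
    \<le> (\<integral>\<^sup>+y. sup_conv t f y \<partial>lborel)"
proof -
  let ?k = "real DIM('a) * unit_ball_vol (real DIM('a)) * x ^ (DIM('a) - 1) * t"
  have k0: "?k \<ge> 0" using t by simp
  have h0: "h \<ge> 0" using f order_trans by blast
  have fm: "f \<in> borel_measurable borel" using f(1) by (rule borel_measurable_continuous_onI)
  have sb: "0 \<le> sup_conv t f y" "sup_conv t f y \<le> h" for y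
    using sup_conv_bounds[OF t(1), of f h y] f order_trans by blast+
  \<comment> \<open>Below the level \<open>h\<close> every superlevel set still contains
    \<open>E\<close>, hence is at least as large as the ball of radius \<open>x\<close> and gains at
    least \<open>?k\<close>. Integration over the levels from 0 to \<open>h\<close> produces the
    factor \<open>h\<close>.\<close>
  have key: "emeasure lborel {y. s < f y} + ennreal ?k \<le> emeasure lborel {y. s < sup_conv t f y}"
    if s: "s \<in> {0..<h}" for s
  proof -
    let ?U = "{y. s < f y}"
    have o: "open ?U" using f(1) by (simp add: open_Collect_less continuous_on_const)
    have "?U \<subseteq> C" using C(2) s by force
    then have b: "bounded ?U" using C(1) compact_imp_bounded bounded_subset by blast
    have EU: "E \<subseteq> ?U" using E(2) s by auto
    then have ne: "?U \<noteq> {}" using E(1) by blast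
    have lm: "?U \<in> lmeasurable" "msum ?U (ball 0 t) \<in> lmeasurable"
      using o b by (auto intro!: lmeasurable_open[of "{y. s < f y}"] lmeasurable_msum)
    have "measure lebesgue E \<le> measure lebesgue ?U" using EU E(3) lm by (intro measure_mono_fmeasurable) (auto dest: fmeasurableD)
    then have "measure lebesgue ?U + ?k \<le> measure lebesgue (msum ?U (ball 0 t))"
      using E(4) by (intro brunn_minkowski_growth(2) o b ne t) linarith
    then have "ennreal (measure lebesgue ?U + ?k) \<le> ennreal (measure lebesgue (msum ?U (ball 0 t)))"
      by (rule ennreal_leI)
    then have "emeasure lebesgue ?U + ennreal ?k \<le> emeasure lebesgue (msum ?U (ball 0 t))"
      unfolding ennreal_plus[OF measure_nonneg k0] by (simp only: emeasure_eq_measure2[OF lm(1)] emeasure_eq_measure2[OF lm(2)])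
    then show ?thesis
      using o open_msum[of "ball 0 t" ?U] by (simp add: sup_conv_superlevel[OF t(1) f(3)])
  qed
  have "(\<integral>\<^sup>+y. f y \<partial>lborel) + ennreal (h * ?k)
      = (\<integral>\<^sup>+s. indicator {0..<h} s * emeasure lborel {x. s < f x} \<partial>lborel) + (\<integral>\<^sup>+s. indicator {0..<h} s * ennreal ?k \<partial>lborel)"
    using nn_integral_layer_cake[OF fm f(2,3)] h0 k0 by (simp add: nn_integral_multc ennreal_mult)
  also have "\<dots> = (\<integral>\<^sup>+s. indicator {0..<h} s * emeasure lborel {x. s < f x} + indicator {0..<h} s * ennreal ?k \<partial>lborel)"
  proof (rule nn_integral_add[symmetric])
    have "(\<lambda>s. emeasure lborel {x. s < f x}) \<in> borel_measurable lborel"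
    proof -
      have "{z \<in> space (lborel \<Otimes>\<^sub>M lborel). fst z < f (snd z)} \<in> sets (lborel \<Otimes>\<^sub>M (lborel :: 'a measure))"
        using fm by measurable
      from lborel.measurable_emeasure_Pair[OF this]
      show ?thesis by (simp add: vimage_def space_pair_measure)
    qed
    then show "(\<lambda>s. indicator {0..<h} s * emeasure lborel {x. s < f x}) \<in> borel_measurable lborel"
      by measurable
  qed simp
  also have "\<dots> \<le> (\<integral>\<^sup>+s. indicator {0..<h} s * emeasure lborel {x. s < sup_conv t f x} \<partial>lborel)"
    using key by (intro nn_integral_mono) (auto simp: indicator_def)
  also have "\<dots> = (\<integral>\<^sup>+y. sup_conv t f y \<partial>lborel)"
    using sb by (intro nn_integral_layer_cake[symmetric] sup_conv_measurable[OF t(1) f(3)]) auto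
  finally show ?thesis .
qed

text \<open>Only an upper bound for the growth rate is wanted, hence the positive part. The
  half-open layer takes care of the kinks of the truncation: at level \<open>a\<close> the function
  can still increase at the rate \<open>norm g\<close>, whereas at level \<open>b\<close> it is
  already maximal.\<close>

lemma sup_conv_quotient_tendsto:
  fixes v :: "'a::euclidean_space \<Rightarrow> real"
  assumes v: "GDERIV v y :> g" and lip: "\<And>x y. \<bar>v x - v y\<bar> \<le> M * norm (x - y)" and M: "M > 0"
    and ab: "a < b"
  defines "f \<equiv> \<lambda>x. min (max (\<bar>v x\<bar> - a) 0) (b - a)"
  defines "A \<equiv> {x. a \<le> \<bar>v x\<bar> \<and> \<bar>v x\<bar> < b}"
  shows "((\<lambda>t. max 0 ((sup_conv t f y - f y) / t - indicator A y * norm g)) \<longlongrightarrow> 0) (at_right 0)"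
proof -
  have fle: "f x \<le> b - a" for x by (simp add: f_def)
  have *: "\<forall>\<^sub>F t in at_right 0. (sup_conv t f y - f y) / t \<le> indicator A y * norm g + e" if e: "e > 0" for e
  proof -
    consider "\<bar>v y\<bar> < a" | "\<bar>v y\<bar> \<ge> b" | "y \<in> A" by (force simp: A_def)
    then show ?thesis
    proof cases
      case 1
      have "(a - \<bar>v y\<bar>) / M > 0" using 1 M by simp
      then have "\<forall>\<^sub>F t in at_right 0. t < (a - \<bar>v y\<bar>) / M"
        by (auto simp: eventually_at_right_field intro!: exI[of _ "(a - \<bar>v y\<bar>) / M"])
      with eventually_at_right_less[of "0::real"] show ?thesis
      proof eventually_elim
        case (elim t)
        have "f x \<le> 0" if "x \<in> ball y t" for x
        proof -
          have "norm (x - y) < t" using that by (simp add: dist_norm norm_minus_commute)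
          then have "M * norm (x - y) < a - \<bar>v y\<bar>"
            using elim M by (smt (verit) mult_strict_left_mono pos_less_divide_eq mult.commute)
          then have "\<bar>v x\<bar> < a" using lip[of x y] by linarith
          then show ?thesis by (simp add: f_def)
        qed
        then have "sup_conv t f y \<le> 0" by (rule sup_conv_bounds(3)[where f=f, OF elim(1) fle])
        moreover have "f y = 0" using 1 ab by (simp add: f_def)
        ultimately have "(sup_conv t f y - f y) / t \<le> 0" using elim by (simp add: divide_nonpos_pos)
        also have "0 \<le> indicator A y * norm g + e" using e by simp
        finally show ?case .
      qed
    next
      case 2
      show ?thesis using eventually_at_right_less[of "0::real"]
      proof eventually_elim
        case (elim t)
        have "f y = b - a" using 2 ab by (simp add: f_def)
        then have "(sup_conv t f y - f y) / t \<le> 0"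
          using sup_conv_bounds(2)[where f=f and x=y, OF elim fle] elim by (simp add: divide_nonpos_pos)
        also have "0 \<le> indicator A y * norm g + e" using e by simp
        finally show ?case .
      qed
    next
      case 3
      obtain d where d: "d > 0" "\<And>x. norm (x - y) < d \<Longrightarrow> norm (v x - v y - (x - y) \<bullet> g) \<le> e * norm (x - y)"
        using v e unfolding gderiv_def has_derivative_at_alt by meson
      have "\<forall>\<^sub>F t in at_right 0. t < d"
        using d(1) by (auto simp: eventually_at_right_field)
      with eventually_at_right_less[of "0::real"] show ?thesis
      proof eventually_elim
        case (elim t)
        have "f x \<le> f y + (norm g + e) * t" if "x \<in> ball y t" for x
        proof -
          have n: "norm (x - y) < t" using that by (simp add: dist_norm norm_minus_commute)
          have "\<bar>v x - v y\<bar> \<le> norm (x - y) * norm g + e * norm (x - y)"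
            using d(2)[of x] n elim(2) Cauchy_Schwarz_ineq2[of "x - y" g] by (simp add: abs_le_iff)
          also have "\<dots> = (norm g + e) * norm (x - y)" by (simp add: algebra_simps)
          also have "\<dots> \<le> (norm g + e) * t" using n e by (intro mult_left_mono) auto
          finally have "\<bar>v x\<bar> - \<bar>v y\<bar> \<le> (norm g + e) * t" by linarith
          moreover have "0 \<le> (norm g + e) * t" using e elim by simp
          moreover have "f y = \<bar>v y\<bar> - a" using 3 by (simp add: f_def A_def)
          ultimately show ?thesis using 3 by (auto simp: f_def A_def)
        qed
        then have "sup_conv t f y \<le> f y + (norm g + e) * t" by (rule sup_conv_bounds(3)[where f=f, OF elim(1) fle])
        then show ?case using elim 3 by (simp add: field_simps)
      qed
    qed
  qed
  show ?thesis
  proof (rule tendstoI)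
    fix e :: real assume "e > 0"
    then have "e / 2 > 0" by simp
    from *[OF this] show "\<forall>\<^sub>F t in at_right 0. dist (max 0 ((sup_conv t f y - f y) / t - indicator A y * norm g)) 0 < e"
      by eventually_elim (use \<open>e > 0\<close> in \<open>auto simp: max_def\<close>)
  qed
qed

lemma superlevel_lmeasurable:
  assumes v: "v \<in> Cc_infinity U" and c: "c > 0"
  shows "{z. c \<le> \<bar>v z\<bar>} \<in> lmeasurable" "compact {z. c \<le> \<bar>v z\<bar>}"
proof -
  obtain C where C: "compact C" "\<And>x. x \<notin> C \<Longrightarrow> v x = 0"
    using Cc_infinity_support[OF v] by metis
  have "closed {y. c \<le> \<bar>v y\<bar>}" using Cc_infinity_gradient(3)[OF v] by (intro closed_Collect_le continuous_intros)
  moreover have "{y. c \<le> \<bar>v y\<bar>} \<subseteq> C" using C(2) c by force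
  ultimately show "compact {z. c \<le> \<bar>v z\<bar>}" using C(1) by (metis compact_Int_closed inf.absorb_iff2)
  then show "{z. c \<le> \<bar>v z\<bar>} \<in> lmeasurable" by (rule lmeasurable_compact)
qed

text \<open>Plays the part of the coarea formula combined with the isoperimetric inequality.
  Sup-convolution with radius \<open>t\<close> increases the integral of the truncation to the layer
  by at least the height times the perimeter of the inner ball times \<open>t\<close>; divided by
  \<open>t\<close>, the increase is in the limit at most the integral of the gradient over the
  layer.\<close>

lemma layer_gradient_bound:
  fixes v :: "'a::euclidean_space \<Rightarrow> real"
  assumes v: "v \<in> Cc_infinity U" and ab: "0 < a" "a < b" and x: "x \<ge> 0"
    and E: "{y. b \<le> \<bar>v y\<bar>} \<noteq> {}" "ball_vol TYPE('a) x \<le> measure lebesgue {y. b \<le> \<bar>v y\<bar>}"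
  shows "(b - a) * (real DIM('a) * unit_ball_vol (real DIM('a)) * x ^ (DIM('a) - 1))
    \<le> (\<integral>y. indicator {y. a \<le> \<bar>v y\<bar> \<and> \<bar>v y\<bar> < b} y * norm (gradient v y) \<partial>lebesgue)"
proof -
  define k where "k = real DIM('a) * unit_ball_vol (real DIM('a)) * x ^ (DIM('a) - 1)"
  define A where "A = {y. a \<le> \<bar>v y\<bar> \<and> \<bar>v y\<bar> < b}"
  define f where "f = (\<lambda>x. min (max (\<bar>v x\<bar> - a) 0) (b - a))"
  obtain C where C: "compact C" "\<And>x. x \<notin> C \<Longrightarrow> v x = 0" "\<And>x. x \<notin> C \<Longrightarrow> gradient v x = 0"
    using Cc_infinity_support[OF v] by metis
  obtain M where M: "M > 0" "\<And>x y. \<bar>v x - v y\<bar> \<le> M * norm (x - y)"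
    using Cc_infinity_Lipschitz[OF v] by metis
  note g = Cc_infinity_gradient[OF v]
  have k0: "k \<ge> 0" using x by (simp add: k_def)
  have fc: "continuous_on UNIV f" unfolding f_def using g by (intro continuous_intros)
  have f0: "0 \<le> f y" "f y \<le> b - a" for y using ab by (auto simp: f_def)
  have fC: "f y = 0" if "y \<notin> C" for y using C(2)[OF that] ab by (simp add: f_def)
  define K where "K = {x + y |x y. x \<in> C \<and> y \<in> cball 0 1}"
  have K: "compact K" unfolding K_def by (rule compact_sums[OF C(1) compact_cball])
  have CK: "y \<in> K" if "z \<in> C" "norm (y - z) \<le> 1" for y z
    unfolding K_def mem_Collect_eq
    by (rule exI[of _ z], rule exI[of _ "y - z"]) (use that in auto)
  define t where "t n = inverse (real (Suc n))" for n
  have t: "t n > 0" "t n \<le> 1" for n by (auto simp: t_def inverse_le_1_iff)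
  have t0: "filterlim t (at_right 0) sequentially"
    unfolding t_def[abs_def] using LIMSEQ_inverse_real_of_nat by (intro tendsto_imp_filterlim_at_right) auto
  have flip: "\<bar>f y - f z\<bar> \<le> M * norm (y - z)" for y z
  proof -
    have "\<bar>min (max s 0) h - min (max r 0) h\<bar> \<le> \<bar>s - r\<bar>" if "h > 0" for s r h :: real
      using that by linarith
    from this[of "b - a" "\<bar>v y\<bar> - a" "\<bar>v z\<bar> - a"]
    have "\<bar>f y - f z\<bar> \<le> \<bar>(\<bar>v y\<bar> - a) - (\<bar>v z\<bar> - a)\<bar>" using ab by (simp only: f_def diff_gt_0_iff_gt)
    also have "\<dots> \<le> \<bar>v y - v z\<bar>" by linarith
    also note M(2)[of y z]
    finally show ?thesis .
  qed
  have sc: "f y \<le> sup_conv (t n) f y" "sup_conv (t n) f y \<le> f y + M * t n" for n y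
  proof -
    show "f y \<le> sup_conv (t n) f y" using sup_conv_bounds(1)[OF t(1) f0(2)] .
    show "sup_conv (t n) f y \<le> f y + M * t n"
    proof (rule sup_conv_bounds(3)[OF t(1) f0(2)])
      fix z assume "z \<in> ball y (t n)"
      then have "M * norm (z - y) \<le> M * t n" using M by (intro mult_left_mono) (auto simp: dist_norm norm_minus_commute)
      then show "f z \<le> f y + M * t n" using flip[of z y] by linarith
    qed
  qed
  have scK: "sup_conv (t n) f y = 0" "f y = 0" if "y \<notin> K" for n y
  proof -
    have "z \<notin> C" if "z \<in> ball y (t n)" for z
      using CK[of z y] \<open>y \<notin> K\<close> that t(2)[of n] by (auto simp: dist_norm)
    then have "sup_conv (t n) f y \<le> 0" using fC by (intro sup_conv_bounds(3)[OF t(1) f0(2)]) auto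
    moreover have "y \<notin> C" using CK[of y y] that by auto
    ultimately show "sup_conv (t n) f y = 0" "f y = 0" using fC f0(1) sc(1)[of y n] by auto
  qed
  have fm: "f \<in> borel_measurable borel" using fc by (rule borel_measurable_continuous_onI)
  have sm: "sup_conv (t n) f \<in> borel_measurable borel" for n
    by (rule sup_conv_measurable[OF t(1) f0(2)])
  have bK: "integrable lborel (\<lambda>y. indicat_real K y *\<^sub>R c)" for c :: real
    by (rule borel_integrable_compact[OF K]) simp
  have fi: "integrable lborel f"
    by (rule Bochner_Integration.integrable_bound[OF bK[of "b - a"]])
      (use f0 scK ab fm in \<open>auto simp: indicator_def\<close>)
  have si: "integrable lborel (sup_conv (t n) f)" for n
  proof (rule Bochner_Integration.integrable_bound[OF bK[of "b - a"]])
    show "AE y in lborel. norm (sup_conv (t n) f y) \<le> norm (indicat_real K y *\<^sub>R (b - a))"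
    proof (intro AE_I2)
      fix y
      have "0 \<le> sup_conv (t n) f y" using f0(1) sc(1) order_trans by blast
      moreover have "sup_conv (t n) f y \<le> b - a" by (rule sup_conv_bounds(2)[OF t(1) f0(2)])
      ultimately show "norm (sup_conv (t n) f y) \<le> norm (indicat_real K y *\<^sub>R (b - a))"
        using scK(1)[of y n] ab by (cases "y \<in> K") simp_all
    qed
  qed (use sm in simp)
  have Em: "{y. b \<le> \<bar>v y\<bar>} \<in> lmeasurable"
    using ab by (intro superlevel_lmeasurable[OF v]) simp
  have growth: "(\<integral>y. f y \<partial>lborel) + (b - a) * k * t n \<le> (\<integral>y. sup_conv (t n) f y \<partial>lborel)" for n
  proof -
    have s0: "0 \<le> sup_conv (t n) f y" for y using f0(1) sc(1) order_trans by blast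
    have "(\<integral>\<^sup>+y. f y \<partial>lborel) + ennreal ((b - a) * (real DIM('a) * unit_ball_vol (real DIM('a)) * x ^ (DIM('a) - 1) * t n))
        \<le> (\<integral>\<^sup>+y. sup_conv (t n) f y \<partial>lborel)"
      by (rule sup_conv_integral_growth[OF fc f0 C(1) fC E(1) _ Em E(2) t(1) x])
        (use ab in \<open>auto simp: f_def\<close>)
    moreover have "0 \<le> (\<integral>y. f y \<partial>lborel)" "0 \<le> (b - a) * k * t n"
      using f0(1) ab k0 t(1)[of n] by auto
    ultimately show ?thesis
      using s0 f0(1)
      by (simp add: nn_integral_eq_integral[OF fi] nn_integral_eq_integral[OF si] k_def mult.assoc
          ennreal_plus[symmetric] del: ennreal_plus)
  qed
  \<comment> \<open>The excess of the difference quotient over the gradient on the layer. It is at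
    most \<open>M\<close>, vanishes off the 1-neighbourhood \<open>K\<close> of the support, and
    tends to 0 pointwise.\<close>
  define e where "e n y = max 0 ((sup_conv (t n) f y - f y) / t n - indicator A y * norm (gradient v y))" for n y
  have Am: "A \<in> sets borel"
  proof -
    have "v \<in> borel_measurable borel" using g(3) by (rule borel_measurable_continuous_onI)
    then show ?thesis unfolding A_def by measurable
  qed
  have gi: "integrable lborel (\<lambda>y. indicator A y * norm (gradient v y))"
  proof -
    have "integrable lborel (\<lambda>y. indicator A y *\<^sub>R norm (gradient v y))"
      using Am integrable_continuous_compact_support(1)[OF g(2) C(1,3)]
      by (intro integrable_mult_indicator integrable_norm) auto
    then show ?thesis by simp
  qed
  have em: "e n \<in> borel_measurable lborel" for n
    unfolding e_def[abs_def] using sm fm gi by measurable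
  have ebound: "norm (e n y) \<le> norm (indicat_real K y *\<^sub>R M)" for n y
  proof (cases "y \<in> K")
    case True
    have "(sup_conv (t n) f y - f y) / t n \<le> M" using sc(2)[of n y] t(1)[of n] by (simp add: field_simps)
    moreover have "0 \<le> indicator A y * norm (gradient v y)" by simp
    ultimately have "(sup_conv (t n) f y - f y) / t n - indicator A y * norm (gradient v y) \<le> M" by linarith
    then show ?thesis using True M(1) by (auto simp: e_def)
  next
    case False
    then have "e n y = max 0 (- (indicator A y * norm (gradient v y)))" using scK by (simp add: e_def)
    also have "\<dots> = 0" by (simp add: indicator_def)
    finally show ?thesis by simp
  qed
  have ei: "integrable lborel (e n)" for n
    by (rule Bochner_Integration.integrable_bound[OF bK em]) (use ebound in auto)
  have elim: "(\<lambda>n. \<integral>y. e n y \<partial>lborel) \<longlonglongrightarrow> (\<integral>y. 0 \<partial>(lborel :: 'a measure))"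
  proof (rule integral_dominated_convergence[where w = "\<lambda>y. norm (indicat_real K y *\<^sub>R M)"])
    show "AE y in lborel. (\<lambda>n. e n y) \<longlonglongrightarrow> 0"
      unfolding e_def f_def A_def
      using filterlim_compose[OF sup_conv_quotient_tendsto[OF g(1) M(2) M(1) ab(2)] t0] by (intro AE_I2)
  qed (use em ebound bK[of M] in auto)
  have "(b - a) * k \<le> (\<integral>y. indicator A y * norm (gradient v y) \<partial>lborel) + (\<integral>y. e n y \<partial>lborel)" for n
  proof -
    have "(b - a) * k * t n \<le> (\<integral>y. sup_conv (t n) f y - f y \<partial>lborel)"
      using growth[of n] fi si by simp
    then have "(b - a) * k \<le> (\<integral>y. sup_conv (t n) f y - f y \<partial>lborel) / t n"
      using t(1)[of n] by (simp add: field_simps)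
    also have "\<dots> = (\<integral>y. (sup_conv (t n) f y - f y) / t n \<partial>lborel)" by simp
    also have "\<dots> \<le> (\<integral>y. indicator A y * norm (gradient v y) + e n y \<partial>lborel)"
      using fi si gi ei by (intro integral_mono) (auto simp: e_def)
    also have "\<dots> = (\<integral>y. indicator A y * norm (gradient v y) \<partial>lborel) + (\<integral>y. e n y \<partial>lborel)"
      using gi ei by (rule Bochner_Integration.integral_add)
    finally show ?thesis .
  qed
  then have "(b - a) * k \<le> (\<integral>y. indicator A y * norm (gradient v y) \<partial>lborel) + 0"
    using elim by (intro LIMSEQ_le_const[OF tendsto_add[OF tendsto_const]]) auto
  moreover have "(\<integral>y. indicator A y * norm (gradient v y) \<partial>lebesgue) = (\<integral>y. indicator A y * norm (gradient v y) \<partial>lborel)"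
    using gi by (intro integral_completion) auto
  ultimately show ?thesis by (simp add: k_def A_def)
qed

text \<open>A function with Lipschitz constant \<open>M\<close> needs the distance
  \<open>(b - a) / M\<close> to fall from \<open>b\<close> to \<open>a\<close>. The neighbourhood of
  this width of the upper superlevel set thus lies in the lower one, and Brunn--Minkowski bounds its
  volume from below.\<close>

lemma layer_radius_bound:
  fixes v :: "'a::euclidean_space \<Rightarrow> real"
  assumes v: "v \<in> Cc_infinity U" and M: "M > 0" "\<And>x y. \<bar>v x - v y\<bar> \<le> M * norm (x - y)"
    and ab: "0 < a" "a < b" and x: "x \<ge> 0" "y \<ge> 0"
    and E: "{z. b \<le> \<bar>v z\<bar>} \<noteq> {}" "ball_vol TYPE('a) x \<le> measure lebesgue {z. b \<le> \<bar>v z\<bar>}"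
    and F: "measure lebesgue {z. a \<le> \<bar>v z\<bar>} \<le> ball_vol TYPE('a) y"
  shows "x + (b - a) / M \<le> y"
proof (rule field_le_epsilon)
  fix e :: real assume e: "e > 0"
  obtain C where C: "compact C" "\<And>x. x \<notin> C \<Longrightarrow> v x = 0"
    using Cc_infinity_support[OF v] by metis
  note g = Cc_infinity_gradient[OF v]
  \<comment> \<open>Brunn--Minkowski is available for open sets, so the closed superlevel set at
    \<open>b\<close> is enlarged to the open one at \<open>b - \<eta>\<close>; this costs at most
    \<open>e\<close> in the radius.\<close>
  define \<eta> where "\<eta> = min ((b - a) / 2) (e * M)"
  have \<eta>: "0 < \<eta>" "\<eta> < b - a" "\<eta> \<le> e * M" using ab e M by (auto simp: \<eta>_def min_def)
  let ?U = "{z. b - \<eta> < \<bar>v z\<bar>}" and ?t = "(b - a - \<eta>) / M"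
  have o: "open ?U" using g(3) by (intro open_Collect_less continuous_intros)
  note lm = superlevel_lmeasurable(1)[OF v]
  have "?U \<subseteq> C" using C(2) \<eta> ab by force
  then have bd: "bounded ?U" using C(1) compact_imp_bounded bounded_subset by blast
  have EU: "{z. b \<le> \<bar>v z\<bar>} \<subseteq> ?U" using \<eta> by auto
  have "measure lebesgue {z. b \<le> \<bar>v z\<bar>} \<le> measure lebesgue ?U"
    using EU o bd lm[of b] ab by (intro measure_mono_fmeasurable) (auto intro: lmeasurable_open dest: fmeasurableD)
  then have "ball_vol TYPE('a) (x + ?t) \<le> measure lebesgue (msum ?U (ball 0 ?t))"
    using E EU \<eta> M x by (intro brunn_minkowski_growth(1) o bd) auto
  also have "\<dots> \<le> measure lebesgue {z. a \<le> \<bar>v z\<bar>}"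
  proof (rule measure_mono_fmeasurable)
    show "msum ?U (ball 0 ?t) \<subseteq> {z. a \<le> \<bar>v z\<bar>}"
    proof
      fix z assume "z \<in> msum ?U (ball 0 ?t)"
      then obtain z1 z2 where z: "z = z1 + z2" "b - \<eta> < \<bar>v z1\<bar>" "norm z2 < ?t" by (auto elim!: msumE)
      have "M * norm z2 < b - a - \<eta>" using z(3) M(1) by (simp add: field_simps)
      then have "\<bar>v z - v z1\<bar> < b - a - \<eta>" using M(2)[of z z1] z(1) by simp
      then show "z \<in> {z. a \<le> \<bar>v z\<bar>}" using z(2) by auto
    qed
    show "msum ?U (ball 0 ?t) \<in> sets lebesgue" by (intro fmeasurableD lmeasurable_msum bd) auto
  qed (use lm ab in auto)
  also note F
  finally have "x + ?t \<le> y"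
    using x \<eta> M by (subst (asm) ball_vol_le_iff) auto
  moreover have "(b - a) / M \<le> ?t + e" using \<eta>(3) M(1) by (simp add: field_simps)
  ultimately show "x + (b - a) / M \<le> y + e" by linarith
qed

section \<open>Symmetrization\<close>

lemma GDERIV_sum:
  assumes "\<And>i. i \<in> I \<Longrightarrow> GDERIV (f i) x :> g i"
  shows "GDERIV (\<lambda>x. \<Sum>i\<in>I. f i x) x :> (\<Sum>i\<in>I. g i)"
  using assms
  by (induction I rule: infinite_finite_induct) (auto intro!: GDERIV_const GDERIV_add)

lemma sum_indicator_disjoint_le:
  fixes c :: "'i \<Rightarrow> real"
  assumes "finite I" "disjoint_family_on A I" "\<And>j. j \<in> I \<Longrightarrow> x \<in> A j \<Longrightarrow> c j \<le> B" "0 \<le> B"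
  shows "(\<Sum>j\<in>I. c j * indicator (A j) x) \<le> B"
proof (cases "\<exists>j\<in>I. x \<in> A j")
  case True
  then obtain j where j: "j \<in> I" "x \<in> A j" by blast
  have "(\<Sum>i\<in>I. c i * indicator (A i) x) = c j * indicator (A j) x + (\<Sum>i\<in>I - {j}. c i * indicator (A i) x)"
    using assms(1) j(1) by (rule sum.remove)
  also have "(\<Sum>i\<in>I - {j}. c i * indicator (A i) x) = 0"
  proof (rule sum.neutral, intro ballI)
    fix i assume "i \<in> I - {j}"
    then have "A i \<inter> A j = {}" using assms(2) j(1) by (auto simp: disjoint_family_on_def)
    then show "c i * indicator (A i) x = 0" using j(2) by (auto simp: indicator_def)
  qed
  finally show ?thesis using j assms(3) by simp
next
  case False
  then have "(\<Sum>j\<in>I. c j * indicator (A j) x) = 0" by (intro sum.neutral) (auto simp: indicator_def)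
  then show ?thesis using assms(4) by simp
qed

text \<open>The radii decrease with the index, so \<open>y j\<close> is the outer one. When the
  inner radius is 0 the annulus is the whole ball, since \<open>ball c 0\<close> is empty.\<close>

definition annulus :: "'a::euclidean_space \<Rightarrow> (nat \<Rightarrow> real) \<Rightarrow> nat \<Rightarrow> 'a set" where
  "annulus c y j = ball c (y j) - ball c (y (Suc j))"

lemma measure_annulus:
  assumes "0 \<le> y (Suc j)" "y (Suc j) \<le> y j"
  shows "annulus (c::'a::euclidean_space) y j \<in> lmeasurable"
    "measure lebesgue (annulus c y j) = ball_vol TYPE('a) (y j) - ball_vol TYPE('a) (y (Suc j))"
proof -
  show "annulus c y j \<in> lmeasurable" unfolding annulus_def by (intro fmeasurable.Diff lmeasurable_ball)
  have "measure lebesgue (annulus c y j) = measure lebesgue (ball c (y j)) - measure lebesgue (ball c (y (Suc j)))"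
    unfolding annulus_def using assms by (intro measurable_measure_Diff subset_ball lmeasurable_ball fmeasurableD)
  then show "measure lebesgue (annulus c y j) = ball_vol TYPE('a) (y j) - ball_vol TYPE('a) (y (Suc j))"
    using measure_ball_0[of "y j" c] measure_ball_0[of "y (Suc j)" c] assms by linarith
qed

lemma integral_sum_indicator:
  fixes A :: "'i \<Rightarrow> 'a::euclidean_space set" and c :: "'i \<Rightarrow> real"
  assumes "finite I" "\<And>j. j \<in> I \<Longrightarrow> A j \<in> lmeasurable"
  shows "integrable lebesgue (\<lambda>x. \<Sum>j\<in>I. c j * indicator (A j) x)"
    "(\<integral>x. (\<Sum>j\<in>I. c j * indicator (A j) x) \<partial>lebesgue) = (\<Sum>j\<in>I. c j * measure lebesgue (A j))"
proof -
  have i: "integrable lebesgue (\<lambda>x. c j * indicat_real (A j) x)" if "j \<in> I" for j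
    by (intro integrable_mult_right integrable_indicator_lmeasurable assms(2) that)
  show "integrable lebesgue (\<lambda>x. \<Sum>j\<in>I. c j * indicator (A j) x)"
    using i by (rule Bochner_Integration.integrable_sum)
  have "(\<integral>x. (\<Sum>j\<in>I. c j * indicator (A j) x) \<partial>lebesgue) = (\<Sum>j\<in>I. \<integral>x. c j * indicat_real (A j) x \<partial>lebesgue)"
    using i by (rule Bochner_Integration.integral_sum)
  also have "\<dots> = (\<Sum>j\<in>I. c j * measure lebesgue (A j))"
  proof (rule sum.cong[OF refl])
    fix j assume "j \<in> I"
    show "(\<integral>x. c j * indicat_real (A j) x \<partial>lebesgue) = c j * measure lebesgue (A j)"
      by (subst integral_mult_right_zero) simp
  qed
  finally show "(\<integral>x. (\<Sum>j\<in>I. c j * indicator (A j) x) \<partial>lebesgue) = (\<Sum>j\<in>I. c j * measure lebesgue (A j))" .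
qed

text \<open>The profile is linear in the squared radius on each annulus, up to smoothing: this keeps it
  smooth at the centre.\<close>

lemma radial_profile:
  fixes x0 :: "'a::euclidean_space" and y :: "nat \<Rightarrow> real"
  assumes y: "\<And>j. j < N \<Longrightarrow> y (Suc j) < y j" "y (Suc N) = 0" "y N \<ge> 0" "y 0 < \<rho>"
    and h: "h > 0" and e: "e > 0"
  obtains \<psi> where "\<psi> \<in> Cc_infinity (ball x0 \<rho>)"
    "\<And>s. s > 0 \<Longrightarrow> (\<integral>x. norm (gradient \<psi> x) powr s \<partial>lebesgue) \<le>
      (\<Sum>j<N. ((1 + e) * (2 * y j * h / ((y j)\<^sup>2 - (y (Suc j))\<^sup>2))) powr s *
        (ball_vol TYPE('a) (y j) - ball_vol TYPE('a) (y (Suc j))))"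
    "\<And>q. q > 0 \<Longrightarrow> (\<integral>x. \<bar>\<psi> x\<bar> powr q \<partial>lebesgue) \<ge>
      (\<Sum>j\<le>N. (h * real j) powr q * (ball_vol TYPE('a) (y j) - ball_vol TYPE('a) (y (Suc j))))"
proof -
  obtain H H' :: "real \<Rightarrow> real" where H: "\<And>k. Ck k H" "\<And>t. DERIV H t :> H' t"
    "\<And>t. 0 \<le> H' t" "\<And>t. H' t \<le> 1 + e" "\<And>t. t \<le> 0 \<Longrightarrow> H t = 0" "\<And>t. t \<ge> 1 \<Longrightarrow> H t = 1"
    "\<And>t. \<not> (0 < t \<and> t < 1) \<Longrightarrow> H' t = 0"
    using smooth_step_exists[OF e] by metis
  have Hnn: "H t \<ge> 0" for t
  proof (cases "t \<le> 0")
    case False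
    then have "H 0 \<le> H t" using H(2,3) by (intro DERIV_nonneg_imp_nondecreasing[of 0 t H]) auto
    then show ?thesis using H(5)[of 0] by simp
  qed (use H(5) in simp)
  have step: "y (Suc j) \<le> y j" if "j \<le> N" for j
    using y(1)[of j] y(2,3) that by (cases "j = N") auto
  have anti: "y j \<le> y i" if "i \<le> j" "j \<le> Suc N" for i j
    using that
  proof (induction j rule: dec_induct)
    case (step j)
    then show ?case using \<open>\<And>j. j \<le> N \<Longrightarrow> y (Suc j) \<le> y j\<close>[of j] by simp
  qed simp
  have ynn: "y j \<ge> 0" if "j \<le> Suc N" for j using anti[OF that] y(2) by simp
  define D where "D j = (y j)\<^sup>2 - (y (Suc j))\<^sup>2" for j
  have Dpos: "D j > 0" if "j < N" for j
    using y(1)[OF that] ynn[of "Suc j"] that by (simp add: D_def power_strict_mono)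
  define Q where "Q x = (x - x0) \<bullet> (x - x0)" for x
  have Qn: "Q x = (norm (x - x0))\<^sup>2" for x by (simp add: Q_def power2_norm_eq_inner)
  have CkQ: "Ck k Q" for k
  proof -
    have "Ck k (\<lambda>x. \<Sum>i\<in>Basis. (x \<bullet> i - x0 \<bullet> i) * (x \<bullet> i - x0 \<bullet> i))"
      by (intro Ck_sum Ck_mult Ck_diff Ck_inner Ck_const)
    moreover have "Q = (\<lambda>x. \<Sum>i\<in>Basis. (x \<bullet> i - x0 \<bullet> i) * (x \<bullet> i - x0 \<bullet> i))"
      unfolding Q_def by (subst euclidean_inner) (simp add: inner_diff_left)
    ultimately show ?thesis by simp
  qed
  have GQ: "GDERIV Q x :> 2 *\<^sub>R (x - x0)" for x
    unfolding gderiv_def Q_def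
    by (auto intro!: derivative_eq_intros simp: inner_commute algebra_simps)
  \<comment> \<open>Runs from 0 on the outer sphere of the annulus \<open>j\<close> to 1 on the
    inner one; its gradient has norm at most \<open>2 * y j / D j\<close> there.\<close>
  define \<tau> where "\<tau> j x = ((y j)\<^sup>2 - Q x) / D j" for j x
  have Ck\<tau>: "Ck k (\<tau> j)" for k j
    using Ck_mult[OF Ck_diff[OF Ck_const[of k "(y j)\<^sup>2"] CkQ[of k]] Ck_const[of k "1 / D j"]]
    by (simp add: \<tau>_def[abs_def])
  have G\<tau>: "GDERIV (\<tau> j) x :> (- 2 / D j) *\<^sub>R (x - x0)" for j x
  proof -
    have "GDERIV (\<lambda>x. ((y j)\<^sup>2 - Q x) * (1 / D j)) x :> ((y j)\<^sup>2 - Q x) *\<^sub>R 0 + (1 / D j) *\<^sub>R (0 - 2 *\<^sub>R (x - x0))"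
      by (intro GDERIV_mult GDERIV_diff GDERIV_const GQ)
    then show ?thesis by (simp add: \<tau>_def[abs_def])
  qed
  \<comment> \<open>On the annulus \<open>j\<close> the first \<open>j\<close> steps are complete,
    so the value is at least \<open>h * real j\<close>. On the innermost ball, \<open>j = N\<close>,
    the profile is constant, which is why the gradient bound sums over \<open>j < N\<close>
    only.\<close>
  define \<psi> where "\<psi> x = (\<Sum>j<N. h * H (\<tau> j x))" for x
  have Ck\<psi>: "Ck k \<psi>" for k
    unfolding \<psi>_def[abs_def] by (intro Ck_sum Ck_mult Ck_const Ck_compose[OF H(1) Ck\<tau>])
  define T where "T j x = (h * H' (\<tau> j x) * (- 2 / D j)) *\<^sub>R (x - x0)" for j x
  have g\<psi>: "gradient \<psi> x = (\<Sum>j<N. T j x)" for x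
  proof (rule gradient_eqI)
    have "GDERIV (\<lambda>x. h * H (\<tau> j x)) x :> T j x" for j
      using GDERIV_mult[OF GDERIV_const[of h] GDERIV_DERIV_compose[OF G\<tau> H(2)]]
      by (simp add: T_def mult.assoc)
    then show "GDERIV \<psi> x :> (\<Sum>j<N. T j x)"
      unfolding \<psi>_def[abs_def] by (intro GDERIV_sum)
  qed
  let ?A = "annulus x0 y"
  have T0: "T j x = 0" if "j < N" "x \<notin> ?A j" for j x
  proof -
    have "\<not> (0 < \<tau> j x \<and> \<tau> j x < 1)"
    proof
      assume t: "0 < \<tau> j x \<and> \<tau> j x < 1"
      then have "(norm (x - x0))\<^sup>2 < (y j)\<^sup>2" "(y (Suc j))\<^sup>2 < (norm (x - x0))\<^sup>2"
        using Dpos[OF that(1)] by (auto simp: \<tau>_def Qn D_def field_simps)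
      then have "norm (x - x0) < y j" "y (Suc j) < norm (x - x0)"
        using ynn[of j] that(1) by (auto intro: power2_less_imp_less)
      then show False using that(2) by (simp add: annulus_def dist_norm norm_minus_commute)
    qed
    then show ?thesis using H(7) by (simp add: T_def)
  qed
  have TS: "norm (T j x) \<le> (1 + e) * (2 * y j * h / D j)" if "j < N" "x \<in> ?A j" for j x
  proof -
    have "norm (x - x0) \<le> y j" using that by (simp add: annulus_def dist_norm norm_minus_commute)
    then have "norm (T j x) \<le> (h * (1 + e) * (2 / D j)) * y j"
      unfolding T_def norm_scaleR using H(3)[of "\<tau> j x"] H(4)[of "\<tau> j x"] h e Dpos[OF that(1)]
      by (intro mult_mono) (auto simp: abs_mult intro!: divide_right_mono mult_right_mono mult_left_mono)
    then show ?thesis by (simp add: mult_ac)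
  qed
  have disj: "disjoint_family_on ?A {..N}"
  proof -
    have *: "?A i \<inter> ?A j = {}" if "i < j" "j \<le> N" for i j
    proof -
      have "y j \<le> y (Suc i)" using anti[of "Suc i" j] that by simp
      then show ?thesis by (auto simp: annulus_def)
    qed
    show ?thesis unfolding disjoint_family_on_def
    proof (intro ballI impI)
      fix i j assume "i \<in> {..N}" "j \<in> {..N}" "i \<noteq> j"
      then consider "i < j" "j \<le> N" | "j < i" "i \<le> N" by force
      then show "?A i \<inter> ?A j = {}" using *[of i j] *[of j i] by cases auto
    qed
  qed
  have Am: "?A j \<in> lmeasurable" "measure lebesgue (?A j) = ball_vol TYPE('a) (y j) - ball_vol TYPE('a) (y (Suc j))"
    if "j \<le> N" for j
    using measure_annulus[of y j x0] ynn[of "Suc j"] step[OF that] that by auto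
  have C\<psi>: "\<psi> \<in> Cc_infinity (ball x0 \<rho>)"
  proof (rule Cc_infinityI[of _ "cball x0 (y 0)"])
    show "\<psi> x = 0" if "x \<notin> cball x0 (y 0)" for x
    proof -
      have "H (\<tau> j x) = 0" if "j < N" for j
      proof (rule H(5))
        have "y j \<le> y 0" using anti[of 0 j] that by simp
        then have "y j \<le> norm (x - x0)" using \<open>x \<notin> cball x0 (y 0)\<close> by (simp add: dist_norm norm_minus_commute)
        then have "(y j)\<^sup>2 \<le> Q x" unfolding Qn using ynn[of j] that by (intro power_mono) auto
        then show "\<tau> j x \<le> 0" using Dpos[OF that] by (simp add: \<tau>_def divide_nonpos_pos)
      qed
      then show ?thesis by (simp add: \<psi>_def)
    qed
  qed (use Ck\<psi> y(4) in auto)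
  have int\<psi>: "integrable lebesgue (\<lambda>x. \<bar>\<psi> x\<bar> powr s)" "integrable lebesgue (\<lambda>x. norm (gradient \<psi> x) powr s)" if "s > 0" for s
    using Lp_Cc_infinity(3,4)[OF C\<psi> open_ball that] by auto
  show ?thesis
  proof (rule that[OF C\<psi>])
    fix s :: real assume s: "s > 0"
    let ?c = "\<lambda>j. ((1 + e) * (2 * y j * h / D j)) powr s"
    have "norm (gradient \<psi> x) powr s \<le> (\<Sum>j<N. ?c j * indicator (?A j) x)" for x
    proof (cases "\<exists>j<N. x \<in> ?A j")
      case True
      then obtain j where j: "j < N" "x \<in> ?A j" by blast
      have "T i x = 0" if "i < N" "i \<noteq> j" for i
      proof (rule T0[OF that(1)])
        have "?A i \<inter> ?A j = {}" using disj that j by (auto simp: disjoint_family_on_def)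
        then show "x \<notin> ?A i" using j by blast
      qed
      then have "gradient \<psi> x = T j x"
        unfolding g\<psi> using j by (subst sum.remove[of _ j]) (auto intro!: sum.neutral)
      then have "norm (gradient \<psi> x) powr s \<le> ?c j"
        using TS[OF j] s by (intro powr_mono2) auto
      also have "\<dots> = ?c j * indicator (?A j) x" using j by simp
      also have "\<dots> \<le> (\<Sum>j<N. ?c j * indicator (?A j) x)"
        using j by (intro member_le_sum) auto
      finally show ?thesis .
    next
      case False
      then have "gradient \<psi> x = 0" unfolding g\<psi> using T0 by (intro sum.neutral) auto
      then show ?thesis by (simp add: sum_nonneg)
    qed
    then have "(\<integral>x. norm (gradient \<psi> x) powr s \<partial>lebesgue) \<le> (\<integral>x. (\<Sum>j<N. ?c j * indicator (?A j) x) \<partial>lebesgue)"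
      using Am(1) s by (intro integral_mono int\<psi> integral_sum_indicator(1)) auto
    also have "\<dots> = (\<Sum>j<N. ?c j * measure lebesgue (?A j))"
      using Am(1) by (intro integral_sum_indicator(2)) auto
    also have "\<dots> = (\<Sum>j<N. ?c j * (ball_vol TYPE('a) (y j) - ball_vol TYPE('a) (y (Suc j))))"
      using Am(2) by (intro sum.cong) auto
    finally show "(\<integral>x. norm (gradient \<psi> x) powr s \<partial>lebesgue) \<le>
      (\<Sum>j<N. ((1 + e) * (2 * y j * h / ((y j)\<^sup>2 - (y (Suc j))\<^sup>2))) powr s *
        (ball_vol TYPE('a) (y j) - ball_vol TYPE('a) (y (Suc j))))" unfolding D_def .
  next
    fix q :: real assume q: "q > 0"
    have "(\<Sum>j\<le>N. (h * real j) powr q * indicator (?A j) x) \<le> \<bar>\<psi> x\<bar> powr q" for x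
    proof (rule sum_indicator_disjoint_le[OF _ disj])
      fix j assume j: "j \<in> {..N}" "x \<in> ?A j"
      have "h * real j = (\<Sum>i<j. h * 1)" by simp
      also have "\<dots> = (\<Sum>i<j. h * H (\<tau> i x))"
      proof (intro sum.cong refl, rule arg_cong[of _ _ "(*) h"], rule H(6)[symmetric])
        fix i assume i: "i \<in> {..<j}"
        have "norm (x - x0) \<le> y j" using j by (simp add: annulus_def dist_norm norm_minus_commute)
        also have "y j \<le> y (Suc i)" using anti[of "Suc i" j] i j by simp
        finally have "Q x \<le> (y (Suc i))\<^sup>2" unfolding Qn by (intro power_mono) auto
        then show "1 \<le> \<tau> i x" using Dpos[of i] i j by (simp add: \<tau>_def D_def le_divide_eq)
      qed
      also have "\<dots> \<le> \<psi> x"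
        unfolding \<psi>_def using j h Hnn by (intro sum_mono2) auto
      finally show "(h * real j) powr q \<le> \<bar>\<psi> x\<bar> powr q"
        using q h by (intro powr_mono2) auto
    qed auto
    then have "(\<integral>x. (\<Sum>j\<le>N. (h * real j) powr q * indicator (?A j) x) \<partial>lebesgue) \<le> (\<integral>x. \<bar>\<psi> x\<bar> powr q \<partial>lebesgue)"
      using Am(1) q by (intro integral_mono int\<psi> integral_sum_indicator(1)) auto
    moreover have "(\<integral>x. (\<Sum>j\<le>N. (h * real j) powr q * indicator (?A j) x) \<partial>lebesgue) = (\<Sum>j\<le>N. (h * real j) powr q * measure lebesgue (?A j))"
      using Am(1) by (intro integral_sum_indicator(2)) auto
    moreover have "\<dots> = (\<Sum>j\<le>N. (h * real j) powr q * (ball_vol TYPE('a) (y j) - ball_vol TYPE('a) (y (Suc j))))"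
      using Am(2) by (intro sum.cong) auto
    ultimately show "(\<integral>x. \<bar>\<psi> x\<bar> powr q \<partial>lebesgue) \<ge>
      (\<Sum>j\<le>N. (h * real j) powr q * (ball_vol TYPE('a) (y j) - ball_vol TYPE('a) (y (Suc j))))" by linarith
  qed
qed

text \<open>The tangent of t^s at \<open>S\<close> lies below the graph. The bound is linear in
  \<open>t\<close>, so integrating it calls for the first power of the gradient only.\<close>

lemma Young_powr:
  fixes s t S :: real
  assumes "s > 1" "t \<ge> 0" "S \<ge> 0"
  shows "s * S powr (s - 1) * t - (s - 1) * S powr s \<le> t powr s"
proof -
  define q where "q = s / (s - 1)"
  have q: "q > 1" "1 / s + 1 / q = 1" using assms(1) by (auto simp: q_def field_simps)
  have "t * S powr (s - 1) \<le> t powr s / s + (S powr (s - 1)) powr q / q"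
    using Youngs_inequality[OF assms(1) q(1,2), of t "S powr (s - 1)"] assms by simp
  also have "(S powr (s - 1)) powr q = S powr s" using assms(1) by (simp add: powr_powr q_def)
  finally have "s * (t * S powr (s - 1)) \<le> s * (t powr s / s + S powr s / q)"
    using assms(1) by (intro mult_left_mono) auto
  also have "\<dots> = t powr s + (s - 1) * S powr s"
    using assms(1) by (simp add: q_def field_simps)
  finally show ?thesis by (simp add: mult_ac)
qed

lemma power_diff_le:
  fixes x y :: real
  assumes "0 \<le> x" "x \<le> y"
  shows "y ^ n - x ^ n \<le> real n * y ^ (n - 1) * (y - x)"
proof (cases n)
  case (Suc m)
  have "y ^ n - x ^ n = (y - x) * (\<Sum>i<n. y ^ i * x ^ (m - i))"
    unfolding Suc using power_diff_sumr2[of y "Suc m" x] by (simp add: mult.commute)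
  also have "\<dots> \<le> (y - x) * (\<Sum>i<n. y ^ m)"
  proof (intro mult_left_mono sum_mono)
    fix i assume "i \<in> {..<n}"
    then have "y ^ i * y ^ (m - i) = y ^ m" unfolding Suc by (simp add: power_add[symmetric])
    moreover have "y ^ i * x ^ (m - i) \<le> y ^ i * y ^ (m - i)"
      using assms by (intro mult_left_mono power_mono) auto
    ultimately show "y ^ i * x ^ (m - i) \<le> y ^ m" by simp
  qed (use assms in auto)
  finally show ?thesis by (simp add: Suc mult_ac)
qed simp

text \<open>Bounds the excess of the energy of the radial profile on one annulus; the right-hand side
  telescopes.\<close>

lemma annulus_excess:
  fixes x y h :: real
  assumes xy: "0 \<le> x" "x < y" and n: "n \<ge> 2" and R: "y \<le> R" and h: "h > 0"
  shows "(2 * y * h / (y\<^sup>2 - x\<^sup>2)) * (y ^ n - x ^ n) - h * real n * x ^ (n - 1)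
    \<le> h * real n * ((y - x) * R ^ (n - 2) + (y ^ (n - 1) - x ^ (n - 1)))"
proof -
  have y: "y > 0" "x + y > 0" using xy by auto
  have D: "y\<^sup>2 - x\<^sup>2 = (y - x) * (x + y)" by (simp add: power2_eq_square algebra_simps)
  have "(2 * y * h / (y\<^sup>2 - x\<^sup>2)) * (y ^ n - x ^ n) \<le> (2 * y * h / (y\<^sup>2 - x\<^sup>2)) * (real n * y ^ (n - 1) * (y - x))"
    using xy h y D by (intro mult_left_mono power_diff_le) auto
  \<comment> \<open>The factor 2y/(x + y) is the price of a profile linear in the squared radius
    instead of the radius. It exceeds 1 by at most (y - x)/y, a quantity that can be summed over the
    annuli.\<close>
  also have "\<dots> = (2 * y / (x + y)) * (h * real n * y ^ (n - 1))"
  proof -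
    have "(c * g / (a * b)) * (m * Y * a) = (c / b) * (g * m * Y)" if "a \<noteq> 0" for a b c g m Y :: real
      using that by (simp add: field_simps)
    from this[of "y - x" "2 * y" h "x + y" "real n" "y ^ (n - 1)"] show ?thesis
      unfolding D using xy by simp
  qed
  also have "\<dots> \<le> (1 + (y - x) / y) * (h * real n * y ^ (n - 1))"
  proof (rule mult_right_mono)
    have "2 * y / (x + y) = 1 + (y - x) / (x + y)" using y by (simp add: field_simps)
    also have "\<dots> \<le> 1 + (y - x) / y" using xy y by (intro add_left_mono divide_left_mono) auto
    finally show "2 * y / (x + y) \<le> 1 + (y - x) / y" .
  qed (use h y in auto)
  also have "\<dots> = h * real n * (y ^ (n - 1) + (y - x) * y ^ (n - 2))"
  proof -
    have "y ^ (n - 1) = y * y ^ (n - 2)"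
      using n by (metis Suc_1 Suc_diff_le diff_Suc_Suc power_Suc numeral_2_eq_2)
    then have "(y - x) / y * y ^ (n - 1) = (y - x) * y ^ (n - 2)" using y by simp
    moreover have "(1 + t) * (h * m * Y) = h * m * (Y + t * Y)" for t m Y :: real
      by (simp add: algebra_simps)
    ultimately show ?thesis by metis
  qed
  also have "\<dots> \<le> h * real n * (y ^ (n - 1) + (y - x) * R ^ (n - 2))"
    using xy h R by (intro mult_left_mono add_left_mono power_mono) auto
  finally show ?thesis by (simp add: algebra_simps)
qed

text \<open>Each layer of \<open>v\<close> is exchanged for the annulus between the balls with the
  volumes of its two superlevel sets, and one \<open>\<psi>\<close> serves all exponents. Here
  \<open>h\<close> is the level spacing, \<open>e\<close> the smoothing error of the profile, and
  \<open>\<theta>\<close> the dilation, which costs \<theta>^(-s) in the energy and \<theta>^n in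
  the mass. The excess term is the slope bound \<open>2 * M\<close> to the power s - 1, times
  \<open>s\<close> and \<open>h\<close>, times twice the perimeter of the ball of radius
  \<open>r0\<close>.\<close>

lemma symmetrization_step:
  fixes v :: "'a::euclidean_space \<Rightarrow> real" and x0 :: 'a
  assumes dim: "DIM('a) \<ge> 2" and v: "v \<in> Cc_infinity U"
    and M: "M > 0" "\<And>x y. \<bar>v x - v y\<bar> \<le> M * norm (x - y)"
    and \<delta>: "\<delta> > 0" and ne: "{z. \<delta> \<le> \<bar>v z\<bar>} \<noteq> {}"
    and r0: "r0 \<ge> 0" "ball_vol TYPE('a) r0 = measure lebesgue {z. \<delta> \<le> \<bar>v z\<bar>}"
    and \<theta>: "0 < \<theta>" "\<theta> \<le> 1" "\<theta> * r0 < \<rho>" and h: "h > 0" and e: "e > 0"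
  obtains \<psi> where "\<psi> \<in> Cc_infinity (ball x0 \<rho>)"
    "\<And>s. s > 1 \<Longrightarrow> (\<integral>x. norm (gradient \<psi> x) powr s \<partial>lebesgue) \<le>
      (1 + e) powr s * \<theta> powr (- s) *
      ((\<integral>x. indicator {z. \<delta> \<le> \<bar>v z\<bar>} x * norm (gradient v x) powr s \<partial>lebesgue)
        + s * (2 * M) powr (s - 1) * h * (real DIM('a) * unit_ball_vol (real DIM('a)) * (2 * r0 ^ (DIM('a) - 1))))"
    "\<And>q. q > 0 \<Longrightarrow> \<theta> ^ DIM('a) * (\<integral>x. max 0 (\<bar>v x\<bar> - \<delta> - h) powr q \<partial>lebesgue) \<le> (\<integral>x. \<bar>\<psi> x\<bar> powr q \<partial>lebesgue)"
proof -
  let ?n = "DIM('a)"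
  define w where "w = unit_ball_vol (real ?n)"
  have w: "w > 0" by (simp add: w_def)
  obtain B where B: "B > 0" "\<And>x. \<bar>v x\<bar> \<le> B" using Cc_infinity_Lipschitz[OF v] by metis
  define E where "E j = {z. \<delta> + real j * h \<le> \<bar>v z\<bar>}" for j
  have Elm: "E j \<in> lmeasurable" for j unfolding E_def using \<delta> h by (intro superlevel_lmeasurable[OF v]) (simp add: add_pos_nonneg)
  have Emono: "E j \<subseteq> E i" if "i \<le> j" for i j
  proof -
    have "real i * h \<le> real j * h" using that h by (intro mult_right_mono) auto
    then show ?thesis by (auto simp: E_def)
  qed
  have E0: "E 0 = {z. \<delta> \<le> \<bar>v z\<bar>}" by (simp add: E_def)
  have "\<exists>j. E j = {}"
  proof -
    obtain j where "real j * h > B" using reals_Archimedean3[OF h] by blast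
    then have "\<delta> + real j * h > \<bar>v z\<bar>" for z using B(2)[of z] \<delta> by (simp add: add.commute add_strict_increasing)
    then show ?thesis unfolding E_def by (auto simp: not_le intro!: exI[of _ j])
  qed
  \<comment> \<open>The last index with a nonempty superlevel set. As \<open>E 0\<close> is
    nonempty, the least empty index is positive and the subtraction is exact.\<close>
  define N where "N = (LEAST j. E j = {}) - 1"
  have N: "E (Suc N) = {}" "E j \<noteq> {}" if "j \<le> N" for j
  proof -
    let ?L = "LEAST j. E j = {}"
    have L: "E ?L = {}" using \<open>\<exists>j. E j = {}\<close> by (rule LeastI_ex)
    then have "?L \<noteq> 0" using ne E0 by metis
    then have "Suc N = ?L" by (simp add: N_def)
    then show "E (Suc N) = {}" using L by simp
    show "E j \<noteq> {}" using not_less_Least[of j "\<lambda>j. E j = {}"] that \<open>Suc N = ?L\<close> by simp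
  qed
  note EN = N(1)[OF order_refl]
  define r where "r j = (SOME r. r \<ge> 0 \<and> ball_vol TYPE('a) r = measure lebesgue (E j))" for j
  have r: "r j \<ge> 0 \<and> ball_vol TYPE('a) (r j) = measure lebesgue (E j)" for j
    unfolding r_def by (rule someI_ex) (metis ball_vol_surj measure_nonneg)
  have rw: "w * r j ^ ?n = measure lebesgue (E j)" for j using r[of j] by (simp add: w_def)
  have rr0: "r 0 = r0"
    using ball_vol_le_iff[of "r 0" r0, where 'a='a] ball_vol_le_iff[of r0 "r 0", where 'a='a] r[of 0] r0 E0
    by (metis order_antisym order_refl)
  have rN: "r (Suc N) = 0"
    using ball_vol_le_iff[of "r (Suc N)" 0, where 'a='a] r[of "Suc N"] EN by (simp add: power_0_left)
  have drop: "r (Suc j) + h / M \<le> r j" if "j < N" for j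
  proof -
    have "r (Suc j) + ((\<delta> + real (Suc j) * h) - (\<delta> + real j * h)) / M \<le> r j"
    proof (rule layer_radius_bound[OF v M])
      show "{z. \<delta> + real (Suc j) * h \<le> \<bar>v z\<bar>} \<noteq> {}" using N(2)[of "Suc j"] that by (simp add: E_def)
    qed (use \<delta> h r in \<open>auto simp: E_def add_pos_nonneg algebra_simps\<close>)
    then show ?thesis by (simp add: algebra_simps)
  qed
  have hM: "h / M > 0" using h M by simp
  have dec: "r (Suc j) < r j" if "j < N" for j using drop[OF that] hM by linarith
  have rle: "r j \<le> r0" if "j \<le> N" for j
    using that
  proof (induction j)
    case (Suc j)
    then show ?case using dec[of j] by simp
  qed (simp add: rr0)
  \<comment> \<open>Shrinking by \<open>\<theta>\<close> fits the profile into the ball of radius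
    \<open>\<rho>\<close>: slopes grow by the factor 1/\<theta>, volumes shrink by
    \<theta>^n.\<close>
  define y where "y j = \<theta> * r j" for j
  have y1: "y (Suc j) < y j" if "j < N" for j using dec[OF that] \<theta> by (simp add: y_def)
  have y2: "y (Suc N) = 0" "y N \<ge> 0" "y 0 < \<rho>" using rN r[of N] \<theta> rr0 by (auto simp: y_def)
  obtain \<psi> where \<psi>: "\<psi> \<in> Cc_infinity (ball x0 \<rho>)"
    "\<And>s. s > 0 \<Longrightarrow> (\<integral>x. norm (gradient \<psi> x) powr s \<partial>lebesgue) \<le>
      (\<Sum>j<N. ((1 + e) * (2 * y j * h / ((y j)\<^sup>2 - (y (Suc j))\<^sup>2))) powr s *
        (ball_vol TYPE('a) (y j) - ball_vol TYPE('a) (y (Suc j))))"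
    "\<And>q. q > 0 \<Longrightarrow> (\<integral>x. \<bar>\<psi> x\<bar> powr q \<partial>lebesgue) \<ge>
      (\<Sum>j\<le>N. (h * real j) powr q * (ball_vol TYPE('a) (y j) - ball_vol TYPE('a) (y (Suc j))))"
    by (rule radial_profile[OF y1 y2 h e, of x0], assumption, rule that) blast+
  define A where "A j = E j - E (Suc j)" for j
  have Alm: "A j \<in> lmeasurable" for j unfolding A_def by (intro fmeasurable.Diff Elm)
  have mA: "measure lebesgue (A j) = w * r j ^ ?n - w * r (Suc j) ^ ?n" for j
    unfolding A_def rw using Elm Emono[of j "Suc j"] by (intro measurable_measure_Diff fmeasurableD) auto
  have Adisj: "disjoint_family_on A I" for I
  proof -
    have *: "A i \<inter> A j = {}" if "i < j" for i j
      using Emono[of "Suc i" j] that by (auto simp: A_def)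
    show ?thesis unfolding disjoint_family_on_def
    proof (intro ballI impI)
      fix i j :: nat assume "i \<noteq> j"
      then show "A i \<inter> A j = {}" using *[of i j] *[of j i] by (cases "i < j") auto
    qed
  qed
  have Aeq: "A j = {z. \<delta> + real j * h \<le> \<bar>v z\<bar> \<and> \<bar>v z\<bar> < \<delta> + real (Suc j) * h}" for j
    by (auto simp: A_def E_def)
  have bv: "ball_vol TYPE('a) (y j) - ball_vol TYPE('a) (y (Suc j)) = \<theta> ^ ?n * measure lebesgue (A j)" for j
    unfolding mA by (simp add: y_def w_def power_mult_distrib algebra_simps)
  \<comment> \<open>The slope bound of the undilated profile on the annulus \<open>j\<close>, before
    smoothing. It is at most \<open>2 * M\<close>, because \<open>r j\<close> is at most the sum of
    the two radii and the radii differ by at least \<open>h / M\<close>.\<close>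
  define S where "S j = 2 * r j * h / ((r j)\<^sup>2 - (r (Suc j))\<^sup>2)" for j
  have S: "0 \<le> S j" "S j \<le> 2 * M" if "j < N" for j
  proof -
    have D: "(r j)\<^sup>2 - (r (Suc j))\<^sup>2 = (r j - r (Suc j)) * (r (Suc j) + r j)" by (simp add: power2_eq_square algebra_simps)
    have rj: "r j > 0" "r (Suc j) \<ge> 0" using dec[OF that] r[of "Suc j"] by auto
    have Dp: "(r j)\<^sup>2 - (r (Suc j))\<^sup>2 > 0" unfolding D using dec[OF that] rj by (intro mult_pos_pos) auto
    then show "0 \<le> S j" unfolding S_def using rj(1) h by (intro divide_nonneg_pos mult_nonneg_nonneg) auto
    have "h \<le> M * (r j - r (Suc j))" using drop[OF that] M(1) by (simp add: field_simps)
    then have "r j * h \<le> (r (Suc j) + r j) * (M * (r j - r (Suc j)))"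
      using rj h by (intro mult_mono) auto
    then have "2 * r j * h \<le> 2 * M * ((r j)\<^sup>2 - (r (Suc j))\<^sup>2)" unfolding D by (simp add: mult_ac)
    then show "S j \<le> 2 * M" unfolding S_def using Dp by (simp add: pos_divide_le_eq)
  qed
  show ?thesis
  proof (rule that[OF \<psi>(1)])
    fix s :: real assume s: "s > 1"
    let ?G = "\<lambda>x. norm (gradient v x) powr s"
    have Gi: "integrable lebesgue ?G"
      using Lp_Cc_infinity(4)[OF subsetD[OF Cc_infinity_mono[OF subset_UNIV] v] open_UNIV, of s] s by simp
    have gi: "integrable lebesgue (\<lambda>x. norm (gradient v x))"
      using integrable_Cc_infinity(2)[OF v] by simp
    have ind: "integrable lebesgue (\<lambda>x. indicator X x * f x)" if "integrable lebesgue f" "X \<in> lmeasurable" for f :: "'a \<Rightarrow> real" and X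
      using integrable_mult_indicator[OF fmeasurableD[OF that(2)] that(1)] by simp
    let ?c = "s * (2 * M) powr (s - 1) * h * (real ?n * w)"
    let ?b = "\<lambda>j. (r j - r (Suc j)) * r0 ^ (?n - 2) + (r j ^ (?n - 1) - r (Suc j) ^ (?n - 1))"
    have layer: "S j powr s * measure lebesgue (A j) \<le> (\<integral>x. indicator (A j) x * ?G x \<partial>lebesgue) + ?c * ?b j"
      if j: "j < N" for j
    proof -
      note Sj = S[OF j]
      have b0: "0 \<le> ?b j" using dec[OF j] r[of "Suc j"] r0 by (intro add_nonneg_nonneg mult_nonneg_nonneg) (auto intro!: power_mono)
      have "((\<delta> + real (Suc j) * h) - (\<delta> + real j * h)) * (real ?n * unit_ball_vol (real ?n) * r (Suc j) ^ (?n - 1))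
          \<le> (\<integral>x. indicator {z. \<delta> + real j * h \<le> \<bar>v z\<bar> \<and> \<bar>v z\<bar> < \<delta> + real (Suc j) * h} x * norm (gradient v x) \<partial>lebesgue)"
      proof (rule layer_gradient_bound[OF v])
        show "{z. \<delta> + real (Suc j) * h \<le> \<bar>v z\<bar>} \<noteq> {}" using N(2)[of "Suc j"] j by (simp add: E_def)
        show "ball_vol TYPE('a) (r (Suc j)) \<le> measure lebesgue {z. \<delta> + real (Suc j) * h \<le> \<bar>v z\<bar>}"
          using r[of "Suc j"] by (simp add: E_def)
      qed (use \<delta> h r[of "Suc j"] in \<open>auto simp: add_pos_nonneg algebra_simps\<close>)
      then have lg: "h * (real ?n * w * r (Suc j) ^ (?n - 1)) \<le> (\<integral>x. indicator (A j) x * norm (gradient v x) \<partial>lebesgue)"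
        unfolding Aeq w_def by (simp add: algebra_simps)
      \<comment> \<open>Young's inequality, integrated over the layer with the slope of the
        competitor as point of tangency: nothing would be lost if the gradient of \<open>v\<close>
        had the norm \<open>S j\<close> throughout.\<close>
      have "s * S j powr (s - 1) * (\<integral>x. indicator (A j) x * norm (gradient v x) \<partial>lebesgue) - (s - 1) * S j powr s * measure lebesgue (A j)
          = (\<integral>x. s * S j powr (s - 1) * (indicator (A j) x * norm (gradient v x)) - (s - 1) * S j powr s * indicator (A j) x \<partial>lebesgue)"
        using ind[OF gi Alm[of j]] integral_sum_indicator[of "{j}" A "\<lambda>_. 1"] Alm by simp
      also have "\<dots> \<le> (\<integral>x. indicator (A j) x * ?G x \<partial>lebesgue)"
      proof (rule integral_mono)
        show "integrable lebesgue (\<lambda>x. s * S j powr (s - 1) * (indicator (A j) x * norm (gradient v x)) - (s - 1) * S j powr s * indicator (A j) x)"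
          using ind[OF gi Alm[of j]] integral_sum_indicator(1)[of "{j}" A "\<lambda>_. 1"] Alm by simp
        show "integrable lebesgue (\<lambda>x. indicator (A j) x * ?G x)" by (rule ind[OF Gi Alm])
        show "s * S j powr (s - 1) * (indicator (A j) x * norm (gradient v x)) - (s - 1) * S j powr s * indicator (A j) x
            \<le> indicator (A j) x * ?G x" for x
          using Young_powr[OF s norm_ge_zero Sj(1), of "gradient v x"] by (simp add: indicator_def)
      qed
      finally have yg: "s * S j powr (s - 1) * (\<integral>x. indicator (A j) x * norm (gradient v x) \<partial>lebesgue) - (s - 1) * S j powr s * measure lebesgue (A j)
          \<le> (\<integral>x. indicator (A j) x * ?G x \<partial>lebesgue)" .
      have "s * S j powr (s - 1) * (h * (real ?n * w * r (Suc j) ^ (?n - 1)))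
          \<le> s * S j powr (s - 1) * (\<integral>x. indicator (A j) x * norm (gradient v x) \<partial>lebesgue)"
        using s by (intro mult_left_mono lg) simp
      with yg have "s * S j powr (s - 1) * (h * (real ?n * w * r (Suc j) ^ (?n - 1))) - (s - 1) * S j powr s * measure lebesgue (A j)
          \<le> (\<integral>x. indicator (A j) x * ?G x \<partial>lebesgue)" by linarith
      \<comment> \<open>The energy of the competitor on the annulus enters here with the factor
        \<open>s\<close> and in the previous inequality with \<open>- (s - 1)\<close>; adding the
        two leaves exactly one copy.\<close>
      moreover have "s * (S j powr s * measure lebesgue (A j)) - s * S j powr (s - 1) * (h * (real ?n * w * r (Suc j) ^ (?n - 1))) \<le> ?c * ?b j"
      proof -
        have "S j powr s = S j powr (s - 1) * S j"
          using Sj(1) by (cases "S j = 0") (auto simp: powr_mult_base' powr_diff)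
        then have "s * (S j powr s * measure lebesgue (A j)) - s * S j powr (s - 1) * (h * (real ?n * w * r (Suc j) ^ (?n - 1)))
            = s * S j powr (s - 1) * w * (S j * (r j ^ ?n - r (Suc j) ^ ?n) - h * real ?n * r (Suc j) ^ (?n - 1))"
          unfolding mA by (simp add: algebra_simps)
        also have "\<dots> \<le> s * S j powr (s - 1) * w * (h * real ?n * ?b j)"
          unfolding S_def using s w dec[OF j] r[of "Suc j"] rle[of j] j h dim
          by (intro mult_left_mono annulus_excess) auto
        also have "\<dots> \<le> s * (2 * M) powr (s - 1) * w * (h * real ?n * ?b j)"
          using Sj s w b0 h by (intro mult_right_mono mult_left_mono powr_mono2) auto
        finally show ?thesis by (simp add: mult_ac)
      qed
      ultimately show ?thesis by (simp add: algebra_simps)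
    qed
    have c0: "?c \<ge> 0" using s h w M by simp
    \<comment> \<open>Both parts of \<open>?b\<close> telescope, each contributing at most
      \<open>r0 ^ (?n - 1)\<close>; dimension at least 2 makes \<open>?n - 2\<close> a true
      subtraction.\<close>
    have tel: "(\<Sum>j<N. ?b j) \<le> 2 * r0 ^ (?n - 1)"
    proof -
      have "(\<Sum>j<N. ?b j) = (\<Sum>j<N. r j - r (Suc j)) * r0 ^ (?n - 2) + (\<Sum>j<N. r j ^ (?n - 1) - r (Suc j) ^ (?n - 1))"
        by (simp add: sum.distrib sum_distrib_right)
      also have "\<dots> = (r 0 - r N) * r0 ^ (?n - 2) + (r 0 ^ (?n - 1) - r N ^ (?n - 1))"
        by (simp only: sum_lessThan_telescope' sum_lessThan_telescope'[of "\<lambda>j. r j ^ (?n - 1)"])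
      also have "\<dots> \<le> r0 * r0 ^ (?n - 2) + r0 ^ (?n - 1)"
        using r[of N] r0 by (intro add_mono mult_right_mono) (auto simp: rr0)
      also have "r0 * r0 ^ (?n - 2) = r0 ^ (?n - 1)"
        using dim by (metis Suc_1 Suc_diff_le diff_Suc_Suc power_Suc numeral_2_eq_2)
      finally show ?thesis by simp
    qed
    let ?I = "\<integral>x. indicator {z. \<delta> \<le> \<bar>v z\<bar>} x * ?G x \<partial>lebesgue"
    have sumG: "(\<Sum>j<N. \<integral>x. indicator (A j) x * ?G x \<partial>lebesgue) \<le> ?I"
    proof -
      have "(\<Sum>j<N. \<integral>x. indicator (A j) x * ?G x \<partial>lebesgue) = (\<integral>x. (\<Sum>j<N. indicator (A j) x * ?G x) \<partial>lebesgue)"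
        by (intro Bochner_Integration.integral_sum[symmetric] ind[OF Gi Alm])
      also have "\<dots> \<le> ?I"
      proof (rule integral_mono)
        show "integrable lebesgue (\<lambda>x. \<Sum>j<N. indicator (A j) x * ?G x)"
          by (intro Bochner_Integration.integrable_sum ind[OF Gi Alm])
        show "integrable lebesgue (\<lambda>x. indicator {z. \<delta> \<le> \<bar>v z\<bar>} x * ?G x)"
          using ind[OF Gi Elm[of 0]] unfolding E0 .
        fix x
        have "(\<Sum>j<N. ?G x * indicator (A j) x) \<le> indicator {z. \<delta> \<le> \<bar>v z\<bar>} x * ?G x"
          using Emono[of 0] E0 by (intro sum_indicator_disjoint_le[OF _ Adisj]) (auto simp: A_def indicator_def)
        then show "(\<Sum>j<N. indicator (A j) x * ?G x) \<le> indicator {z. \<delta> \<le> \<bar>v z\<bar>} x * ?G x"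
          by (simp add: mult.commute)
      qed
      finally show ?thesis .
    qed
    have main: "(\<Sum>j<N. S j powr s * measure lebesgue (A j)) \<le> ?I + ?c * (2 * r0 ^ (?n - 1))"
    proof -
      have "(\<Sum>j<N. S j powr s * measure lebesgue (A j)) \<le> (\<Sum>j<N. (\<integral>x. indicator (A j) x * ?G x \<partial>lebesgue) + ?c * ?b j)"
        using layer by (intro sum_mono) auto
      also have "\<dots> = (\<Sum>j<N. \<integral>x. indicator (A j) x * ?G x \<partial>lebesgue) + ?c * (\<Sum>j<N. ?b j)"
        by (subst sum.distrib) (simp only: sum_distrib_left)
      also have "\<dots> \<le> ?I + ?c * (2 * r0 ^ (?n - 1))"
        using tel c0 sumG by (intro add_mono mult_left_mono)
      finally show ?thesis .
    qed
    have "(\<integral>x. norm (gradient \<psi> x) powr s \<partial>lebesgue) \<le>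
        (\<Sum>j<N. ((1 + e) * (2 * y j * h / ((y j)\<^sup>2 - (y (Suc j))\<^sup>2))) powr s * (\<theta> ^ ?n * measure lebesgue (A j)))"
      using \<psi>(2)[of s] s unfolding bv by simp
    also have "\<dots> \<le> (\<Sum>j<N. (1 + e) powr s * \<theta> powr (- s) * (S j powr s * measure lebesgue (A j)))"
    proof (rule sum_mono)
      fix j assume j: "j \<in> {..<N}"
      have "2 * y j * h / ((y j)\<^sup>2 - (y (Suc j))\<^sup>2) = S j / \<theta>"
      proof -
        have "(y j)\<^sup>2 - (y (Suc j))\<^sup>2 = \<theta> * (\<theta> * ((r j)\<^sup>2 - (r (Suc j))\<^sup>2))"
          by (simp add: y_def power2_eq_square algebra_simps)
        then show ?thesis using \<theta>(1) by (simp add: y_def S_def mult_ac)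
      qed
      then have "((1 + e) * (2 * y j * h / ((y j)\<^sup>2 - (y (Suc j))\<^sup>2))) powr s = (1 + e) powr s * \<theta> powr (- s) * S j powr s"
        using \<theta>(1) e S(1)[of j] j by (simp add: powr_mult powr_divide powr_minus_divide)
      moreover have "\<theta> ^ ?n * measure lebesgue (A j) \<le> measure lebesgue (A j)"
        using \<theta> by (intro mult_left_le_one_le power_le_one) auto
      ultimately show "((1 + e) * (2 * y j * h / ((y j)\<^sup>2 - (y (Suc j))\<^sup>2))) powr s * (\<theta> ^ ?n * measure lebesgue (A j))
          \<le> (1 + e) powr s * \<theta> powr (- s) * (S j powr s * measure lebesgue (A j))"
        by (simp add: mult.assoc mult_left_mono)
    qed
    also have "\<dots> = (1 + e) powr s * \<theta> powr (- s) * (\<Sum>j<N. S j powr s * measure lebesgue (A j))"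
      by (simp add: sum_distrib_left)
    also have "\<dots> \<le> (1 + e) powr s * \<theta> powr (- s) * (?I + ?c * (2 * r0 ^ (?n - 1)))"
      using main by (intro mult_left_mono) auto
    finally show "(\<integral>x. norm (gradient \<psi> x) powr s \<partial>lebesgue) \<le>
      (1 + e) powr s * \<theta> powr (- s) *
      (?I + s * (2 * M) powr (s - 1) * h * (real DIM('a) * unit_ball_vol (real DIM('a)) * (2 * r0 ^ (DIM('a) - 1))))"
      by (simp add: w_def mult.assoc)
  next
    fix q :: real assume q: "q > 0"
    have "(\<integral>x. max 0 (\<bar>v x\<bar> - \<delta> - h) powr q \<partial>lebesgue) \<le> (\<integral>x. (\<Sum>j\<le>N. (h * real j) powr q * indicator (A j) x) \<partial>lebesgue)"
    proof (rule integral_mono)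
      show "integrable lebesgue (\<lambda>x. \<Sum>j\<le>N. (h * real j) powr q * indicator (A j) x)"
        using Alm by (intro integral_sum_indicator(1)) auto
      show "integrable lebesgue (\<lambda>x. max 0 (\<bar>v x\<bar> - \<delta> - h) powr q)"
        using integrable_truncated_Cc_infinity[OF v _ q, of "\<delta> + h"] \<delta> h by (simp add: diff_diff_eq)
      fix x
      show "max 0 (\<bar>v x\<bar> - \<delta> - h) powr q \<le> (\<Sum>j\<le>N. (h * real j) powr q * indicator (A j) x)"
      proof (cases "\<bar>v x\<bar> \<le> \<delta> + h")
        case False
        \<comment> \<open>The highest level reached at \<open>x\<close>. The modulus of
          \<open>v\<close> exceeds \<delta> there by less than (j + 1) h, while the profile
          guarantees only j h; this accounts for the loss of \<open>h\<close> in the claim.\<close>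
        define j where "j = Max {j. j \<le> N \<and> x \<in> E j}"
        have fin: "finite {j. j \<le> N \<and> x \<in> E j}" by simp
        have "x \<in> E 0" using False h by (simp add: E_def)
        then have nemp: "{j. j \<le> N \<and> x \<in> E j} \<noteq> {}" by auto
        have j: "j \<le> N" "x \<in> E j" using Max_in[OF fin nemp] by (auto simp: j_def)
        have "x \<notin> E (Suc j)"
        proof
          assume a: "x \<in> E (Suc j)"
          show False
          proof (cases "j = N")
            case True
            then show False using a EN by simp
          next
            case False
            then have "Suc j \<le> j" using Max_ge[OF fin, of "Suc j"] a j(1) by (simp add: j_def)
            then show False by simp
          qed
        qed
        then have "\<bar>v x\<bar> - \<delta> - h \<le> h * real j" "x \<in> A j" using j(2) by (auto simp: E_def A_def algebra_simps)
        then have "max 0 (\<bar>v x\<bar> - \<delta> - h) powr q \<le> (h * real j) powr q * indicator (A j) x"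
          using q h by (auto intro!: powr_mono2)
        also have "\<dots> \<le> (\<Sum>j\<le>N. (h * real j) powr q * indicator (A j) x)"
          using j by (intro member_le_sum) auto
        finally show ?thesis .
      next
        case True
        then have "max 0 (\<bar>v x\<bar> - \<delta> - h) = 0" by simp
        then show ?thesis using q by (simp add: sum_nonneg)
      qed
    qed
    also have "\<dots> = (\<Sum>j\<le>N. (h * real j) powr q * measure lebesgue (A j))"
      using Alm by (intro integral_sum_indicator(2)) auto
    finally have "\<theta> ^ ?n * (\<integral>x. max 0 (\<bar>v x\<bar> - \<delta> - h) powr q \<partial>lebesgue)
        \<le> \<theta> ^ ?n * (\<Sum>j\<le>N. (h * real j) powr q * measure lebesgue (A j))"
      using \<theta> by (intro mult_left_mono) auto
    also have "\<dots> = (\<Sum>j\<le>N. (h * real j) powr q * (ball_vol TYPE('a) (y j) - ball_vol TYPE('a) (y (Suc j))))"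
      unfolding bv by (simp add: sum_distrib_left mult_ac)
    also have "\<dots> \<le> (\<integral>x. \<bar>\<psi> x\<bar> powr q \<partial>lebesgue)" using \<psi>(3)[OF q] .
    finally show "\<theta> ^ ?n * (\<integral>x. max 0 (\<bar>v x\<bar> - \<delta> - h) powr q \<partial>lebesgue) \<le> (\<integral>x. \<bar>\<psi> x\<bar> powr q \<partial>lebesgue)" .
  qed
qed

section \<open>Capacity and measure\<close>

text \<open>Integration by parts of \<open>\<phi>\<close> squared against a linear function
  \<open>l\<close> with unit gradient and modulus at most \<open>S\<close> on the ball. The mixed
  term is at most half of the left-hand side plus 2 S^2 times the energy; absorbing the half gives
  the constant 4 S^2.\<close>

lemma poincare_ball:
  fixes \<phi> :: "'a::euclidean_space \<Rightarrow> real"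
  assumes p: "\<phi> \<in> Cc_infinity (ball y0 S)" and S: "S > 0"
  shows "(\<integral>x. (\<phi> x)\<^sup>2 \<partial>lebesgue) \<le> 4 * S\<^sup>2 * (\<integral>x. (norm (gradient \<phi> x))\<^sup>2 \<partial>lebesgue)"
proof -
  obtain e :: 'a where e: "e \<in> Basis" using nonempty_Basis by blast
  obtain C where C: "compact C" "C \<subseteq> ball y0 S" "\<And>x. x \<notin> C \<Longrightarrow> \<phi> x = 0" "\<And>x. x \<notin> C \<Longrightarrow> gradient \<phi> x = 0"
    using Cc_infinity_support[OF p] by metis
  note c = Cc_infinity_gradient[OF p]
  define l where "l = (\<lambda>x. (x - y0) \<bullet> e)"
  have Ckl: "Ck k l" for k
    using Ck_diff[OF Ck_inner[of k e] Ck_const[of k "y0 \<bullet> e"]] by (simp add: l_def inner_diff_left)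
  have gl: "gradient l x = e" for x
    unfolding l_def by (intro gradient_eqI) (auto simp: gderiv_def intro!: derivative_eq_intros)
  define f where "f = (\<lambda>x. \<phi> x * \<phi> x)"
  have f: "f \<in> Cc_infinity (ball y0 S)" "gradient f x = (2 * \<phi> x) *\<^sub>R gradient \<phi> x" for x
    unfolding f_def using Cc_infinity_mult[OF p Cc_infinity_Ck[OF p]] by (auto simp: scaleR_left_distrib[symmetric])
  have fi: "integrable lebesgue f" by (rule integrable_Cc_infinity[OF f(1)])
  have i2: "integrable lebesgue (\<lambda>x. (norm (gradient \<phi> x))\<^sup>2)"
    using c C by (intro integrable_continuous_compact_support(2)[OF _ C(1)] continuous_intros) auto
  have il: "integrable lebesgue (\<lambda>x. l x *\<^sub>R gradient f x)"
    using Cc_infinity_gradient[OF f(1)] C Ckl[of 0]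
    by (intro integrable_continuous_compact_support(2)[OF _ C(1)] continuous_intros) (auto simp: f(2))
  have "(\<integral>x. f x \<partial>lebesgue) = norm (\<integral>x. f x *\<^sub>R e \<partial>lebesgue)"
    using e fi by (simp add: f_def)
  also have "(\<integral>x. f x *\<^sub>R e \<partial>lebesgue) = - (\<integral>x. l x *\<^sub>R gradient f x \<partial>lebesgue)"
    using integration_by_parts_Cc_infinity[OF f(1) Ckl] by (simp add: gl)
  also have "norm \<dots> \<le> (\<integral>x. norm (l x *\<^sub>R gradient f x) \<partial>lebesgue)"
    unfolding norm_minus_cancel by (rule integral_norm_bound)
  also have "\<dots> \<le> (\<integral>x. 1 / 2 * f x + 2 * S\<^sup>2 * (norm (gradient \<phi> x))\<^sup>2 \<partial>lebesgue)"
  proof (rule integral_mono)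
    fix x
    show "norm (l x *\<^sub>R gradient f x) \<le> 1 / 2 * f x + 2 * S\<^sup>2 * (norm (gradient \<phi> x))\<^sup>2"
    proof (cases "x \<in> C")
      case True
      then have "norm (x - y0) \<le> S" using C(2) by (auto simp: dist_norm norm_minus_commute less_imp_le)
      then have "\<bar>l x\<bar> \<le> S" using Basis_le_norm[OF e, of "x - y0"] by (simp add: l_def)
      then have "norm (l x *\<^sub>R gradient f x) \<le> S * (2 * \<bar>\<phi> x\<bar> * norm (gradient \<phi> x))"
        by (simp add: f(2) abs_mult mult_right_mono)
      also have "\<dots> = 2 * (\<bar>\<phi> x\<bar> * (S * norm (gradient \<phi> x)))" by simp
      also have "\<dots> \<le> 1 / 2 * f x + 2 * S\<^sup>2 * (norm (gradient \<phi> x))\<^sup>2"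
      proof -
        have "0 \<le> (\<bar>\<phi> x\<bar> - 2 * (S * norm (gradient \<phi> x)))\<^sup>2" by simp
        also have "\<dots> = f x - 4 * (\<bar>\<phi> x\<bar> * (S * norm (gradient \<phi> x))) + 4 * (S\<^sup>2 * (norm (gradient \<phi> x))\<^sup>2)"
          by (simp add: f_def power2_eq_square algebra_simps)
        finally show ?thesis by simp
      qed
      finally show ?thesis .
    next
      case False
      then have "\<phi> x = 0" "gradient \<phi> x = 0" using C(3,4) by blast+
      moreover from this have "gradient f x = 0" using f(2)[of x] by simp
      moreover have "f x = 0" using \<open>\<phi> x = 0\<close> by (simp add: f_def)
      ultimately show ?thesis by simp
    qed
    show "integrable lebesgue (\<lambda>x. norm (l x *\<^sub>R gradient f x))" using il by (rule integrable_norm)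
    show "integrable lebesgue (\<lambda>x. 1 / 2 * f x + 2 * S\<^sup>2 * (norm (gradient \<phi> x))\<^sup>2)"
      using fi i2 by simp
  qed
  also have "\<dots> = 1 / 2 * (\<integral>x. f x \<partial>lebesgue) + 2 * S\<^sup>2 * (\<integral>x. (norm (gradient \<phi> x))\<^sup>2 \<partial>lebesgue)"
    using fi i2 by simp
  finally show ?thesis by (simp add: f_def power2_eq_square)
qed

text \<open>For \<open>a\<close> below \<open>\<eta>\<close> the first term suffices, above it the
  second. The point is that the constant term can be made small at the expense of the factor of the
  higher power.\<close>

lemma powr_interpolate:
  fixes a \<eta> :: real
  assumes "a \<ge> 0" "\<eta> > 0" "s \<le> p" "s > 0"
  shows "a powr s \<le> \<eta> powr s + \<eta> powr (s - p) * a powr p"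
proof (cases "a \<le> \<eta>")
  case True
  then have "a powr s \<le> \<eta> powr s" using assms by (intro powr_mono2) auto
  then show ?thesis by (simp add: add_increasing2)
next
  case False
  then have "a powr (s - p) \<le> \<eta> powr (s - p)" using assms by (intro powr_mono2') auto
  then have "a powr (s - p) * a powr p \<le> \<eta> powr (s - p) * a powr p" by (rule mult_right_mono) simp
  then show ?thesis by (simp add: powr_add[symmetric] add_increasing)
qed

text \<open>As \<open>\<phi>\<close> is at least 1 on \<open>K\<close>, the measure of
  \<open>K\<close> is at most the integral of its square. The Poincare inequality leads to the
  gradient at exponent 2, and interpolation from there to \<open>p\<close>, where the capacity
  lives.\<close>

lemma measure_compact_le_energy:
  fixes \<phi> :: "'a::euclidean_space \<Rightarrow> real"
  assumes p: "p > 2" and ph: "\<phi> \<in> Cc_infinity (ball y0 S)" and S: "S > 0" and \<eta>: "\<eta> > 0"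
    and K: "compact K" "\<And>x. x \<in> K \<Longrightarrow> 1 \<le> \<phi> x"
  shows "measure lebesgue K \<le> 4 * S\<^sup>2 * (\<eta> powr 2 * measure lebesgue (ball y0 S)
     + \<eta> powr (2 - p) * (\<integral>x. norm (gradient \<phi> x) powr p \<partial>lebesgue_on (ball y0 S)))"
proof -
  let ?B = "ball y0 S"
  obtain C where C: "compact C" "C \<subseteq> ?B" "\<And>x. x \<notin> C \<Longrightarrow> \<phi> x = 0" "\<And>x. x \<notin> C \<Longrightarrow> gradient \<phi> x = 0"
    using Cc_infinity_support[OF ph] by metis
  note c = Cc_infinity_gradient[OF ph]
  have i\<phi>: "integrable lebesgue (\<lambda>x. (\<phi> x)\<^sup>2)"
    using c C by (intro integrable_continuous_compact_support(2)[OF _ C(1)] continuous_intros) auto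
  have i2: "integrable lebesgue (\<lambda>x. (norm (gradient \<phi> x))\<^sup>2)"
    using c C by (intro integrable_continuous_compact_support(2)[OF _ C(1)] continuous_intros) auto
  have ip: "integrable lebesgue (\<lambda>x. norm (gradient \<phi> x) powr p)"
    using Lp_Cc_infinity(4)[OF ph open_ball] p by simp
  have iB: "integrable lebesgue (indicat_real ?B)" and iK: "integrable lebesgue (indicat_real K)"
    using K(1) by (auto intro: integrable_indicator_lmeasurable lmeasurable_compact)
  have "measure lebesgue K = (\<integral>x. indicat_real K x \<partial>lebesgue)" by simp
  also have "\<dots> \<le> (\<integral>x. (\<phi> x)\<^sup>2 \<partial>lebesgue)"
  proof (rule integral_mono[OF iK i\<phi>])
    show "indicat_real K x \<le> (\<phi> x)\<^sup>2" for x
      using K(2)[of x] by (cases "x \<in> K") (simp_all add: one_le_power)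
  qed
  also have "\<dots> \<le> 4 * S\<^sup>2 * (\<integral>x. (norm (gradient \<phi> x))\<^sup>2 \<partial>lebesgue)" by (rule poincare_ball[OF ph S])
  also have "(\<integral>x. (norm (gradient \<phi> x))\<^sup>2 \<partial>lebesgue)
      \<le> (\<integral>x. \<eta> powr 2 * indicat_real ?B x + \<eta> powr (2 - p) * norm (gradient \<phi> x) powr p \<partial>lebesgue)"
  proof (rule integral_mono[OF i2])
    show "integrable lebesgue (\<lambda>x. \<eta> powr 2 * indicat_real ?B x + \<eta> powr (2 - p) * norm (gradient \<phi> x) powr p)"
      using ip iB by simp
    fix x
    show "(norm (gradient \<phi> x))\<^sup>2 \<le> \<eta> powr 2 * indicat_real ?B x + \<eta> powr (2 - p) * norm (gradient \<phi> x) powr p"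
    proof (cases "x \<in> ?B")
      case True
      then show ?thesis using powr_interpolate[of "norm (gradient \<phi> x)" \<eta> 2 p] \<eta> p by simp
    next
      case False
      then have "gradient \<phi> x = 0" using C(2,4) by blast
      then show ?thesis by simp
    qed
  qed
  also have "\<dots> = \<eta> powr 2 * measure lebesgue ?B + \<eta> powr (2 - p) * (\<integral>x. norm (gradient \<phi> x) powr p \<partial>lebesgue)"
    using ip iB by simp
  also have "(\<integral>x. norm (gradient \<phi> x) powr p \<partial>lebesgue) = (\<integral>x. norm (gradient \<phi> x) powr p \<partial>lebesgue_on ?B)"
  proof (rule integral_lebesgue_on_support(1)[symmetric])
    fix x assume "x \<notin> ?B"
    then have "gradient \<phi> x = 0" using C(2,4) by blast
    then show "norm (gradient \<phi> x) powr p = 0" using p by simp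
  qed simp
  finally show ?thesis using S by (simp add: mult_left_mono)
qed

text \<open>Capacity of an arbitrary set is defined through open supersets, and that of an open set
  through its compact subsets. So the open set provided by the definition is exhausted by a closed
  set, compact as the ball is bounded, to which the energy bound applies.\<close>

lemma cap_small_imp_measure_small:
  fixes y0 :: "'a::euclidean_space"
  assumes p: "p > 2" and S: "S > 0" and \<epsilon>: "\<epsilon> > 0"
  shows "\<exists>\<kappa>::real>0. \<forall>E. cap p (ball y0 S) E < ennreal \<kappa> \<longrightarrow>
    (\<exists>U. open U \<and> E \<subseteq> U \<and> U \<in> lmeasurable \<and> measure lebesgue U \<le> \<epsilon>)"
proof -
  let ?B = "ball y0 S"
  \<comment> \<open>First \<open>\<eta>\<close> brings the term without energy down to \<epsilon>/4,
    then \<open>\<kappa>\<close> does the same for the energy term. The other \<epsilon>/2 is left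
    for the part of the open set outside the compact set.\<close>
  define b where "b = 4 * S\<^sup>2 * (measure lebesgue ?B + 1)"
  have b: "b > 0" using S by (simp add: b_def add_nonneg_pos)
  define \<eta> where "\<eta> = sqrt (\<epsilon> / (4 * b))"
  have \<eta>: "\<eta> > 0" "\<eta> powr 2 = \<epsilon> / (4 * b)" using \<epsilon> b by (auto simp: \<eta>_def)
  have e1: "4 * S\<^sup>2 * (\<eta> powr 2 * measure lebesgue ?B) \<le> \<epsilon> / 4"
  proof -
    have "4 * S\<^sup>2 * (\<eta> powr 2 * measure lebesgue ?B) = \<epsilon> / (4 * b) * (4 * S\<^sup>2 * measure lebesgue ?B)"
      unfolding \<eta>(2) by simp
    also have "\<dots> \<le> \<epsilon> / (4 * b) * b"
      using b \<epsilon> S by (intro mult_left_mono) (auto simp: b_def)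
    finally show ?thesis using b by simp
  qed
  define \<kappa> where "\<kappa> = \<epsilon> / (4 * (4 * S\<^sup>2 * \<eta> powr (2 - p)))"
  have pos: "4 * S\<^sup>2 * \<eta> powr (2 - p) > 0" using S \<eta>(1) by simp
  have \<kappa>: "\<kappa> > 0" unfolding \<kappa>_def using \<epsilon> pos by (intro divide_pos_pos) simp_all
  have e2: "4 * S\<^sup>2 * (\<eta> powr (2 - p) * \<kappa>) = \<epsilon> / 4"
    using S \<eta>(1) by (simp add: \<kappa>_def)
  have cK: "measure lebesgue K \<le> \<epsilon> / 2" if K: "compact K" "cap_compact p ?B K < ennreal \<kappa>" for K
  proof -
    obtain \<phi> where ph: "\<phi> \<in> Cc_infinity ?B" "\<forall>x\<in>K. 1 \<le> \<phi> x"
      "(\<integral>\<^sup>+x. ennreal (norm (gradient \<phi> x) powr p) \<partial>lebesgue_on ?B) < ennreal \<kappa>"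
      using K(2) unfolding cap_compact_def INF_less_iff by auto
    have ip: "integrable (lebesgue_on ?B) (\<lambda>x. norm (gradient \<phi> x) powr p)"
      using Lp_Cc_infinity(2)[OF ph(1) open_ball, of p] p by (simp add: Lp_def)
    have "ennreal (\<integral>x. norm (gradient \<phi> x) powr p \<partial>lebesgue_on ?B) < ennreal \<kappa>"
      using ph(3) nn_integral_eq_integral[OF ip] by simp
    then have E: "(\<integral>x. norm (gradient \<phi> x) powr p \<partial>lebesgue_on ?B) \<le> \<kappa>"
      by (simp add: ennreal_less_iff less_imp_le)
    have "measure lebesgue K \<le> 4 * S\<^sup>2 * (\<eta> powr 2 * measure lebesgue ?B
       + \<eta> powr (2 - p) * (\<integral>x. norm (gradient \<phi> x) powr p \<partial>lebesgue_on ?B))"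
      using measure_compact_le_energy[OF p ph(1) S \<eta>(1) K(1)] ph(2) by blast
    also have "\<dots> \<le> 4 * S\<^sup>2 * (\<eta> powr 2 * measure lebesgue ?B + \<eta> powr (2 - p) * \<kappa>)"
      using E by (intro mult_left_mono add_left_mono) auto
    also have "\<dots> \<le> \<epsilon> / 2" using e1 e2 by (simp only: distrib_left)
    finally show ?thesis .
  qed
  show ?thesis
  proof (intro exI[of _ \<kappa>] conjI \<kappa> allI impI)
    fix E assume "cap p ?B E < ennreal \<kappa>"
    then obtain U where U: "open U" "E \<subseteq> U" "U \<subseteq> ?B" "cap_open p ?B U < ennreal \<kappa>"
      unfolding cap_def INF_less_iff by auto
    have bU: "bounded U" using U(3) bounded_subset bounded_ball by blast
    have Ul: "U \<in> lmeasurable" using U(1) bU lmeasurable_open by blast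
    have "\<epsilon> / 2 > 0" using \<epsilon> by simp
    obtain T where T: "closed T" "T \<subseteq> U" "U - T \<in> lmeasurable" "emeasure lebesgue (U - T) < ennreal (\<epsilon> / 2)"
      using sets_lebesgue_inner_closed[OF fmeasurableD[OF Ul] \<open>\<epsilon> / 2 > 0\<close>] by metis
    have "compact T" using T bU bounded_subset compact_eq_bounded_closed by blast
    moreover have "cap_compact p ?B T < ennreal \<kappa>"
    proof (rule le_less_trans[OF _ U(4)])
      show "cap_compact p ?B T \<le> cap_open p ?B U"
        unfolding cap_open_def using \<open>compact T\<close> T(2) by (intro SUP_upper) simp
    qed
    ultimately have "measure lebesgue T \<le> \<epsilon> / 2" by (rule cK)
    moreover have "measure lebesgue (U - T) \<le> \<epsilon> / 2"
      using T(3,4) \<epsilon> by (simp add: emeasure_eq_measure2 ennreal_less_iff)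
    moreover have "measure lebesgue U \<le> measure lebesgue (T \<union> (U - T))"
      using T(2) by (intro eq_refl arg_cong[of _ _ "measure lebesgue"]) auto
    moreover have "measure lebesgue (T \<union> (U - T)) \<le> measure lebesgue T + measure lebesgue (U - T)"
      using T(3) lmeasurable_compact[OF \<open>compact T\<close>] by (intro measure_Un_le fmeasurableD)
    ultimately have "measure lebesgue U \<le> \<epsilon>" by linarith
    with U Ul show "\<exists>U. open U \<and> E \<subseteq> U \<and> U \<in> lmeasurable \<and> measure lebesgue U \<le> \<epsilon>" by blast
  qed
qed

lemma cap_zero_imp_negligible:
  fixes y0 :: "'a::euclidean_space"
  assumes p: "p > 2" and S: "S > 0" and z: "cap p (ball y0 S) E = 0"
  shows "negligible E"
  unfolding negligible_outer_le
proof (intro allI impI)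
  fix e :: real assume "e > 0"
  then obtain \<kappa> :: real where k: "\<kappa> > 0" "\<And>E. cap p (ball y0 S) E < ennreal \<kappa> \<Longrightarrow>
      \<exists>U. open U \<and> E \<subseteq> U \<and> U \<in> lmeasurable \<and> measure lebesgue U \<le> e"
    using cap_small_imp_measure_small[OF p S, of e y0] by blast
  have "cap p (ball y0 S) E < ennreal \<kappa>" using z k(1) by simp
  from k(2)[OF this] show "\<exists>T. E \<subseteq> T \<and> T \<in> lmeasurable \<and> measure lebesgue T \<le> e" by blast
qed

text \<open>\<Omega> differs from a countable intersection of open sets by a negligible set. The
  differences \<open>U - \<Omega>\<close> are not known to be measurable, so they are enclosed in
  measurable sets of small measure.\<close>

lemma quasi_open_lebesgue:
  fixes y0 :: "'a::euclidean_space"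
  assumes p: "p > 2" and S: "S > 0" and q: "quasi_open p (ball y0 S) \<Omega>"
  shows "\<Omega> \<in> sets lebesgue"
proof -
  have "\<exists>U V. open U \<and> \<Omega> \<subseteq> U \<and> U - \<Omega> \<subseteq> V \<and> V \<in> lmeasurable \<and> measure lebesgue V \<le> e" if e: "e > 0" for e
  proof -
    obtain \<kappa> :: real where k: "\<kappa> > 0" "\<And>E. cap p (ball y0 S) E < ennreal \<kappa> \<Longrightarrow>
      \<exists>U. open U \<and> E \<subseteq> U \<and> U \<in> lmeasurable \<and> measure lebesgue U \<le> e"
      using cap_small_imp_measure_small[OF p S e, of y0] by blast
    obtain U where U: "open U" "\<Omega> \<subseteq> U" "cap p (ball y0 S) (U - \<Omega>) < ennreal \<kappa>"
      using q k(1) unfolding quasi_open_def by blast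
    obtain V where "U - \<Omega> \<subseteq> V" "V \<in> lmeasurable" "measure lebesgue V \<le> e"
      using k(2)[OF U(3)] by blast
    with U show ?thesis by (intro exI[of _ U] exI[of _ V] conjI)
  qed
  moreover have "inverse (real (Suc n)) > 0" for n by simp
  ultimately have "\<forall>n. \<exists>U V. open U \<and> \<Omega> \<subseteq> U \<and> U - \<Omega> \<subseteq> V \<and> V \<in> lmeasurable \<and> measure lebesgue V \<le> inverse (real (Suc n))"
    by blast
  then obtain U V where UV: "\<And>n. open (U n)" "\<And>n. \<Omega> \<subseteq> U n" "\<And>n. U n - \<Omega> \<subseteq> V n" "\<And>n. V n \<in> lmeasurable"
    "\<And>n. measure lebesgue (V n) \<le> inverse (real (Suc n))" by metis
  have "negligible ((\<Inter>n. U n) - \<Omega>)"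
    unfolding negligible_outer_le
  proof (intro allI impI)
    fix e :: real assume "e > 0"
    then obtain n where "inverse (real (Suc n)) < e" using reals_Archimedean by blast
    then show "\<exists>T. (\<Inter>n. U n) - \<Omega> \<subseteq> T \<and> T \<in> lmeasurable \<and> measure lebesgue T \<le> e"
      using UV(3,4,5)[of n] by (intro exI[of _ "V n"]) auto
  qed
  moreover have "(\<Inter>n. U n) \<in> sets lebesgue" using UV(1) by (intro sets.countable_INT) auto
  moreover have "\<Omega> = (\<Inter>n. U n) - ((\<Inter>n. U n) - \<Omega>)" using UV(2) by blast
  ultimately show ?thesis by (metis negligible_imp_sets sets.Diff)
qed

text \<open>With the empty set as exceptional set, open sets become quasi-open and continuous
  functions quasi-continuous.\<close>

lemma cap_empty:
  fixes B :: "'a::euclidean_space set"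
  assumes "p > 0" shows "cap p B {} = 0"
proof -
  have z: "(\<lambda>_. 0) \<in> Cc_infinity B"
    by (rule Cc_infinityI[of _ "{}"]) (auto intro: Ck_const)
  have g: "gradient (\<lambda>_::'a. 0) x = 0" for x by (rule gradient_eqI) (rule GDERIV_const)
  have "cap_compact p B {} \<le> (\<integral>\<^sup>+x. ennreal (norm (gradient (\<lambda>_::'a. 0) x) powr p) \<partial>lebesgue_on B)"
    unfolding cap_compact_def using z by (intro INF_lower) auto
  also have "\<dots> = 0" using assms by (simp add: g)
  finally have "cap_compact p B {} = 0" by simp
  then have "cap_open p B {} = 0" by (simp add: cap_open_def)
  moreover have "cap p B {} \<le> cap_open p B {}" unfolding cap_def by (intro INF_lower) auto
  ultimately show ?thesis by simp
qed

lemma open_quasi_open: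
  assumes "p > 0" "open U" shows "quasi_open p B U"
  unfolding quasi_open_def using assms cap_empty[of p B] by (auto intro!: exI[of _ U])

lemma continuous_quasi_continuous_on:
  assumes "p > 0" "continuous_on D u" shows "quasi_continuous_on p B D u"
  unfolding quasi_continuous_on_def using assms cap_empty[of p B] by (auto intro!: exI[of _ "{}"])

section \<open>Approximation of Sobolev functions\<close>

text \<open>Convexity of the power with weights \<open>1 - l\<close> and \<open>l\<close>, from the
  tangent at \<open>a + b\<close> applied to \<open>a / (1 - l)\<close> and \<open>b / l\<close>.
  For small \<open>l\<close> the factor of the main term \<open>a\<close> is close to 1, which the
  triangle inequality with fixed constants would not give.\<close>

lemma powr_add_le:
  fixes a b s l :: real
  assumes "a \<ge> 0" "b \<ge> 0" "s > 1" "0 < l" "l < 1"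
  shows "(a + b) powr s \<le> (1 - l) powr (1 - s) * a powr s + l powr (1 - s) * b powr s"
proof -
  let ?T = "a + b"
  have key: "s * ?T powr (s - 1) * t - m * (s - 1) * ?T powr s \<le> m powr (1 - s) * t powr s"
    if "m > 0" "t \<ge> 0" for m t :: real
  proof -
    have "s * ?T powr (s - 1) * (t / m) - (s - 1) * ?T powr s \<le> (t / m) powr s"
      using that assms by (intro Young_powr) auto
    then have "m * (s * ?T powr (s - 1) * (t / m) - (s - 1) * ?T powr s) \<le> m * (t / m) powr s"
      using that(1) by (intro mult_left_mono) auto
    moreover have "m * (t / m) powr s = m powr (1 - s) * t powr s"
      using that by (simp add: powr_divide powr_diff)
    moreover have "m * (s * ?T powr (s - 1) * (t / m) - (s - 1) * ?T powr s)
        = s * ?T powr (s - 1) * t - m * (s - 1) * ?T powr s"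
      using that(1) by (simp add: right_diff_distrib)
    ultimately show ?thesis by simp
  qed
  have "?T powr s = ?T powr (s - 1) * ?T"
  proof (cases "?T = 0")
    case False
    then have "?T > 0" using assms by linarith
    then show ?thesis by (simp add: powr_diff)
  qed simp
  then have "?T powr s = (s * ?T powr (s - 1) * a - (1 - l) * (s - 1) * ?T powr s)
      + (s * ?T powr (s - 1) * b - l * (s - 1) * ?T powr s)"
    by (simp add: algebra_simps)
  also have "\<dots> \<le> (1 - l) powr (1 - s) * a powr s + l powr (1 - s) * b powr s"
    using assms by (intro add_mono key) auto
  finally show ?thesis .
qed

lemma integrable_lower_powr:
  fixes f :: "'a \<Rightarrow> 'b::euclidean_space"
  assumes M: "finite_measure M" and f: "f \<in> borel_measurable M" "integrable M (\<lambda>x. norm (f x) powr p)"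
    and s: "0 < s" "s \<le> p"
  shows "integrable M (\<lambda>x. norm (f x) powr s)"
proof (rule Bochner_Integration.integrable_bound)
  show "integrable M (\<lambda>x. 1 + norm (f x) powr p)"
    using f(2) finite_measure.integrable_const[OF M] by (intro Bochner_Integration.integrable_add)
  show "(\<lambda>x. norm (f x) powr s) \<in> borel_measurable M" using f(1) by measurable
  show "AE x in M. norm (norm (f x) powr s) \<le> norm (1 + norm (f x) powr p)"
    using powr_interpolate[of "norm (f _)" 1 s p] s by (intro AE_I2) simp
qed

text \<open>Carries convergence of the gradients from the exponent \<open>p\<close> to 2.
  Interpolation with a small \<open>\<eta>\<close>, chosen so that the constant term times the total
  mass is at most e/2, takes the place of Hoelder's inequality.\<close>

lemma tendsto_lower_powr:
  fixes f :: "nat \<Rightarrow> 'a \<Rightarrow> 'b::euclidean_space"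
  assumes M: "finite_measure M" and f: "\<And>n. f n \<in> borel_measurable M" "\<And>n. integrable M (\<lambda>x. norm (f n x) powr p)"
    and lim: "(\<lambda>n. \<integral>x. norm (f n x) powr p \<partial>M) \<longlonglongrightarrow> 0"
    and s: "0 < s" "s \<le> p"
  shows "(\<lambda>n. \<integral>x. norm (f n x) powr s \<partial>M) \<longlonglongrightarrow> 0"
proof (rule tendstoI)
  fix e :: real assume e: "e > 0"
  let ?m = "measure M (space M)"
  define \<eta> where "\<eta> = (e / (2 * (?m + 1))) powr (1 / s)"
  have m1: "?m + 1 > 0" by (simp add: add_nonneg_pos)
  have \<eta>: "\<eta> > 0" "\<eta> powr s = e / (2 * (?m + 1))" using e m1 s by (auto simp: \<eta>_def powr_powr)
  have b: "(\<integral>x. norm (f n x) powr s \<partial>M) \<le> \<eta> powr s * ?m + \<eta> powr (s - p) * (\<integral>x. norm (f n x) powr p \<partial>M)" for n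
  proof -
    have "(\<integral>x. norm (f n x) powr s \<partial>M) \<le> (\<integral>x. \<eta> powr s + \<eta> powr (s - p) * norm (f n x) powr p \<partial>M)"
    proof (rule integral_mono)
      show "integrable M (\<lambda>x. norm (f n x) powr s)" by (rule integrable_lower_powr[OF M f s])
      show "integrable M (\<lambda>x. \<eta> powr s + \<eta> powr (s - p) * norm (f n x) powr p)"
        using f(2) finite_measure.integrable_const[OF M]
        by (intro Bochner_Integration.integrable_add integrable_mult_right)
      show "norm (f n x) powr s \<le> \<eta> powr s + \<eta> powr (s - p) * norm (f n x) powr p" for x
        using powr_interpolate[OF norm_ge_zero \<eta>(1) s(2,1)] .
    qed
    also have "\<dots> = (\<integral>x. \<eta> powr s \<partial>M) + (\<integral>x. \<eta> powr (s - p) * norm (f n x) powr p \<partial>M)"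
      using f(2) finite_measure.integrable_const[OF M]
      by (intro Bochner_Integration.integral_add integrable_mult_right)
    also have "\<dots> = \<eta> powr s * ?m + \<eta> powr (s - p) * (\<integral>x. norm (f n x) powr p \<partial>M)"
      by (simp add: mult.commute)
    finally show ?thesis .
  qed
  have half: "\<eta> powr s * ?m \<le> e / 2"
    unfolding \<eta>(2) using e m1 by (simp add: field_simps)
  have "(\<lambda>n. \<eta> powr (s - p) * (\<integral>x. norm (f n x) powr p \<partial>M)) \<longlonglongrightarrow> \<eta> powr (s - p) * 0"
    by (intro tendsto_intros lim)
  then have "\<forall>\<^sub>F n in sequentially. \<eta> powr (s - p) * (\<integral>x. norm (f n x) powr p \<partial>M) < e / 2"
    by (rule order_tendstoD(2)) (use e in simp)
  then show "\<forall>\<^sub>F n in sequentially. dist (\<integral>x. norm (f n x) powr s \<partial>M) 0 < e"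
  proof eventually_elim
    case (elim n)
    have "0 \<le> (\<integral>x. norm (f n x) powr s \<partial>M)" by (simp add: integral_nonneg_AE)
    then show ?case using b[of n] half elim by (simp add: dist_real_def)
  qed
qed

lemma integral_lebesgue_on_subset:
  fixes f :: "'a::euclidean_space \<Rightarrow> real"
  assumes "\<Omega> \<in> sets lebesgue" "D \<in> sets lebesgue" "\<Omega> \<subseteq> D"
  shows "(\<integral>x. indicator \<Omega> x * f x \<partial>lebesgue_on D) = (\<integral>x. f x \<partial>lebesgue_on \<Omega>)"
proof -
  have "(\<integral>x. f x \<partial>lebesgue_on \<Omega>) = (\<integral>x. indicator \<Omega> x * f x \<partial>lebesgue)"
    using assms(1) by (simp add: integral_restrict_space)
  moreover have "(\<integral>x. indicator \<Omega> x * f x \<partial>lebesgue_on D) = (\<integral>x. indicator \<Omega> x * f x \<partial>lebesgue)"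
    using assms by (intro integral_lebesgue_on_support(1)) (auto simp: indicator_def)
  ultimately show ?thesis by simp
qed

text \<open>As \<open>u\<close> vanishes almost everywhere off \<Omega>, a test function
  \<open>w n\<close> can reach the modulus \<delta> there only on the set
  \<open>E \<delta> n\<close> where it differs from \<open>u\<close> by at least \<delta>. Measure
  and energies over its superlevel set are therefore bounded by those of \<open>u\<close> over
  \<Omega>, up to an approximation error and integrals over \<open>E \<delta> n\<close>, both of
  which tend to 0.\<close>

lemma superlevel_approx:
  fixes u :: "'a::euclidean_space \<Rightarrow> real" and g :: "'a \<Rightarrow> 'a"
  assumes D: "open D" "D \<in> lmeasurable" and p: "p > 2" and q: "0 < q" "q \<le> p"
    and u: "u \<in> Lp p D" and g: "g \<in> Lp p D" and ph: "\<And>n. \<phi> n \<in> Cc_infinity D"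
    and lim: "(\<lambda>n. \<integral>x. \<bar>u x - \<phi> n x\<bar> powr p \<partial>lebesgue_on D) \<longlonglongrightarrow> 0"
      "(\<lambda>n. \<integral>x. norm (g x - gradient (\<phi> n) x) powr p \<partial>lebesgue_on D) \<longlonglongrightarrow> 0"
    and \<Omega>: "\<Omega> \<in> sets lebesgue" "\<Omega> \<subseteq> D" "AE x in lebesgue_on D. x \<notin> \<Omega> \<longrightarrow> u x = 0" "measure lebesgue \<Omega> < c"
    and K: "(\<integral>x. norm (g x) powr p \<partial>lebesgue_on \<Omega>) < Kp" "(\<integral>x. norm (g x) powr 2 \<partial>lebesgue_on \<Omega>) < K2"
      "K' < (\<integral>x. \<bar>u x\<bar> powr q \<partial>lebesgue_on D)"
  shows "\<exists>v\<in>Cc_infinity D. \<exists>\<delta>>0. measure lebesgue {z. \<delta> \<le> \<bar>v z\<bar>} < c \<and>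
    (\<integral>x. indicator {z. \<delta> \<le> \<bar>v z\<bar>} x * norm (gradient v x) powr p \<partial>lebesgue) < Kp \<and>
    (\<integral>x. indicator {z. \<delta> \<le> \<bar>v z\<bar>} x * norm (gradient v x) powr 2 \<partial>lebesgue) < K2 \<and>
    K' < (\<integral>x. max 0 (\<bar>v x\<bar> - 2 * \<delta>) powr q \<partial>lebesgue)"
    (is "\<exists>v\<in>_. \<exists>\<delta>>0. ?G \<delta> v")
proof -
  let ?M = "lebesgue_on D"
  have Ds: "D \<in> sets lebesgue" using D(2) by (rule fmeasurableD)
  have fin: "finite_measure ?M" using D(2) by (rule finite_measure_lebesgue_on)
  have um: "u \<in> borel_measurable ?M" and gm: "g \<in> borel_measurable ?M"
    and ui: "integrable ?M (\<lambda>x. norm (u x) powr p)" and gi: "integrable ?M (\<lambda>x. norm (g x) powr p)"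
    using u g by (auto simp: Lp_def)
  have pm: "\<phi> n \<in> borel_measurable ?M" "gradient (\<phi> n) \<in> borel_measurable ?M" for n
    using Lp_Cc_infinity(1,2)[OF ph D(1), of p n] p by (auto simp: Lp_def)
  have pi: "integrable ?M (\<lambda>x. norm (\<phi> n x) powr p)" "integrable ?M (\<lambda>x. norm (gradient (\<phi> n) x) powr p)" for n
    using Lp_Cc_infinity(1,2)[OF ph D(1), of p n] p by (auto simp: Lp_def)
  have diff: "integrable ?M (\<lambda>x. norm (a x - b x) powr p)"
    if "a \<in> borel_measurable ?M" "b \<in> borel_measurable ?M" "integrable ?M (\<lambda>x. norm (a x) powr p)" "integrable ?M (\<lambda>x. norm (b x) powr p)"
    for a b :: "'a \<Rightarrow> 'c::euclidean_space"
  proof (rule Bochner_Integration.integrable_bound)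
    let ?k = "(1 - 1 / 2) powr (1 - p) :: real" and ?l = "(1 / 2) powr (1 - p) :: real"
    show "integrable ?M (\<lambda>x. ?k * norm (a x) powr p + ?l * norm (b x) powr p)"
      using that by (intro Bochner_Integration.integrable_add integrable_mult_right)
    show "(\<lambda>x. norm (a x - b x) powr p) \<in> borel_measurable ?M" using that by measurable
    show "AE x in ?M. norm (norm (a x - b x) powr p) \<le> norm (?k * norm (a x) powr p + ?l * norm (b x) powr p)"
    proof (intro AE_I2)
      fix x
      have "norm (a x - b x) powr p \<le> (norm (a x) + norm (b x)) powr p"
        using p by (intro powr_mono2 norm_triangle_ineq4) auto
      also have "\<dots> \<le> ?k * norm (a x) powr p + ?l * norm (b x) powr p"
        using p by (intro powr_add_le) auto
      finally show "norm (norm (a x - b x) powr p) \<le> norm (?k * norm (a x) powr p + ?l * norm (b x) powr p)" by simp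
    qed
  qed
  have di: "integrable ?M (\<lambda>x. norm (u x - \<phi> n x) powr p)" "integrable ?M (\<lambda>x. norm (g x - gradient (\<phi> n) x) powr p)" for n
    using diff[OF um pm(1) ui pi(1)] diff[OF gm pm(2) gi pi(2)] by auto
  \<comment> \<open>Convergence in mean yields convergence almost everywhere only along a
    subsequence, which \<open>w\<close> denotes from here on.\<close>
  obtain r where r: "strict_mono r" "AE x in ?M. (\<lambda>n. norm (u x - \<phi> (r n) x) powr p) \<longlonglongrightarrow> 0"
    using tendsto_L1_AE_subseq[of ?M "\<lambda>n x. norm (u x - \<phi> n x) powr p"] di(1) lim(1) by auto
  define w where "w n = \<phi> (r n)" for n
  have wC: "w n \<in> Cc_infinity D" for n by (simp add: w_def ph)
  have wm: "w n \<in> borel_measurable ?M" "gradient (w n) \<in> borel_measurable ?M" for n by (simp_all add: w_def pm)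
  note wout = Cc_infinity_zero_outside[OF wC]
  define E where "E \<delta> n = {x \<in> D. \<delta> \<le> \<bar>u x - w n x\<bar>}" for \<delta> n
  have Em: "E \<delta> n \<in> sets ?M" for \<delta> n
  proof -
    have "{x \<in> space ?M. \<delta> \<le> \<bar>u x - w n x\<bar>} \<in> sets ?M" using um wm by measurable
    then show ?thesis by (simp add: E_def)
  qed
  have Elim: "AE x in ?M. (\<lambda>n. indicat_real (E \<delta> n) x) \<longlonglongrightarrow> 0" if \<delta>: "\<delta> > 0" for \<delta>
    using r(2)
  proof eventually_elim
    case (elim x)
    have "\<delta> powr p > 0" using \<delta> by simp
    from order_tendstoD(2)[OF elim this] show ?case
    proof (intro tendsto_eventually, eventually_elim)
      case (elim n)
      then have "norm (u x - \<phi> (r n) x) < \<delta>" using \<delta> p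
        by (meson linorder_not_less norm_ge_zero powr_mono2 less_imp_le order_trans zero_less_numeral)
      then show ?case by (simp add: E_def w_def)
    qed
  qed
  have dom: "(\<lambda>n. \<integral>x. indicator (E \<delta> n) x * f x \<partial>?M) \<longlonglongrightarrow> 0" if \<delta>: "\<delta> > 0" and f: "integrable ?M f" for \<delta> and f :: "'a \<Rightarrow> real"
  proof -
    have "(\<lambda>n. \<integral>x. indicator (E \<delta> n) x * f x \<partial>?M) \<longlonglongrightarrow> (\<integral>x. 0 \<partial>?M)"
    proof (rule integral_dominated_convergence[where w = "\<lambda>x. norm (f x)"])
      show "AE x in ?M. (\<lambda>n. indicator (E \<delta> n) x * f x) \<longlonglongrightarrow> 0"
        using Elim[OF \<delta>] by eventually_elim (auto intro: tendsto_mult_left_zero)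
      show "(\<lambda>x. indicator (E \<delta> n) x * f x) \<in> borel_measurable ?M" for n
        using Em f by measurable
      show "AE x in ?M. norm (indicator (E \<delta> n) x * f x) \<le> norm (f x)" for n
        by (intro AE_I2) (simp add: indicator_def)
    qed (use f in simp_all)
    then show ?thesis by simp
  qed
  have ie: "integrable ?M (\<lambda>x. indicator (E \<delta> n) x * f x)" if "integrable ?M f" for \<delta> n and f :: "'a \<Rightarrow> real"
    using integrable_mult_indicator[OF Em that] by simp
  have P1: "\<forall>\<^sub>F n in sequentially. measure lebesgue {z. \<delta> \<le> \<bar>w n z\<bar>} < c" if \<delta>: "\<delta> > 0" for \<delta>
  proof -
    have i1: "integrable ?M (\<lambda>x. 1 :: real)" by (rule finite_measure.integrable_const[OF fin])
    have i\<Omega>: "integrable ?M (\<lambda>x. indicator \<Omega> x * (1::real))"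
      using integrable_mult_indicator[OF _ i1, of \<Omega>] \<Omega>(1,2) Ds by (simp add: sets_restrict_space_iff)
    have "(\<lambda>n. measure lebesgue \<Omega> + (\<integral>x. indicator (E \<delta> n) x * 1 \<partial>?M)) \<longlonglongrightarrow> measure lebesgue \<Omega> + 0"
      by (intro tendsto_intros dom[OF \<delta> i1])
    then have "\<forall>\<^sub>F n in sequentially. measure lebesgue \<Omega> + (\<integral>x. indicator (E \<delta> n) x * 1 \<partial>?M) < c"
      by (rule order_tendstoD(2)) (use \<Omega>(4) in simp)
    then show ?thesis
    proof eventually_elim
      case (elim n)
      let ?P = "{z. \<delta> \<le> \<bar>w n z\<bar>}"
      have Pl: "?P \<in> lmeasurable" by (rule superlevel_lmeasurable(1)[OF wC \<delta>])
      have PD: "?P \<subseteq> D" using wout(1) \<delta> by force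
      have iP: "integrable ?M (\<lambda>x. indicator ?P x * (1::real))"
        using integrable_mult_indicator[OF _ i1, of ?P] PD Ds fmeasurableD[OF Pl] by (simp add: sets_restrict_space_iff)
      have "measure lebesgue ?P = (\<integral>x. 1 \<partial>lebesgue_on ?P)"
        using Pl by (simp add: measure_restrict_space fmeasurableD)
      also have "\<dots> = (\<integral>x. indicator ?P x * 1 \<partial>?M)"
        by (rule integral_lebesgue_on_subset[symmetric, OF fmeasurableD[OF Pl] Ds PD])
      also have "\<dots> \<le> (\<integral>x. indicator \<Omega> x * 1 + indicator (E \<delta> n) x * 1 \<partial>?M)"
      proof (rule integral_mono_AE[OF iP])
        show "integrable ?M (\<lambda>x. indicator \<Omega> x * 1 + indicator (E \<delta> n) x * (1::real))"
          using i\<Omega> ie[OF i1] by (rule Bochner_Integration.integrable_add)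
        have "AE x in ?M. x \<in> D" using AE_space[of ?M] by simp
        with \<Omega>(3) show "AE x in ?M. indicator ?P x * (1::real) \<le> indicator \<Omega> x * 1 + indicator (E \<delta> n) x * 1"
          by eventually_elim (auto simp: indicator_def E_def)
      qed
      also have "\<dots> = (\<integral>x. indicator \<Omega> x * 1 \<partial>?M) + (\<integral>x. indicator (E \<delta> n) x * 1 \<partial>?M)"
        using i\<Omega> ie[OF i1] by (rule Bochner_Integration.integral_add)
      also have "(\<integral>x. indicator \<Omega> x * 1 \<partial>?M) = measure lebesgue \<Omega>"
        using integral_lebesgue_on_subset[OF \<Omega>(1) Ds \<Omega>(2), of "\<lambda>_. 1"] \<Omega>(1) by (simp add: measure_restrict_space)
      finally show ?case using elim by linarith
    qed
  qed
  have P2: "\<forall>\<^sub>F n in sequentially. (\<integral>x. indicator {z. \<delta> \<le> \<bar>w n z\<bar>} x * norm (gradient (w n) x) powr s \<partial>lebesgue) < k"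
    if \<delta>: "\<delta> > 0" and s: "1 < s" "s \<le> p" and k: "(\<integral>x. norm (g x) powr s \<partial>lebesgue_on \<Omega>) < k" for \<delta> s k
  proof -
    let ?I = "\<integral>x. norm (g x) powr s \<partial>lebesgue_on \<Omega>"
    have s0: "0 < s" using s by simp
    \<comment> \<open>The weight \<open>l\<close> belongs to the approximation error. A small
      \<open>l\<close> brings the factor of the main term close to 1; the large factor
      \<open>l powr (1 - s)\<close> is harmless, as it multiplies a quantity tending to 0.\<close>
    have "((\<lambda>l. (1 - l) powr (1 - s) * ?I) \<longlongrightarrow> (1 - 0) powr (1 - s) * ?I) (at_right 0)"
      by (intro tendsto_intros) auto
    then have "\<forall>\<^sub>F l in at_right 0. (1 - l) powr (1 - s) * ?I < k"
      by (rule order_tendstoD(2)) (use k in simp)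
    moreover have "\<forall>\<^sub>F l in at_right 0. (0::real) < l \<and> l < 1"
      by (auto simp: eventually_at_right_field intro!: exI[of _ 1])
    ultimately have "\<forall>\<^sub>F l in at_right (0::real). (1 - l) powr (1 - s) * ?I < k \<and> 0 < l \<and> l < 1"
      by eventually_elim simp
    then obtain l :: real where l: "0 < l" "l < 1" "(1 - l) powr (1 - s) * ?I < k"
      using eventually_happens[of _ "at_right (0::real)"] by (auto simp: trivial_limit_at_right_real)
    have gs: "integrable ?M (\<lambda>x. norm (g x) powr s)" by (rule integrable_lower_powr[OF fin gm gi s0 s(2)])
    have gws: "integrable ?M (\<lambda>x. norm (g x - gradient (w n) x) powr s)" for n
      unfolding w_def using gm pm(2) by (intro integrable_lower_powr[OF fin _ di(2) s0 s(2)]) measurable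
    have "(\<lambda>n. \<integral>x. norm (g x - gradient (\<phi> n) x) powr s \<partial>?M) \<longlonglongrightarrow> 0"
      using gm pm(2) by (intro tendsto_lower_powr[OF fin _ di(2) lim(2) s0 s(2)]) measurable
    from LIMSEQ_subseq_LIMSEQ[OF this r(1)]
    have gl: "(\<lambda>n. \<integral>x. norm (g x - gradient (w n) x) powr s \<partial>?M) \<longlonglongrightarrow> 0"
      by (simp add: o_def w_def)
    let ?Y = "\<lambda>n. (1 - l) powr (1 - s) * (?I + (\<integral>x. indicator (E \<delta> n) x * norm (g x) powr s \<partial>?M))
        + l powr (1 - s) * (\<integral>x. norm (g x - gradient (w n) x) powr s \<partial>?M)"
    have "?Y \<longlonglongrightarrow> (1 - l) powr (1 - s) * (?I + 0) + l powr (1 - s) * 0"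
      by (intro tendsto_intros dom[OF \<delta> gs] gl)
    then have "\<forall>\<^sub>F n in sequentially. ?Y n < k"
      by (rule order_tendstoD(2)) (use l in simp)
    then show ?thesis
    proof eventually_elim
      case (elim n)
      let ?P = "{z. \<delta> \<le> \<bar>w n z\<bar>}"
      let ?f = "\<lambda>x. indicator ?P x * norm (gradient (w n) x) powr s"
      have Pl: "?P \<in> lmeasurable" by (rule superlevel_lmeasurable(1)[OF wC \<delta>])
      have i\<Omega>: "integrable ?M (\<lambda>x. indicator \<Omega> x * norm (g x) powr s)"
        using integrable_mult_indicator[OF _ gs, of \<Omega>] \<Omega>(1,2) Ds by (simp add: sets_restrict_space_iff)
      let ?h = "\<lambda>x. (1 - l) powr (1 - s) * (indicator \<Omega> x * norm (g x) powr s + indicator (E \<delta> n) x * norm (g x) powr s)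
          + l powr (1 - s) * norm (g x - gradient (w n) x) powr s"
      have hi: "integrable ?M ?h"
        by (intro Bochner_Integration.integrable_add integrable_mult_right i\<Omega> ie gs gws)
      have fi: "integrable ?M ?f"
      proof -
        have "integrable lebesgue (\<lambda>x. norm (gradient (w n) x) powr s)"
          by (rule Lp_Cc_infinity(4)[OF wC D(1) s0])
        from integrable_mult_indicator[OF fmeasurableD[OF Pl] this] have "integrable lebesgue ?f" by simp
        moreover have "?f x = 0" if "x \<notin> D" for x using wout(2)[OF that] s0 by simp
        ultimately show ?thesis using integral_lebesgue_on_support(2)[OF Ds, of ?f] by blast
      qed
      have "(\<integral>x. ?f x \<partial>lebesgue) = (\<integral>x. ?f x \<partial>?M)"
        using wout(2) s0 by (intro integral_lebesgue_on_support(1)[OF Ds, symmetric]) simp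
      also have "\<dots> \<le> (\<integral>x. ?h x \<partial>?M)"
      proof (rule integral_mono_AE[OF fi hi])
        have "AE x in ?M. x \<in> D" using AE_space[of ?M] by simp
        with \<Omega>(3) show "AE x in ?M. ?f x \<le> ?h x"
        proof eventually_elim
          case (elim x)
          show "?f x \<le> ?h x"
          proof (cases "x \<in> ?P")
            case True
            then have "x \<in> \<Omega> \<or> x \<in> E \<delta> n" using elim by (auto simp: E_def)
            then have a: "norm (g x) powr s \<le> indicator \<Omega> x * norm (g x) powr s + indicator (E \<delta> n) x * norm (g x) powr s"
              by (auto simp: indicator_def)
            have "norm (gradient (w n) x) \<le> norm (g x) + norm (g x - gradient (w n) x)"
              using norm_triangle_ineq4[of "g x" "g x - gradient (w n) x"] by simp
            then have "norm (gradient (w n) x) powr s \<le> (norm (g x) + norm (g x - gradient (w n) x)) powr s"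
              using s0 by (intro powr_mono2) auto
            also have "\<dots> \<le> (1 - l) powr (1 - s) * norm (g x) powr s + l powr (1 - s) * norm (g x - gradient (w n) x) powr s"
              using s(1) l by (intro powr_add_le) auto
            also have "\<dots> \<le> ?h x" by (intro add_right_mono mult_left_mono a) simp
            finally show ?thesis using True by simp
          next
            case False
            then show ?thesis by simp
          qed
        qed
      qed
      also have "\<dots> = (1 - l) powr (1 - s) * ((\<integral>x. indicator \<Omega> x * norm (g x) powr s \<partial>?M) + (\<integral>x. indicator (E \<delta> n) x * norm (g x) powr s \<partial>?M))
          + l powr (1 - s) * (\<integral>x. norm (g x - gradient (w n) x) powr s \<partial>?M)"
        using i\<Omega> ie[OF gs] gws by simp
      also have "(\<integral>x. indicator \<Omega> x * norm (g x) powr s \<partial>?M) = ?I"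
        by (rule integral_lebesgue_on_subset[OF \<Omega>(1) Ds \<Omega>(2)])
      finally show ?case using elim by linarith
    qed
  qed
  have uq: "integrable ?M (\<lambda>x. \<bar>u x\<bar> powr q)"
    using integrable_lower_powr[OF fin um ui q] by simp
  have P3: "\<forall>\<^sub>F n in sequentially. K' < (\<integral>x. max 0 (\<bar>w n x\<bar> - 2 * \<delta>) powr q \<partial>lebesgue)"
    if \<delta>: "\<delta> > 0" and k: "K' < (\<integral>x. max 0 (\<bar>u x\<bar> - 3 * \<delta>) powr q \<partial>?M)" for \<delta>
  proof -
    let ?f = "\<lambda>x. max 0 (\<bar>u x\<bar> - 3 * \<delta>) powr q"
    have fi: "integrable ?M ?f"
    proof (rule Bochner_Integration.integrable_bound[OF uq])
      show "?f \<in> borel_measurable ?M" using um by measurable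
      show "AE x in ?M. norm (?f x) \<le> norm (\<bar>u x\<bar> powr q)"
        using \<delta> q by (intro AE_I2) (auto intro!: powr_mono2)
    qed
    have "(\<lambda>n. (\<integral>x. ?f x \<partial>?M) - (\<integral>x. indicator (E \<delta> n) x * ?f x \<partial>?M)) \<longlonglongrightarrow> (\<integral>x. ?f x \<partial>?M) - 0"
      by (intro tendsto_intros dom[OF \<delta> fi])
    then have "\<forall>\<^sub>F n in sequentially. K' < (\<integral>x. ?f x \<partial>?M) - (\<integral>x. indicator (E \<delta> n) x * ?f x \<partial>?M)"
      by (rule order_tendstoD(1)) (use k in simp)
    then show ?thesis
    proof eventually_elim
      case (elim n)
      let ?h = "\<lambda>x. max 0 (\<bar>w n x\<bar> - 2 * \<delta>) powr q"
      have h0: "?h x = 0" if "x \<notin> D" for x using wout(1)[OF that] \<delta> q by simp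
      have "integrable lebesgue ?h" using \<delta> by (intro integrable_truncated_Cc_infinity[OF wC _ q(1)]) simp
      then have hi: "integrable ?M ?h" using integral_lebesgue_on_support(2)[OF Ds, of ?h] h0 by blast
      have "(\<integral>x. ?f x \<partial>?M) - (\<integral>x. indicator (E \<delta> n) x * ?f x \<partial>?M) = (\<integral>x. ?f x - indicator (E \<delta> n) x * ?f x \<partial>?M)"
        using fi ie[OF fi] by simp
      also have "\<dots> \<le> (\<integral>x. ?h x \<partial>?M)"
      proof (rule integral_mono_AE)
        show "integrable ?M (\<lambda>x. ?f x - indicator (E \<delta> n) x * ?f x)" using fi ie[OF fi] by simp
        have "AE x in ?M. x \<in> D" using AE_space[of ?M] by simp
        then show "AE x in ?M. ?f x - indicator (E \<delta> n) x * ?f x \<le> ?h x"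
        proof eventually_elim
          case (elim x)
          show ?case
          proof (cases "x \<in> E \<delta> n")
            case False
            then have "\<bar>u x - w n x\<bar> < \<delta>" using elim by (simp add: E_def)
            then have "max 0 (\<bar>u x\<bar> - 3 * \<delta>) \<le> max 0 (\<bar>w n x\<bar> - 2 * \<delta>)" by linarith
            then show ?thesis using False q by (simp add: powr_mono2)
          qed simp
        qed
      qed (rule hi)
      also have "\<dots> = (\<integral>x. ?h x \<partial>lebesgue)" by (rule integral_lebesgue_on_support(1)[OF Ds h0])
      finally show ?case using elim by linarith
    qed
  qed
  \<comment> \<open>The \<open>q\<close>-integral alone limits \<delta>; the other bounds hold for
    every positive \<delta> once \<open>n\<close> is large. Passing from \<open>u\<close> to
    \<open>w n\<close> costs one \<delta>, hence the factor 3 here against 2 in the conclusion,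
    which in turn leaves one \<delta> for the level spacing.\<close>
  obtain \<delta> where \<delta>: "\<delta> > 0" "K' < (\<integral>x. max 0 (\<bar>u x\<bar> - 3 * \<delta>) powr q \<partial>?M)"
  proof -
    define d where "d n = inverse (real (Suc n))" for n
    have d: "d n > 0" "d \<longlonglongrightarrow> 0" for n unfolding d_def using LIMSEQ_inverse_real_of_nat by auto
    have "(\<lambda>n. \<integral>x. max 0 (\<bar>u x\<bar> - 3 * d n) powr q \<partial>?M) \<longlonglongrightarrow> (\<integral>x. \<bar>u x\<bar> powr q \<partial>?M)"
    proof (rule integral_dominated_convergence[OF _ _ uq])
      show "(\<lambda>x. \<bar>u x\<bar> powr q) \<in> borel_measurable ?M" using um by measurable
      show "(\<lambda>x. max 0 (\<bar>u x\<bar> - 3 * d n) powr q) \<in> borel_measurable ?M" for n using um by measurable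
      show "AE x in ?M. (\<lambda>n. max 0 (\<bar>u x\<bar> - 3 * d n) powr q) \<longlonglongrightarrow> \<bar>u x\<bar> powr q"
      proof (intro AE_I2)
        fix x
        have "(\<lambda>n. max 0 (\<bar>u x\<bar> - 3 * d n)) \<longlonglongrightarrow> max 0 (\<bar>u x\<bar> - 3 * 0)" by (intro tendsto_intros d(2))
        then have "(\<lambda>n. max 0 (\<bar>u x\<bar> - 3 * d n)) \<longlonglongrightarrow> \<bar>u x\<bar>" by simp
        then show "(\<lambda>n. max 0 (\<bar>u x\<bar> - 3 * d n) powr q) \<longlonglongrightarrow> \<bar>u x\<bar> powr q"
          using q by (intro tendsto_powr2 tendsto_const) auto
      qed
      show "AE x in ?M. norm (max 0 (\<bar>u x\<bar> - 3 * d n) powr q) \<le> \<bar>u x\<bar> powr q" for n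
        using d(1)[of n] q by (intro AE_I2) (auto intro!: powr_mono2)
    qed
    from order_tendstoD(1)[OF this K(3)] obtain n where "K' < (\<integral>x. max 0 (\<bar>u x\<bar> - 3 * d n) powr q \<partial>?M)"
      by (meson eventually_happens trivial_limit_sequentially)
    then show thesis using that d(1) by blast
  qed
  have "1 < p" "(1::real) < 2" "2 \<le> p" using p by simp_all
  from P1[OF \<delta>(1)] P2[OF \<delta>(1) this(1) order_refl K(1)] P2[OF \<delta>(1) this(2,3) K(2)] P3[OF \<delta>]
  have "\<forall>\<^sub>F n in sequentially. ?G \<delta> (w n)" by eventually_elim blast
  then obtain n where "?G \<delta> (w n)" using eventually_happens trivial_limit_sequentially by blast
  then show ?thesis using wC[of n] \<delta>(1) by blast
qed

section \<open>Optimality of the ball\<close>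

text \<open>The strict bounds \<open>Kp\<close>, \<open>K2\<close> and \<open>K'\<close> pay in turn
  for the dilation, for the passage to a test function, and for the discretization.\<close>

lemma rearranged_competitor:
  fixes u :: "'a::euclidean_space \<Rightarrow> real" and g :: "'a \<Rightarrow> 'a" and x0 :: 'a
  assumes dim: "DIM('a) \<ge> 2" and D: "open D" "D \<in> lmeasurable" and p: "p > 2" and q: "0 < q" "q \<le> p"
    and u: "u \<in> Lp p D" and g: "g \<in> Lp p D" and ph: "\<And>n. \<phi> n \<in> Cc_infinity D"
    and lim: "(\<lambda>n. \<integral>x. \<bar>u x - \<phi> n x\<bar> powr p \<partial>lebesgue_on D) \<longlonglongrightarrow> 0"
      "(\<lambda>n. \<integral>x. norm (g x - gradient (\<phi> n) x) powr p \<partial>lebesgue_on D) \<longlonglongrightarrow> 0"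
    and \<Omega>: "\<Omega> \<in> sets lebesgue" "\<Omega> \<subseteq> D" "AE x in lebesgue_on D. x \<notin> \<Omega> \<longrightarrow> u x = 0"
    and \<rho>: "\<rho> > 0" "measure lebesgue \<Omega> \<le> ball_vol TYPE('a) \<rho>"
    and K: "(\<integral>x. norm (g x) powr p \<partial>lebesgue_on \<Omega>) < Kp" "(\<integral>x. norm (g x) powr 2 \<partial>lebesgue_on \<Omega>) < K2"
      "K' < (\<integral>x. \<bar>u x\<bar> powr q \<partial>lebesgue_on D)" "0 \<le> K'"
  shows "\<exists>\<psi>\<in>Cc_infinity (ball x0 \<rho>). (\<integral>x. norm (gradient \<psi> x) powr p \<partial>lebesgue) < Kp \<and>
    (\<integral>x. norm (gradient \<psi> x) powr 2 \<partial>lebesgue) < K2 \<and> K' < (\<integral>x. \<bar>\<psi> x\<bar> powr q \<partial>lebesgue)"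
proof -
  let ?n = "DIM('a)"
  let ?c = "ball_vol TYPE('a) \<rho>"
  have c: "?c > 0" using \<rho>(1) by simp
  \<comment> \<open>The superlevel set of the test function may be larger than \<Omega>. A factor
    \<theta> < 1 permits a volume up to \<theta>^(-n) times that of the target ball, and the
    dilation by \<theta> undoes the excess.\<close>
  have "((\<lambda>\<theta>. \<theta> powr p * Kp) \<longlongrightarrow> 1 powr p * Kp) (at_left 1)"
    "((\<lambda>\<theta>. \<theta> powr 2 * K2) \<longlongrightarrow> 1 powr 2 * K2) (at_left 1)"
    "((\<lambda>\<theta>. K' / \<theta> ^ ?n) \<longlongrightarrow> K' / 1 ^ ?n) (at_left (1::real))"
    by (intro tendsto_intros; simp)+
  then have "\<forall>\<^sub>F \<theta> in at_left (1::real). (\<integral>x. norm (g x) powr p \<partial>lebesgue_on \<Omega>) < \<theta> powr p * Kp"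
    "\<forall>\<^sub>F \<theta> in at_left (1::real). (\<integral>x. norm (g x) powr 2 \<partial>lebesgue_on \<Omega>) < \<theta> powr 2 * K2"
    "\<forall>\<^sub>F \<theta> in at_left (1::real). K' / \<theta> ^ ?n < (\<integral>x. \<bar>u x\<bar> powr q \<partial>lebesgue_on D)"
    using order_tendstoD K by fastforce+
  moreover have "\<forall>\<^sub>F \<theta> in at_left (1::real). 0 < \<theta> \<and> \<theta> < 1"
    by (auto simp: eventually_at_left_field intro!: exI[of _ 0])
  ultimately have "\<forall>\<^sub>F \<theta> in at_left (1::real). (\<integral>x. norm (g x) powr p \<partial>lebesgue_on \<Omega>) < \<theta> powr p * Kp \<and>
    (\<integral>x. norm (g x) powr 2 \<partial>lebesgue_on \<Omega>) < \<theta> powr 2 * K2 \<and>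
    K' / \<theta> ^ ?n < (\<integral>x. \<bar>u x\<bar> powr q \<partial>lebesgue_on D) \<and> 0 < \<theta> \<and> \<theta> < 1"
    by eventually_elim simp
  from eventually_happens'[OF trivial_limit_at_left_real this]
  obtain \<theta> where \<theta>: "(\<integral>x. norm (g x) powr p \<partial>lebesgue_on \<Omega>) < \<theta> powr p * Kp"
    "(\<integral>x. norm (g x) powr 2 \<partial>lebesgue_on \<Omega>) < \<theta> powr 2 * K2"
    "K' / \<theta> ^ ?n < (\<integral>x. \<bar>u x\<bar> powr q \<partial>lebesgue_on D)" "0 < \<theta>" "\<theta> < 1"
    by blast
  have \<theta>n: "0 < \<theta> ^ ?n" "\<theta> ^ ?n < 1" using \<theta>(4,5) by (simp_all add: power_less_one_iff)
  have "measure lebesgue \<Omega> < ?c / \<theta> ^ ?n"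
  proof -
    have "?c * \<theta> ^ ?n < ?c" using c \<theta>n mult_strict_left_mono[OF \<theta>n(2) c] by simp
    then have "?c < ?c / \<theta> ^ ?n" using \<theta>n(1) by (simp add: pos_less_divide_eq)
    then show ?thesis using \<rho>(2) by linarith
  qed
  from superlevel_approx[OF D p q u g ph lim \<Omega> this \<theta>(1,2,3)]
  obtain v \<delta> where v: "v \<in> Cc_infinity D" and \<delta>: "\<delta> > 0" "measure lebesgue {z. \<delta> \<le> \<bar>v z\<bar>} < ?c / \<theta> ^ ?n"
    "(\<integral>x. indicator {z. \<delta> \<le> \<bar>v z\<bar>} x * norm (gradient v x) powr p \<partial>lebesgue) < \<theta> powr p * Kp"
    "(\<integral>x. indicator {z. \<delta> \<le> \<bar>v z\<bar>} x * norm (gradient v x) powr 2 \<partial>lebesgue) < \<theta> powr 2 * K2"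
    "K' / \<theta> ^ ?n < (\<integral>x. max 0 (\<bar>v x\<bar> - 2 * \<delta>) powr q \<partial>lebesgue)"
    by blast
  obtain M where M: "M > 0" "\<And>x y. \<bar>v x - v y\<bar> \<le> M * norm (x - y)"
    using Cc_infinity_Lipschitz[OF v] by metis
  \<comment> \<open>Here the sign of \<open>K'\<close> enters: with an empty superlevel set the
    \<open>q\<close>-integral would vanish, contradicting its strict lower bound.\<close>
  have ne: "{z. \<delta> \<le> \<bar>v z\<bar>} \<noteq> {}"
  proof
    assume "{z. \<delta> \<le> \<bar>v z\<bar>} = {}"
    then have "\<bar>v z\<bar> < \<delta>" for z by (auto simp: not_le)
    then have "max 0 (\<bar>v z\<bar> - 2 * \<delta>) = 0" for z using \<delta>(1) by (smt (verit))
    then have "(\<integral>x. max 0 (\<bar>v x\<bar> - 2 * \<delta>) powr q \<partial>lebesgue) = 0" using q by simp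
    moreover have "0 \<le> K' / \<theta> ^ ?n" using K(4) \<theta>n by simp
    ultimately show False using \<delta>(5) by linarith
  qed
  obtain r0 where r0: "r0 \<ge> 0" "ball_vol TYPE('a) r0 = measure lebesgue {z. \<delta> \<le> \<bar>v z\<bar>}"
    using ball_vol_surj measure_nonneg by metis
  have \<theta>r: "\<theta> * r0 < \<rho>"
  proof (rule ccontr)
    assume "\<not> \<theta> * r0 < \<rho>"
    then have "?c \<le> ball_vol TYPE('a) (\<theta> * r0)"
      using \<rho>(1) r0(1) \<theta>(4) by (subst ball_vol_le_iff) auto
    also have "\<dots> = \<theta> ^ ?n * measure lebesgue {z. \<delta> \<le> \<bar>v z\<bar>}"
      unfolding r0(2)[symmetric] by (simp add: power_mult_distrib)
    also have "\<dots> < ?c" using \<delta>(2) \<theta>n(1) by (simp add: pos_less_divide_eq mult.commute)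
    finally show False by simp
  qed
  let ?A = "\<lambda>s. \<integral>x. indicator {z. \<delta> \<le> \<bar>v z\<bar>} x * norm (gradient v x) powr s \<partial>lebesgue"
  let ?k = "real DIM('a) * unit_ball_vol (real DIM('a)) * (2 * r0 ^ (DIM('a) - 1))"
  \<comment> \<open>The energy bound of the symmetrization with \<open>t\<close> both as level
    spacing and as smoothing error. As \<open>t\<close> tends to 0, only \<theta>^(-s) times the
    energy of \<open>v\<close> over its superlevel set remains.\<close>
  let ?E = "\<lambda>s t. (1 + t) powr s * \<theta> powr (- s) * (?A s + s * (2 * M) powr (s - 1) * t * ?k)"
  have ev: "\<forall>\<^sub>F t in at_right 0. ?E s t < L" if "?A s < \<theta> powr s * L" for s L
  proof -
    have "((\<lambda>t. ?E s t) \<longlongrightarrow> (1 + 0) powr s * \<theta> powr (- s) * (?A s + s * (2 * M) powr (s - 1) * 0 * ?k)) (at_right 0)"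
      by (intro tendsto_intros) auto
    then have "((\<lambda>t. ?E s t) \<longlongrightarrow> \<theta> powr (- s) * ?A s) (at_right 0)" by simp
    moreover have "\<theta> powr (- s) * ?A s < L"
    proof -
      have "\<theta> powr (- s) * ?A s < \<theta> powr (- s) * (\<theta> powr s * L)"
        using that \<theta>(4) by (intro mult_strict_left_mono) auto
      also have "\<dots> = L" using \<theta>(4) by (simp add: powr_minus field_simps)
      finally show ?thesis .
    qed
    ultimately show ?thesis by (rule order_tendstoD(2))
  qed
  have "\<forall>\<^sub>F t in at_right 0. 0 < t \<and> t < \<delta>"
    using \<delta>(1) by (auto simp: eventually_at_right_field)
  with ev[OF \<delta>(3)] ev[OF \<delta>(4)] have "\<forall>\<^sub>F t in at_right 0. ?E p t < Kp \<and> ?E 2 t < K2 \<and> 0 < t \<and> t < \<delta>"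
    by eventually_elim simp
  from eventually_happens'[OF trivial_limit_at_right_real this]
  obtain t where t: "?E p t < Kp" "?E 2 t < K2" "0 < t" "t < \<delta>"
    by blast
  obtain \<psi> where \<psi>: "\<psi> \<in> Cc_infinity (ball x0 \<rho>)"
    "\<And>s. s > 1 \<Longrightarrow> (\<integral>x. norm (gradient \<psi> x) powr s \<partial>lebesgue) \<le> ?E s t"
    "\<And>q. q > 0 \<Longrightarrow> \<theta> ^ DIM('a) * (\<integral>x. max 0 (\<bar>v x\<bar> - \<delta> - t) powr q \<partial>lebesgue) \<le> (\<integral>x. \<bar>\<psi> x\<bar> powr q \<partial>lebesgue)"
    by (rule symmetrization_step[OF dim v M \<delta>(1) ne r0 \<theta>(4) less_imp_le[OF \<theta>(5)] \<theta>r t(3) t(3), of x0], rule that) blast+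
  have "K' < \<theta> ^ ?n * (\<integral>x. max 0 (\<bar>v x\<bar> - 2 * \<delta>) powr q \<partial>lebesgue)"
    using \<delta>(5) \<theta>n(1) by (simp add: pos_divide_less_eq mult.commute)
  also have "\<dots> \<le> \<theta> ^ ?n * (\<integral>x. max 0 (\<bar>v x\<bar> - \<delta> - t) powr q \<partial>lebesgue)"
  proof (intro mult_left_mono integral_mono)
    show "integrable lebesgue (\<lambda>x. max 0 (\<bar>v x\<bar> - 2 * \<delta>) powr q)"
      "integrable lebesgue (\<lambda>x. max 0 (\<bar>v x\<bar> - \<delta> - t) powr q)"
      using integrable_truncated_Cc_infinity[OF v _ q(1), of "2 * \<delta>"]
        integrable_truncated_Cc_infinity[OF v _ q(1), of "\<delta> + t"] \<delta>(1) t(3) by (simp_all add: diff_diff_eq)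
    show "max 0 (\<bar>v x\<bar> - 2 * \<delta>) powr q \<le> max 0 (\<bar>v x\<bar> - \<delta> - t) powr q" for x
      using t q by (intro powr_mono2) auto
  qed (use \<theta>n in simp)
  also have "\<dots> \<le> (\<integral>x. \<bar>\<psi> x\<bar> powr q \<partial>lebesgue)" by (rule \<psi>(3)[OF q(1)])
  finally have "K' < (\<integral>x. \<bar>\<psi> x\<bar> powr q \<partial>lebesgue)" .
  moreover have "(\<integral>x. norm (gradient \<psi> x) powr p \<partial>lebesgue) < Kp" using \<psi>(2)[of p] p t(1) by simp
  moreover have "(\<integral>x. norm (gradient \<psi> x) powr 2 \<partial>lebesgue) < K2" using le_less_trans[OF \<psi>(2)[of 2] t(2)] by simp
  ultimately show ?thesis using \<psi>(1) by blast
qed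

lemma integral_weak_gradient_on:
  fixes u :: "'a::euclidean_space \<Rightarrow> real"
  assumes D: "open D" and \<Omega>: "\<Omega> \<in> sets lebesgue" "\<Omega> \<subseteq> D" and g: "has_weak_gradient D u g" "g \<in> borel_measurable (lebesgue_on D)"
  shows "(\<integral>x. norm (weak_gradient D u x) powr s \<partial>lebesgue_on \<Omega>) = (\<integral>x. norm (g x) powr s \<partial>lebesgue_on \<Omega>)"
proof (rule integral_lebesgue_on_cong_AE(1)[OF \<Omega>(1)])
  have "g \<in> borel_measurable (lebesgue_on \<Omega>)" using g(2) \<Omega>(2) by (rule measurable_restrict_mono)
  then show "(\<lambda>x. norm (g x) powr s) \<in> borel_measurable (lebesgue_on \<Omega>)" by measurable
  have Ds: "D \<in> sets lebesgue" using D by auto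
  have "AE x in lebesgue. x \<in> D \<longrightarrow> weak_gradient D u x = g x"
    using weak_gradient_AE_eq[OF D g(1)] Ds by (simp add: AE_restrict_space_iff)
  then have "AE x in lebesgue. x \<in> \<Omega> \<longrightarrow> norm (weak_gradient D u x) powr s = norm (g x) powr s"
    by eventually_elim (use \<Omega>(2) in auto)
  then show "AE x in lebesgue_on \<Omega>. norm (weak_gradient D u x) powr s = norm (g x) powr s"
    using \<Omega>(1) by (simp add: AE_restrict_space_iff)
qed

text \<open>A smooth function supported in \<open>U\<close> meets the boundary condition everywhere
  rather than quasi everywhere, and its weak gradient agrees almost everywhere with the classical
  one; so its quotient bounds the infimum.\<close>

lemma lambda1_le_Cc_infinity:
  fixes D :: "'a::euclidean_space set"
  assumes p: "p > 2" and q: "q > 0" and D: "open D" and U: "open U" "U \<subseteq> D" and psi: "\<psi> \<in> Cc_infinity U"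
    and pos: "0 < (\<integral>x. \<bar>\<psi> x\<bar> powr q \<partial>lebesgue)"
  shows "lambda1 p q B D U \<le> ereal (((1 / p) * (\<integral>x. norm (gradient \<psi> x) powr p \<partial>lebesgue) +
      (1 / 2) * (\<integral>x. norm (gradient \<psi> x) powr 2 \<partial>lebesgue)) / ((1 / q) * (\<integral>x. \<bar>\<psi> x\<bar> powr q \<partial>lebesgue)))"
proof -
  have Us: "U \<in> sets lebesgue" and Ds: "D \<in> sets lebesgue" using U D by auto
  have psiD: "\<psi> \<in> Cc_infinity D" using psi Cc_infinity_mono[OF U(2)] by blast
  note out = Cc_infinity_zero_outside[OF psi]
  have gm: "gradient \<psi> \<in> borel_measurable (lebesgue_on D)"
    using integrable_Cc_infinity(2)[OF psi] by (intro measurable_restrict_space1) simp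
  have w: "(\<integral>x. norm (weak_gradient D \<psi> x) powr s \<partial>lebesgue_on U) = (\<integral>x. norm (gradient \<psi> x) powr s \<partial>lebesgue)"
    if "s > 0" for s
  proof -
    have "(\<integral>x. norm (weak_gradient D \<psi> x) powr s \<partial>lebesgue_on U) = (\<integral>x. norm (gradient \<psi> x) powr s \<partial>lebesgue_on U)"
      by (rule integral_weak_gradient_on[OF D Us U(2) has_weak_gradient_Cc_infinity[OF D psiD] gm])
    also have "\<dots> = (\<integral>x. norm (gradient \<psi> x) powr s \<partial>lebesgue)"
      using out(2) that by (intro integral_lebesgue_on_support(1)[OF Us]) simp
    finally show ?thesis .
  qed
  have wq: "(\<integral>x. \<bar>\<psi> x\<bar> powr q \<partial>lebesgue_on U) = (\<integral>x. \<bar>\<psi> x\<bar> powr q \<partial>lebesgue)"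
    using out(1) q by (intro integral_lebesgue_on_support(1)[OF Us]) simp
  have qe: "quasi_everywhere p B (D - U) (\<lambda>x. \<psi> x = 0)"
  proof -
    have "{x \<in> D - U. \<not> \<psi> x = 0} = {}" using out(1) by blast
    moreover have "cap p B {} = 0" using p by (intro cap_empty) simp
    ultimately show ?thesis unfolding quasi_everywhere_def by (simp only:)
  qed
  have cont: "continuous_on D \<psi>"
    using Cc_infinity_gradient(3)[OF psi] continuous_on_subset by blast
  have mem: "\<psi> \<in> W1_0_quasi p B D U"
    unfolding W1_0_quasi_def
    using Cc_infinity_subset_W1_0[OF psiD D] continuous_quasi_continuous_on[OF _ cont] qe p by simp
  have nz: "\<not> (AE x in lebesgue_on D. \<psi> x = 0)"
  proof
    assume "AE x in lebesgue_on D. \<psi> x = 0"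
    then have "AE x in lebesgue. x \<in> D \<longrightarrow> \<psi> x = 0" using Ds by (simp add: AE_restrict_space_iff)
    then have "AE x in lebesgue. \<bar>\<psi> x\<bar> powr q = 0"
      by eventually_elim (use out(1) U(2) in auto)
    then have "(\<integral>x. \<bar>\<psi> x\<bar> powr q \<partial>lebesgue) = 0" by (rule integral_eq_zero_AE)
    with pos show False by simp
  qed
  have sq: "(norm y)\<^sup>2 = norm y powr 2" for y :: 'a by simp
  show ?thesis
    unfolding lambda1_def
  proof (rule INF_lower2[of \<psi>])
    show "\<psi> \<in> {\<phi> \<in> W1_0_quasi p B D U. \<not> (AE x in lebesgue_on D. \<phi> x = 0)}" using mem nz by simp
    have "p > 0" "(2::real) > 0" using p by simp_all
    then show "ereal ((1 / p * (\<integral>x. norm (weak_gradient D \<psi> x) powr p \<partial>lebesgue_on U) +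
        1 / 2 * (\<integral>x. (norm (weak_gradient D \<psi> x))\<^sup>2 \<partial>lebesgue_on U)) / (1 / q * (\<integral>x. \<bar>\<psi> x\<bar> powr q \<partial>lebesgue_on U)))
      \<le> ereal ((1 / p * (\<integral>x. norm (gradient \<psi> x) powr p \<partial>lebesgue) +
        1 / 2 * (\<integral>x. norm (gradient \<psi> x) powr 2 \<partial>lebesgue)) / (1 / q * (\<integral>x. \<bar>\<psi> x\<bar> powr q \<partial>lebesgue)))"
      unfolding sq by (simp only: w wq order_refl)
  qed
qed

text \<open>The infimum for \<Omega> is bounded below one admissible function at a time; if none
  exists, the eigenvalue of \<Omega> is infinite and the claim is trivial. The competitors in the
  ball only approach the quotient of \<open>\<phi>\<close>, hence the arbitrary
  \<open>e\<close>.\<close>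

lemma lambda1_ball_le:
  fixes D B :: "'a::euclidean_space set" and x0 y0 :: 'a
  assumes dim: "DIM('a) \<ge> 2" and p: "p > 2" and q: "0 < q" "q \<le> p"
    and D: "open D" "D \<in> lmeasurable" and B: "B = ball y0 S" "S > 0"
    and \<rho>: "\<rho> > 0" "ball x0 \<rho> \<subseteq> D"
    and \<Omega>: "\<Omega> \<subseteq> D" "quasi_open p B \<Omega>" "emeasure lebesgue \<Omega> \<le> ennreal (ball_vol TYPE('a) \<rho>)"
  shows "lambda1 p q B D (ball x0 \<rho>) \<le> lambda1 p q B D \<Omega>"
proof -
  have Ds: "D \<in> sets lebesgue" using D(2) by (rule fmeasurableD)
  have \<Omega>s: "\<Omega> \<in> sets lebesgue" using quasi_open_lebesgue[OF p B(2)] \<Omega>(2) unfolding B(1) by blast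
  have \<Omega>l: "\<Omega> \<in> lmeasurable" using fmeasurableI2[OF D(2) \<Omega>(1) \<Omega>s] .
  have m\<Omega>: "measure lebesgue \<Omega> \<le> ball_vol TYPE('a) \<rho>"
    using \<Omega>(3) \<rho>(1) by (simp add: emeasure_eq_measure2[OF \<Omega>l])
  have p0: "p > 0" using p by simp
  have sq: "(norm y)\<^sup>2 = norm y powr 2" for y :: 'a by simp
  show ?thesis
    unfolding lambda1_def[of p q B D \<Omega>]
  proof (rule INF_greatest)
    fix \<phi> assume "\<phi> \<in> {\<phi> \<in> W1_0_quasi p B D \<Omega>. \<not> (AE x in lebesgue_on D. \<phi> x = 0)}"
    then have W: "\<phi> \<in> W1_0 p D" and qe: "cap p B {x \<in> D - \<Omega>. \<not> \<phi> x = 0} = 0"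
      and nz: "\<not> (AE x in lebesgue_on D. \<phi> x = 0)"
      by (auto simp: W1_0_quasi_def quasi_everywhere_def)
    obtain g f where g: "has_weak_gradient D \<phi> g" "\<phi> \<in> Lp p D" "g \<in> Lp p D" "\<And>n. f n \<in> Cc_infinity D"
      "(\<lambda>n. \<integral>x. \<bar>\<phi> x - f n x\<bar> powr p \<partial>lebesgue_on D) \<longlonglongrightarrow> 0"
      "(\<lambda>n. \<integral>x. norm (g x - gradient (f n) x) powr p \<partial>lebesgue_on D) \<longlonglongrightarrow> 0"
      by (rule W1_0_approx[OF W D(1) p0], rule that) blast+
    have gm: "g \<in> borel_measurable (lebesgue_on D)" and fm: "\<phi> \<in> borel_measurable (lebesgue_on D)"
      using g(2,3) by (auto simp: Lp_def)
    have "negligible {x \<in> D - \<Omega>. \<not> \<phi> x = 0}"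
      using cap_zero_imp_negligible[OF p B(2)] qe unfolding B(1) by blast
    then have "AE x in lebesgue. x \<notin> {x \<in> D - \<Omega>. \<not> \<phi> x = 0}"
      unfolding negligible_iff_null_sets by (rule AE_not_in)
    then have "AE x in lebesgue. x \<in> D \<longrightarrow> (x \<notin> \<Omega> \<longrightarrow> \<phi> x = 0)"
      by eventually_elim blast
    then have zero: "AE x in lebesgue_on D. x \<notin> \<Omega> \<longrightarrow> \<phi> x = 0"
      using Ds by (simp add: AE_restrict_space_iff)
    define Ip I2 J where "Ip = (\<integral>x. norm (g x) powr p \<partial>lebesgue_on \<Omega>)"
      and "I2 = (\<integral>x. norm (g x) powr 2 \<partial>lebesgue_on \<Omega>)" and "J = (\<integral>x. \<bar>\<phi> x\<bar> powr q \<partial>lebesgue_on D)"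
    have uq: "integrable (lebesgue_on D) (\<lambda>x. \<bar>\<phi> x\<bar> powr q)"
      using integrable_lower_powr[OF finite_measure_lebesgue_on[OF D(2)] fm _ q] g(2) by (simp add: Lp_def)
    have J\<Omega>: "(\<integral>x. \<bar>\<phi> x\<bar> powr q \<partial>lebesgue_on \<Omega>) = J"
    proof -
      have ind: "integrable (lebesgue_on D) (\<lambda>x. indicator \<Omega> x * \<bar>\<phi> x\<bar> powr q)"
        using integrable_mult_indicator[OF _ uq, of \<Omega>] \<Omega>s \<Omega>(1) Ds by (simp add: sets_restrict_space_iff)
      have "J = (\<integral>x. indicator \<Omega> x * \<bar>\<phi> x\<bar> powr q \<partial>lebesgue_on D)"
        unfolding J_def
      proof (rule integral_cong_AE)
        show "AE x in lebesgue_on D. \<bar>\<phi> x\<bar> powr q = indicator \<Omega> x * \<bar>\<phi> x\<bar> powr q"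
          using zero by eventually_elim (auto simp: indicator_def)
      qed (use uq ind in \<open>auto intro: borel_measurable_integrable\<close>)
      also have "\<dots> = (\<integral>x. \<bar>\<phi> x\<bar> powr q \<partial>lebesgue_on \<Omega>)"
        by (rule integral_lebesgue_on_subset[OF \<Omega>s Ds \<Omega>(1)])
      finally show ?thesis ..
    qed
    have J: "J > 0"
    proof -
      have "J \<noteq> 0"
      proof
        assume "J = 0"
        then have "AE x in lebesgue_on D. \<bar>\<phi> x\<bar> powr q = 0"
          using integral_nonneg_eq_0_iff_AE[OF uq] by (simp add: J_def)
        then have "AE x in lebesgue_on D. \<phi> x = 0" by eventually_elim simp
        with nz show False by simp
      qed
      moreover have "J \<ge> 0" unfolding J_def by (simp add: integral_nonneg_AE)
      ultimately show ?thesis by simp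
    qed
    let ?Q = "(1 / p * Ip + 1 / 2 * I2) / (1 / q * J)"
    have "lambda1 p q B D (ball x0 \<rho>) \<le> ereal ?Q + ereal e" if e: "e > 0" for e
    proof -
      \<comment> \<open>All three integrals are moved by \<open>t\<close> in the unfavourable
        direction. Since \<open>J\<close> is positive, the quotient is continuous at
        \<open>t = 0\<close>, so a small \<open>t\<close> costs less than \<open>e\<close>.\<close>
      let ?f = "\<lambda>t. (1 / p * (Ip + t) + 1 / 2 * (I2 + t)) / (1 / q * (J - t))"
      have "(?f \<longlongrightarrow> (1 / p * (Ip + 0) + 1 / 2 * (I2 + 0)) / (1 / q * (J - 0))) (at_right 0)"
        using J q by (intro tendsto_intros) auto
      then have "\<forall>\<^sub>F t in at_right 0. ?f t < ?Q + e"
        by (rule order_tendstoD(2)) (use e in simp)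
      moreover have "\<forall>\<^sub>F t in at_right 0. 0 < t \<and> t < J"
        using J by (auto simp: eventually_at_right_field)
      ultimately have "\<forall>\<^sub>F t in at_right 0. ?f t < ?Q + e \<and> 0 < t \<and> t < J"
        by eventually_elim simp
      from eventually_happens'[OF trivial_limit_at_right_real this]
      obtain t where t: "?f t < ?Q + e" "0 < t" "t < J"
        by blast
      have "\<exists>\<psi>\<in>Cc_infinity (ball x0 \<rho>). (\<integral>x. norm (gradient \<psi> x) powr p \<partial>lebesgue) < Ip + t \<and>
        (\<integral>x. norm (gradient \<psi> x) powr 2 \<partial>lebesgue) < I2 + t \<and> J - t < (\<integral>x. \<bar>\<psi> x\<bar> powr q \<partial>lebesgue)"
        using t(2,3)
        by (intro rearranged_competitor[OF dim D p q g(2-6) \<Omega>s \<Omega>(1) zero \<rho>(1) m\<Omega>]) (auto simp: Ip_def I2_def J_def)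
      then obtain \<psi> where psi: "\<psi> \<in> Cc_infinity (ball x0 \<rho>)"
        "(\<integral>x. norm (gradient \<psi> x) powr p \<partial>lebesgue) < Ip + t"
        "(\<integral>x. norm (gradient \<psi> x) powr 2 \<partial>lebesgue) < I2 + t" "J - t < (\<integral>x. \<bar>\<psi> x\<bar> powr q \<partial>lebesgue)" by blast
      have Jt: "0 < 1 / q * (J - t)" using t q by simp
      have nn: "0 \<le> 1 / p * (\<integral>x. norm (gradient \<psi> x) powr p \<partial>lebesgue) + 1 / 2 * (\<integral>x. norm (gradient \<psi> x) powr 2 \<partial>lebesgue)"
        using p0 by (intro add_nonneg_nonneg mult_nonneg_nonneg integral_nonneg_AE) auto
      have num: "1 / p * (\<integral>x. norm (gradient \<psi> x) powr p \<partial>lebesgue) + 1 / 2 * (\<integral>x. norm (gradient \<psi> x) powr 2 \<partial>lebesgue)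
          \<le> 1 / p * (Ip + t) + 1 / 2 * (I2 + t)"
        using psi(2,3) p0 by (intro add_mono mult_left_mono) auto
      have "0 < (\<integral>x. \<bar>\<psi> x\<bar> powr q \<partial>lebesgue)" using psi(4) t(3) by linarith
      from lambda1_le_Cc_infinity[OF p q(1) D(1) open_ball \<rho>(2) psi(1) this, of B]
      have "lambda1 p q B D (ball x0 \<rho>) \<le> ereal ((1 / p * (\<integral>x. norm (gradient \<psi> x) powr p \<partial>lebesgue) +
        1 / 2 * (\<integral>x. norm (gradient \<psi> x) powr 2 \<partial>lebesgue)) / (1 / q * (\<integral>x. \<bar>\<psi> x\<bar> powr q \<partial>lebesgue)))" .
      also have "\<dots> \<le> ereal (?f t)"
        unfolding ereal_less_eq
      proof (rule frac_le[OF order_trans[OF nn num] num Jt])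
        show "1 / q * (J - t) \<le> 1 / q * (\<integral>x. \<bar>\<psi> x\<bar> powr q \<partial>lebesgue)"
          using psi(4) q by (intro mult_left_mono) auto
      qed
      also have "\<dots> \<le> ereal (?Q + e)" using t(1) by simp
      finally show ?thesis by simp
    qed
    then have Q: "lambda1 p q B D (ball x0 \<rho>) \<le> ereal ?Q"
      by (rule ereal_le_epsilon2)
    have w: "(\<integral>x. norm (weak_gradient D \<phi> x) powr s \<partial>lebesgue_on \<Omega>) = (\<integral>x. norm (g x) powr s \<partial>lebesgue_on \<Omega>)" for s
      by (rule integral_weak_gradient_on[OF D(1) \<Omega>s \<Omega>(1) g(1) gm])
    show "lambda1 p q B D (ball x0 \<rho>) \<le> ereal ((1 / p * (\<integral>x. norm (weak_gradient D \<phi> x) powr p \<partial>lebesgue_on \<Omega>) +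
        1 / 2 * (\<integral>x. (norm (weak_gradient D \<phi> x))\<^sup>2 \<partial>lebesgue_on \<Omega>)) / (1 / q * (\<integral>x. \<bar>\<phi> x\<bar> powr q \<partial>lebesgue_on \<Omega>)))"
      unfolding sq w J\<Omega> using Q unfolding Ip_def I2_def .
  qed
qed

theorem theorem3p1:
  fixes p q c :: real and D B :: "'a::euclidean_space set"
    and x0 y0 :: 'a and R S :: real
  assumes "DIM('a) \<ge> 2"
    and "p > q" and "q \<ge> 2"
    and "D = ball x0 R" and "R > 0"
    and "B = ball y0 S" and "D \<subseteq> B"
    and "0 < c" and "c < measure lebesgue D"
  shows "\<exists>\<Omega>. is_arg_min (lambda1 p q B D)
           (\<lambda>\<Omega>. \<Omega> \<in> quasi_open_subsets p B D \<and> emeasure lebesgue \<Omega> \<le> ennreal c) \<Omega>"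
proof -
  \<comment> \<open>The radius of the ball of volume \<open>c\<close>. As \<open>c\<close> is less
    than the volume of \<open>D\<close>, this ball, centred at \<open>x0\<close>, lies in
    \<open>D\<close>; it uses up the whole volume allowed.\<close>
  obtain \<rho> where \<rho>: "\<rho> \<ge> 0" "ball_vol TYPE('a) \<rho> = c"
    using ball_vol_surj[of c] \<open>0 < c\<close> by (metis less_imp_le)
  have "\<rho> \<noteq> 0" using \<rho>(2) \<open>0 < c\<close> by (auto simp: power_0_left)
  then have \<rho>0: "\<rho> > 0" using \<rho>(1) by simp
  have mD: "measure lebesgue D = ball_vol TYPE('a) R"
    unfolding \<open>D = ball x0 R\<close> using \<open>R > 0\<close> by (intro measure_ball_0) simp
  have "\<rho> \<le> R"
    using ball_vol_le_iff[of \<rho> R, where 'a='a] \<rho> \<open>R > 0\<close> \<open>c < measure lebesgue D\<close> mD by simp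
  then have sub: "ball x0 \<rho> \<subseteq> D" unfolding \<open>D = ball x0 R\<close> by (rule subset_ball)
  have S: "S > 0"
  proof (rule ccontr)
    assume "\<not> S > 0"
    then have "B = {}" unfolding \<open>B = ball y0 S\<close> by simp
    then show False using \<open>D \<subseteq> B\<close> \<open>D = ball x0 R\<close> \<open>R > 0\<close> by simp
  qed
  have p: "p > 2" "0 < q" "q \<le> p" using \<open>p > q\<close> \<open>q \<ge> 2\<close> by simp_all
  have D: "open D" "D \<in> lmeasurable" unfolding \<open>D = ball x0 R\<close> by simp_all
  have em: "emeasure lebesgue (ball x0 \<rho>) = ennreal c"
    using measure_ball_0[OF \<rho>(1), of x0] \<rho>(2) by (simp only: emeasure_eq_measure2[OF lmeasurable_ball])
  have feasible: "ball x0 \<rho> \<in> quasi_open_subsets p B D" "emeasure lebesgue (ball x0 \<rho>) \<le> ennreal c"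
    using sub open_quasi_open[of p "ball x0 \<rho>" B] p em by (auto simp: quasi_open_subsets_def)
  have "lambda1 p q B D (ball x0 \<rho>) \<le> lambda1 p q B D \<Omega>"
    if "\<Omega> \<in> quasi_open_subsets p B D" "emeasure lebesgue \<Omega> \<le> ennreal c" for \<Omega>
    using that \<rho>(2)
    by (intro lambda1_ball_le[OF \<open>DIM('a) \<ge> 2\<close> p D \<open>B = ball y0 S\<close> S \<rho>0 sub]) (auto simp: quasi_open_subsets_def)
  then have "is_arg_min (lambda1 p q B D)
      (\<lambda>\<Omega>. \<Omega> \<in> quasi_open_subsets p B D \<and> emeasure lebesgue \<Omega> \<le> ennreal c) (ball x0 \<rho>)"
    unfolding is_arg_min_def using feasible by (auto simp: not_less)
  then show ?thesis by blast
qed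

end
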